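(* (1) If compositions $\alpha$ and $\beta$ are related by switching, then $\mathcal{H}(\alpha)=\mathcal{H}(\beta)$, and consequently the caterpillars $\mathrm{Cat}(1\odot\alpha\odot1)$ and $\mathrm{Cat}(1\odot\beta\odot1)$ have the same half-generalized degree polynomial. (2) If $\alpha$ has $q$ irreducible factors that are not palindromes, then there are at least $2^{q-1}$ compositions $\beta$ with $\mathcal{H}(\beta)=\mathcal{H}(\alpha)$, no two of which are equal or reverses of each other. Moreover, $\mathrm{Cat}(1\odot\alpha\odot1)$ is one of at least $2^{q-1}$ pairwise non-isomorphic caterpillars with the same half-generalized degree polynomial, equivalently with the same subtree polynomial. In particular, there exist arbitrarily large sets of pairwise non-isomorphic caterpillars with the same half-generalized degree polynomial and the same subtree polynomial.
   Context: A composition is a finite sequence $\alpha=(a_1,\dots,a_k)$ of positive integers, with length $\ell(\alpha)=k$. Its reverse is $\alpha^*=(a_k,\dots,a_1)$, and it is a palindrome if $\alpha=\alpha^*$. For compositions of equal size, $\gamma\ge\alpha$ means every partial sum $g_1+\dots+g_j$ of $\gamma$ is a partial sum of $\alpha$. Concatenation is $(a_1,\dots,a_k)\cdot(b_1,\dots,b_m)=(a_1,\dots,a_k,b_1,\dots,b_m)$ and near-concatenation is $(a_1,\dots,a_k)\odot(b_1,\dots,b_m)=(a_1,\dots,a_{k-1},a_k+b_1,b_2,\dots,b_m)$. Write $\beta^{\odot i}$ for the $i$-fold near-concatenation of $\beta$, and $\alpha\circ\beta=\beta^{\odot a_1}\cdot\beta^{\odot a_2}\cdots\beta^{\odot a_k}$.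 A factorization $\alpha=\alpha_1\circ\cdots\circ\alpha_k$ is nontrivial if no $\alpha_i$ equals the composition $(1)$, no two consecutive factors both have length 1, and no two consecutive factors both have all parts equal to 1. It is irreducible if it is nontrivial and no $\alpha_i$ admits a nontrivial factorization. It is known (Billera–Thomas–van Willigenburg) that every composition has a unique irreducible factorization; its factors are the irreducible factors of $\alpha$. If $\alpha$ has irreducible factorization $\alpha_1\circ\cdots\circ\alpha_k$, a switch of $\alpha$ is any composition $\beta_1\circ\cdots\circ\beta_k$ with each $\beta_i\in\{\alpha_i,\alpha_i^*\}$. Two compositions are related by switching if one is a switch of the other. Define \[\mathcal{H}(\alpha)=\sum_{\gamma\ge\alpha}\frac{y^{\ell(\gamma)-1}z^{\ell(\alpha)-\ell(\gamma)}}{(y+z)^{\ell(\alpha)-1}}\sum_{i=1}^{\ell(\gamma)}x_{\gamma_i}.\] For a composition $(c_1,\dots,c_k)$ with $c_1,c_k\ge2$, the caterpillar $\mathrm{Cat}(c_1,\dots,c_k)$ is a path $v_1,\dots,v_k$ with each $v_i$ additionally adjacent to $c_i-1$ leaves. The composition $1\odot\alpha\odot1$ is $\alpha$ with $1$ added to its first and last parts. For a tree $T$, a subtree is a connected subgraph with nonempty vertex set. For a subtree $S$, $e(S)$ is the number of edges of $T$ with both endpoints in $S$, $d(S)$ the number with exactly one endpoint in $S$, and $\ell(S)$ the number of edges of $S$ having an endpoint that is a leaf of $S$. The half-generalized degree polynomial is $\sum_S y^{d(S)}z^{e(S)}$ and the subtree polynomial is $\sum_S q^{e(S)}r^{\ell(S)}$,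 both summed over all subtrees $S$. *)

theory Defs
  imports
    "HOL-Library.Poly_Mapping"
    "HOL-Computational_Algebra.Polynomial"
    "HOL-Computational_Algebra.Fraction_Field"
    "Graph_Theory.Digraph_Isomorphism"
begin

section \<open>Compositions\<close>

definition composition :: "nat list \<Rightarrow> bool" where
  "composition \<alpha> \<longleftrightarrow> \<alpha> \<noteq> [] \<and> (\<forall>a\<in>set \<alpha>. 0 < a)"

definition palindrome :: "nat list \<Rightarrow> bool" where
  "palindrome \<alpha> \<longleftrightarrow> rev \<alpha> = \<alpha>"

definition partial_sums :: "nat list \<Rightarrow> nat set" where
  "partial_sums \<alpha> = {sum_list (take j \<alpha>) | j. 1 \<le> j \<and> j \<le> length \<alpha>}"

text \<open>The compositions \<open>\<gamma>\<close> with \<open>\<gamma> \<ge> \<alpha>\<close>; for a composition \<open>\<alpha>\<close> this is a finite set.\<close>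

definition coarsenings :: "nat list \<Rightarrow> nat list set" where
  "coarsenings \<alpha> = {\<gamma>. composition \<gamma> \<and> sum_list \<gamma> = sum_list \<alpha> \<and>
                       partial_sums \<gamma> \<subseteq> partial_sums \<alpha>}"

text \<open>Concatenation of compositions is \<^term>\<open>(@)\<close>. Only nonempty arguments matter for
  near-concatenation; taking the empty list as a neutral element lets powers be written as a fold.\<close>

definition near_concat :: "nat list \<Rightarrow> nat list \<Rightarrow> nat list" (infixr "\<odot>" 65) where
  "\<alpha> \<odot> \<beta> = (if \<alpha> = [] then \<beta> else if \<beta> = [] then \<alpha>
            else butlast \<alpha> @ [last \<alpha> + hd \<beta>] @ tl \<beta>)"

definition near_power :: "nat list \<Rightarrow> nat \<Rightarrow> nat list" where
  "near_power \<beta> i = foldr (\<odot>) (replicate i \<beta>) []"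

definition comp_circ :: "nat list \<Rightarrow> nat list \<Rightarrow> nat list" (infixr "\<circ>\<^sub>c" 70) where
  "\<alpha> \<circ>\<^sub>c \<beta> = concat (map (near_power \<beta>) \<alpha>)"

text \<open>The product of a list of factors. The composition \<open>(1)\<close> is a two-sided identity of \<open>\<circ>\<^sub>c\<close>, so it
  is the empty product, and for a nonempty list starting the fold with it has no effect.\<close>

definition circ_list :: "nat list list \<Rightarrow> nat list" where
  "circ_list as = foldr (\<circ>\<^sub>c) as [1]"

definition factorization :: "nat list \<Rightarrow> nat list list \<Rightarrow> bool" where
  "factorization \<alpha> as \<longleftrightarrow> (\<forall>a\<in>set as. composition a) \<and> \<alpha> = circ_list as"

definition nontrivial_factorization :: "nat list \<Rightarrow> nat list list \<Rightarrow> bool" where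
  "nontrivial_factorization \<alpha> as \<longleftrightarrow>
     factorization \<alpha> as \<and> [1] \<notin> set as \<and>
     successively (\<lambda>a b. \<not> (length a = 1 \<and> length b = 1)) as \<and>
     successively (\<lambda>a b. \<not> (set a = {1} \<and> set b = {1})) as"

text \<open>A factor \<open>a\<close> must have no nontrivial factorization into two or more factors; the one-factor
  factorization \<open>[a]\<close>, which every composition other than \<open>(1)\<close> has, does not count. The
  composition \<open>(1)\<close> itself has the empty irreducible factorization.\<close>

definition irreducible_factorization :: "nat list \<Rightarrow> nat list list \<Rightarrow> bool" where
  "irreducible_factorization \<alpha> as \<longleftrightarrow>
     nontrivial_factorization \<alpha> as \<and>
     (\<forall>a\<in>set as. \<not> (\<exists>bs. 2 \<le> length bs \<and> nontrivial_factorization a bs))"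

definition is_switch_of :: "nat list \<Rightarrow> nat list \<Rightarrow> bool" where
  "is_switch_of \<beta> \<alpha> \<longleftrightarrow>
     (\<exists>as bs. irreducible_factorization \<alpha> as \<and> list_all2 (\<lambda>b a. b = a \<or> b = rev a) bs as \<and>
              \<beta> = circ_list bs)"

definition switching_related :: "nat list \<Rightarrow> nat list \<Rightarrow> bool" where
  "switching_related \<alpha> \<beta> \<longleftrightarrow> is_switch_of \<beta> \<alpha> \<or> is_switch_of \<alpha> \<beta>"


section \<open>The polynomial \<open>\<H>(\<alpha>)\<close>\<close>

text \<open>Polynomials over the integers in two variables are represented by \<^typ>\<open>int poly poly\<close>.
  The inner variable \<open>var1\<close> is \<open>y\<close> (or \<open>q\<close>), the outer variable \<open>var2\<close> is \<open>z\<close> (or \<open>r\<close>).\<close>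

definition var1 :: "int poly poly" where "var1 = [:[:0, 1:]:]"
definition var2 :: "int poly poly" where "var2 = [:0, 1:]"

text \<open>Polynomials in \<open>x\<^sub>0, x\<^sub>1, \<dots>\<close> over a ring are finitely supported maps from exponent vectors to
  coefficients; multiplication on \<^type>\<open>poly_mapping\<close> is convolution.\<close>

type_synonym 'a mpoly = "(nat \<Rightarrow>\<^sub>0 nat) \<Rightarrow>\<^sub>0 'a"

definition X :: "nat \<Rightarrow> 'a::comm_ring_1 mpoly" where
  "X i = Poly_Mapping.single (Poly_Mapping.single i 1) 1"

definition C :: "'a \<Rightarrow> 'a::comm_ring_1 mpoly" where
  "C c = Poly_Mapping.single 0 c"

text \<open>\<open>\<H>(\<alpha>)\<close> is a polynomial in the \<open>x\<^sub>i\<close> whose coefficients are rational functions in \<open>y\<close> and \<open>z\<close>.\<close>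

definition H_poly :: "nat list \<Rightarrow> int poly poly fract mpoly" where
  "H_poly \<alpha> =
     (let y = Fract var1 1; z = Fract var2 1 in
      \<Sum>\<gamma>\<in>coarsenings \<alpha>.
        C (y ^ (length \<gamma> - 1) * z ^ (length \<alpha> - length \<gamma>) / (y + z) ^ (length \<alpha> - 1))
        * (\<Sum>i<length \<gamma>. X (\<gamma> ! i)))"


section \<open>Graphs and caterpillars\<close>

text \<open>A graph is a \<^type>\<open>pair_pre_digraph\<close> satisfying \<^locale>\<open>pair_graph\<close> (finite, loopless,
  symmetric): every undirected edge is a pair of opposite arcs.

  \<open>Cat c\<close> has the spine vertices \<open>v\<^sub>i = (i, 0)\<close> and, attached to each \<open>v\<^sub>i\<close>, the \<open>c ! i - 1\<close> leaves
  \<open>(i, j)\<close> with \<open>0 < j < c ! i\<close>.\<close>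

definition Cat_arcs :: "nat list \<Rightarrow> (nat \<times> nat) rel" where
  "Cat_arcs c = {((i, 0), (Suc i, 0)) | i. Suc i < length c} \<union>
                {((i, 0), (i, j)) | i j. i < length c \<and> 0 < j \<and> j < c ! i}"

definition Cat :: "nat list \<Rightarrow> (nat \<times> nat) pair_pre_digraph" where
  "Cat c = \<lparr> pverts = {(i, j). i < length c \<and> j < c ! i},
             parcs = Cat_arcs c \<union> (Cat_arcs c)\<inverse> \<rparr>"

definition caterpillars :: "(nat \<times> nat) pair_pre_digraph set" where
  "caterpillars = {Cat c | c. composition c \<and> 2 \<le> hd c \<and> 2 \<le> last c}"

definition isomorphic :: "'a pair_pre_digraph \<Rightarrow> 'b pair_pre_digraph \<Rightarrow> bool" where
  "isomorphic G K \<longleftrightarrow> digraph_iso (with_proj G) (with_proj K)"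

definition edges :: "'a pair_pre_digraph \<Rightarrow> 'a set set" where
  "edges G = {{u, v} | u v. (u, v) \<in> parcs G}"

text \<open>\<^const>\<open>Digraph_Component.connected\<close> includes that the vertex set is nonempty. Requiring
  \<^locale>\<open>pair_graph\<close> excludes sub-digraphs containing an arc without its opposite.\<close>

definition subtrees :: "'a pair_pre_digraph \<Rightarrow> 'a pair_pre_digraph set" where
  "subtrees T = {S. pair_graph S \<and> subgraph (with_proj S) (with_proj T) \<and>
                    Digraph_Component.connected (with_proj S)}"

definition num_edges_in :: "'a pair_pre_digraph \<Rightarrow> 'a pair_pre_digraph \<Rightarrow> nat" where
  "num_edges_in T S = card {e \<in> edges T. e \<subseteq> pverts S}"

definition num_edges_boundary :: "'a pair_pre_digraph \<Rightarrow> 'a pair_pre_digraph \<Rightarrow> nat" where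
  "num_edges_boundary T S = card {e \<in> edges T. card (e \<inter> pverts S) = 1}"

definition leaf :: "'a pair_pre_digraph \<Rightarrow> 'a \<Rightarrow> bool" where
  "leaf S v \<longleftrightarrow> v \<in> pverts S \<and> card {e \<in> edges S. v \<in> e} = 1"

definition num_leaf_edges :: "'a pair_pre_digraph \<Rightarrow> nat" where
  "num_leaf_edges S = card {e \<in> edges S. \<exists>v\<in>e. leaf S v}"

definition half_gen_degree_poly :: "'a pair_pre_digraph \<Rightarrow> int poly poly" where
  "half_gen_degree_poly T =
     (\<Sum>S\<in>subtrees T. var1 ^ num_edges_boundary T S * var2 ^ num_edges_in T S)"

definition subtree_poly :: "'a pair_pre_digraph \<Rightarrow> int poly poly" where
  "subtree_poly T = (\<Sum>S\<in>subtrees T. var1 ^ num_edges_in T S * var2 ^ num_leaf_edges S)"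

end

theory Submission
  imports Defs
begin

text \<open>Put \<open>v = y / (y + z)\<close> and \<open>w = z / (y + z)\<close>, so that \<open>v + w = 1\<close>. Then \<open>\<H>(\<alpha>)\<close> is the expected value of
  \<open>\<Sum>i. x\<^sub>\<gamma>\<^sub>i\<close> for the random coarsening \<open>\<gamma>\<close> of \<open>\<alpha>\<close> that keeps each interior partial sum with probability \<open>v\<close>.
  Replacing \<open>x\<^sub>a\<close> by \<open>max (a - d) 0\<close> turns this expectation into the sum, over all windows of \<open>d\<close> consecutive
  integers strictly between \<open>0\<close> and the size of \<open>\<alpha>\<close>, of \<open>w\<close> to the number of partial sums of \<open>\<alpha>\<close> in the window.
  These window sums determine \<open>\<H>(\<alpha>)\<close>, since the indicator of \<open>a = e\<close> is a second difference of such functions.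
  They are invariant under reversal, and the window sums of \<open>\<alpha> \<circ> \<beta>\<close> depend on \<open>\<alpha>\<close> only through its size and window
  sums; as \<open>(\<alpha> \<circ> \<beta>)\<^sup>* = \<alpha>\<^sup>* \<circ> \<beta>\<^sup>*\<close>, each factor of a product can be reversed without changing them.

  The half-generalized degree polynomial of \<open>Cat(1 \<odot> \<alpha> \<odot> 1)\<close> is, up to the contribution of the one-leaf subtrees,
  \<open>y + z\<close> times the same expectation with \<open>x\<^sub>a = (y + z)\<^sup>a\<close>. Sizes and partial sums recover the factors of a
  product from the product, so the \<open>2\<^sup>q\<close> switches are distinct and at least \<open>2\<^bsup>q - 1\<^esup>\<close> remain up to reversal.
  Finally, an isomorphism of caterpillars maps the spine to the spine, hence preserves or reverses the composition.\<close>

subsection \<open>Sums over coarsenings\<close>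

text \<open>Windows appear because a window lies inside a single block exactly when no partial sum
  in it is kept. This has probability \<open>w\<close> to their number, so an expectation over
  coarsenings becomes a sum over positions, and there remainders modulo the size of
  \<open>\<beta>\<close> separate the two factors of a product.

  The sums live in an arbitrary commutative ring with \<open>v + w = 1\<close> because they are used
  twice: over polynomials with rational functions as coefficients for \<open>H_poly\<close>, and
  over the rationals for the degree polynomial, evaluated at positive integers so that
  \<open>y + z\<close> is invertible.

  The subtree polynomial has no direct link to \<open>H_poly\<close>. It is reached from the
  half-generalized degree polynomial by substituting \<open>1 + q * (r - 1)\<close> for
  \<open>y\<close> and \<open>q\<close> for \<open>z\<close> and subtracting a term that depends,
  apart from \<open>q\<close> and \<open>r\<close>, only on the number of edges. Since either
  polynomial determines the number of vertices, they carry the same information.\<close>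

text \<open>If \<open>v + w = 1\<close>, then \<open>coarse_sum v w f \<alpha>\<close> is the expected value of \<open>\<Sum>i. f \<gamma>\<^sub>i\<close> for the random coarsening \<open>\<gamma>\<close> of \<open>\<alpha>\<close>,
  \<open>first_block v w f a r\<close> the one of \<open>f \<gamma>\<^sub>1\<close> for the composition \<open>a # r\<close>, and \<open>blocks_sum\<close> adds up the latter over
  all possible starting points of a block.\<close>

fun first_block :: "'a::comm_ring_1 \<Rightarrow> 'a \<Rightarrow> (nat \<Rightarrow> 'a) \<Rightarrow> nat \<Rightarrow> nat list \<Rightarrow> 'a" where
  "first_block v w f a [] = f a"
| "first_block v w f a (b # r) = v * f a + w * first_block v w f (a + b) r"

fun blocks_sum :: "'a::comm_ring_1 \<Rightarrow> 'a \<Rightarrow> (nat \<Rightarrow> 'a) \<Rightarrow> nat list \<Rightarrow> 'a" where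
  "blocks_sum v w f [] = 0"
| "blocks_sum v w f (a # r) = first_block v w f a r + blocks_sum v w f r"

fun coarse_sum :: "'a::comm_ring_1 \<Rightarrow> 'a \<Rightarrow> (nat \<Rightarrow> 'a) \<Rightarrow> nat list \<Rightarrow> 'a" where
  "coarse_sum v w f [] = 0"
| "coarse_sum v w f (a # r) = first_block v w f a r + v * blocks_sum v w f r"

text \<open>Condition on whether the partial sum \<open>a\<close> is kept. Blocks starting inside
  \<open>r\<close> contribute \<open>v * blocks_sum v w f r\<close> in either case, which is where
  \<open>v + w = 1\<close> enters.\<close>

lemma coarse_sum_Cons_Cons:
  assumes "v + w = 1"
  shows "coarse_sum v w f (a # b # r) =
    v * (f a + coarse_sum v w f (b # r)) + w * coarse_sum v w f ((a + b) # r)"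
proof -
  have "v * blocks_sum v w f r = (v + w) * (v * blocks_sum v w f r)" using assms by simp
  then show ?thesis by (simp add: algebra_simps)
qed

section \<open>Partial sums and the recursion for coarsenings\<close>

lemma partial_sums_Nil [simp]: "partial_sums [] = {}"
  by (simp add: partial_sums_def)

lemma partial_sums_Cons [simp]: "partial_sums (a # r) = insert a ((+) a ` partial_sums r)"
proof -
  have "{j. 1 \<le> j \<and> j \<le> length (a # r)} = insert 1 (Suc ` {j. 1 \<le> j \<and> j \<le> length r})"
    by (auto simp: image_iff) presburger
  moreover have "partial_sums xs = (\<lambda>j. sum_list (take j xs)) ` {j. 1 \<le> j \<and> j \<le> length xs}" for xs
    by (auto simp: partial_sums_def)
  ultimately show ?thesis by (simp add: image_image)
qed

lemma composition_Cons: "composition (a # r) \<longleftrightarrow> 0 < a \<and> (r = [] \<or> composition r)"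
  by (auto simp: composition_def)

lemma composition_Nil [simp]: "\<not> composition []"
  by (simp add: composition_def)

lemma partial_sums_pos: "composition \<alpha> \<Longrightarrow> p \<in> partial_sums \<alpha> \<Longrightarrow> 0 < p"
  by (cases \<alpha>) (auto simp: composition_Cons)

lemma partial_sums_le: "p \<in> partial_sums \<alpha> \<Longrightarrow> p \<le> sum_list \<alpha>"
  by (induction \<alpha> arbitrary: p) auto

lemma sum_list_in_partial_sums: "\<alpha> \<noteq> [] \<Longrightarrow> sum_list \<alpha> \<in> partial_sums \<alpha>"
proof (induction \<alpha>)
  case (Cons a r)
  then show ?case by (cases "r = []") auto
qed simp

lemma sum_list_pos: "composition \<alpha> \<Longrightarrow> 0 < sum_list \<alpha>"
  by (cases \<alpha>) (auto simp: composition_Cons)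

lemma image_add_subset_iff: "(+) (a::nat) ` A \<subseteq> (+) a ` B \<longleftrightarrow> A \<subseteq> B"
  by (auto simp: image_iff subset_iff)

text \<open>The first part is the least partial sum, and the others are shifted by it. Equality of
  products and reversals is proved through partial sums below, because both operations act simply on
  them.\<close>

lemma composition_eqI:
  assumes "composition \<alpha>" "composition \<beta>" "partial_sums \<alpha> = partial_sums \<beta>"
  shows "\<alpha> = \<beta>"
  using assms
proof (induction \<alpha> arbitrary: \<beta>)
  case Nil
  then show ?case by simp
next
  case (Cons a r)
  obtain b s where \<beta>: "\<beta> = b # s" using Cons.prems(2) by (cases \<beta>) auto
  have least: "(LEAST p. p \<in> partial_sums (a # r)) = a" for a r
    by (rule Least_equality) auto
  have "a = (LEAST p. p \<in> partial_sums (a # r))" by (rule least[symmetric])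
  also have "\<dots> = b" unfolding Cons.prems(3) \<beta> by (rule least)
  finally have ab: "a = b" .
  have pos: "0 < a" using Cons.prems by (simp add: composition_Cons)
  have nin: "a \<notin> (+) a ` partial_sums t" if "t = [] \<or> composition t" for t
    using that partial_sums_pos by force
  have "(+) a ` partial_sums r = (+) a ` partial_sums s"
    using Cons.prems nin[of r] nin[of s] unfolding \<beta> ab composition_Cons partial_sums_Cons
    by (metis insert_ident)
  then have ps: "partial_sums r = partial_sums s"
    by (auto simp: image_add_subset_iff set_eq_subset)
  have "r = s"
  proof (cases "r = [] \<or> s = []")
    case True
    then show ?thesis using ps by (metis partial_sums_Nil sum_list_in_partial_sums empty_iff)
  next
    case False
    then show ?thesis using Cons.IH[of s] Cons.prems ps unfolding \<beta> composition_Cons by auto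
  qed
  then show ?case by (simp add: \<beta> ab)
qed

lemma coarsenings_singleton: "0 < a \<Longrightarrow> coarsenings [a] = {[a]}"
proof
  assume "0 < a"
  then show "{[a]} \<subseteq> coarsenings [a]" by (auto simp: coarsenings_def composition_Cons)
  show "coarsenings [a] \<subseteq> {[a]}"
  proof
    fix \<gamma> assume g: "\<gamma> \<in> coarsenings [a]"
    then have "composition \<gamma>" "partial_sums \<gamma> \<subseteq> {a}" "\<gamma> \<noteq> []" by (auto simp: coarsenings_def)
    then have "partial_sums \<gamma> = partial_sums [a]"
      using sum_list_in_partial_sums[of \<gamma>] by auto
    then show "\<gamma> \<in> {[a]}" using composition_eqI[OF \<open>composition \<gamma>\<close>, of "[a]"] \<open>0 < a\<close>
      by (simp add: composition_Cons)
  qed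
qed

text \<open>A coarsening has the partial sum \<open>a\<close> or loses it, and in the latter case it
  coarsens the composition with the first two parts merged. Merging is not a structural step on
  lists, so the inductions based on it run over the length.\<close>

lemma coarsenings_Cons_Cons:
  assumes "composition (a # b # r)"
  shows "coarsenings (a # b # r) = (#) a ` coarsenings (b # r) \<union> coarsenings ((a + b) # r)"
    and "(#) a ` coarsenings (b # r) \<inter> coarsenings ((a + b) # r) = {}"
proof -
  have pos: "0 < a" "0 < b" and r: "r = [] \<or> composition r"
    using assms by (auto simp: composition_Cons)
  have ps: "partial_sums (a # b # r) = insert a (partial_sums ((a + b) # r))"
    by (auto simp: image_image add.assoc)
  show "coarsenings (a # b # r) = (#) a ` coarsenings (b # r) \<union> coarsenings ((a + b) # r)"
  proof (intro equalityI subsetI)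
    fix \<gamma> assume g: "\<gamma> \<in> coarsenings (a # b # r)"
    then obtain c s where \<gamma>: "\<gamma> = c # s" by (cases \<gamma>) (auto simp: coarsenings_def)
    have c: "c \<in> partial_sums (a # b # r)" using g unfolding \<gamma> coarsenings_def by auto
    then have ca: "c = a \<or> c \<ge> a + b" by auto
    show "\<gamma> \<in> (#) a ` coarsenings (b # r) \<union> coarsenings ((a + b) # r)"
    proof (cases "c = a")
      case True
      have "s \<noteq> []" using g pos unfolding \<gamma> True coarsenings_def by auto
      then have s: "composition s" using g unfolding \<gamma> True by (auto simp: coarsenings_def composition_Cons)
      have "a + p \<in> insert a ((+) a ` partial_sums (b # r))" if "p \<in> partial_sums s" for p
        using g that unfolding \<gamma> True coarsenings_def by auto
      then have "partial_sums s \<subseteq> partial_sums (b # r)"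
        using partial_sums_pos[OF s] by fastforce
      then have "s \<in> coarsenings (b # r)" using g s unfolding \<gamma> True coarsenings_def by auto
      then show ?thesis using \<gamma> True by auto
    next
      case False
      then have "a \<notin> partial_sums \<gamma>" using ca pos unfolding \<gamma> by auto
      moreover have "composition \<gamma>" "sum_list \<gamma> = sum_list ((a + b) # r)"
          "partial_sums \<gamma> \<subseteq> insert a (partial_sums ((a + b) # r))"
        using g unfolding coarsenings_def ps[symmetric] by simp_all
      ultimately have "\<gamma> \<in> coarsenings ((a + b) # r)" unfolding coarsenings_def by blast
      then show ?thesis by simp
    qed
  next
    fix \<gamma> assume "\<gamma> \<in> (#) a ` coarsenings (b # r) \<union> coarsenings ((a + b) # r)"
    then show "\<gamma> \<in> coarsenings (a # b # r)"
    proof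
      assume "\<gamma> \<in> (#) a ` coarsenings (b # r)"
      then obtain s where \<gamma>: "\<gamma> = a # s" and s: "composition s" "sum_list s = sum_list (b # r)"
          "partial_sums s \<subseteq> partial_sums (b # r)" by (auto simp: coarsenings_def)
      have "partial_sums \<gamma> \<subseteq> partial_sums (a # b # r)"
        unfolding \<gamma> partial_sums_Cons[of a] using s(3) by blast
      then show ?thesis using pos s(1,2) \<gamma> by (simp add: coarsenings_def composition_Cons)
    next
      assume "\<gamma> \<in> coarsenings ((a + b) # r)"
      then show ?thesis unfolding coarsenings_def ps by auto
    qed
  qed
  have "a \<notin> partial_sums ((a + b) # r)" using pos by auto
  then show "(#) a ` coarsenings (b # r) \<inter> coarsenings ((a + b) # r) = {}"
    by (auto simp: coarsenings_def)
qed

text \<open>Ensures that the truncated differences in the exponents of \<open>H_poly\<close> are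
  true differences.\<close>

lemma length_coarsening:
  assumes "composition \<alpha>" "\<gamma> \<in> coarsenings \<alpha>"
  shows "1 \<le> length \<gamma> \<and> length \<gamma> \<le> length \<alpha>"
  using assms
proof (induction "length \<alpha>" arbitrary: \<alpha> \<gamma>)
  case 0
  then show ?case by simp
next
  case (Suc n)
  then obtain a r where \<alpha>: "\<alpha> = a # r" by (cases \<alpha>) auto
  show ?case
  proof (cases r)
    case Nil
    then show ?thesis using Suc.prems coarsenings_singleton[of a] unfolding \<alpha>
      by (auto simp: composition_Cons)
  next
    case (Cons b t)
    have c: "composition (b # t)" "composition ((a + b) # t)"
      using Suc.prems(1) unfolding \<alpha> Cons by (auto simp: composition_Cons)
    show ?thesis
      using Suc.hyps(1)[OF _ c(1)] Suc.hyps(1)[OF _ c(2)] Suc.hyps(2) Suc.prems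
        coarsenings_Cons_Cons(1)[of a b t] unfolding \<alpha> Cons by force
  qed
qed

lemma finite_coarsenings: "composition \<alpha> \<Longrightarrow> finite (coarsenings \<alpha>)"
proof (induction "length \<alpha>" arbitrary: \<alpha>)
  case 0
  then show ?case by simp
next
  case (Suc n)
  then obtain a r where \<alpha>: "\<alpha> = a # r" by (cases \<alpha>) auto
  show ?case
  proof (cases r)
    case Nil
    then show ?thesis using Suc.prems coarsenings_singleton[of a] unfolding \<alpha>
      by (auto simp: composition_Cons)
  next
    case (Cons b t)
    have c: "composition (b # t)" "composition ((a + b) # t)"
      using Suc.prems(1) unfolding \<alpha> Cons by (auto simp: composition_Cons)
    show ?thesis
      using Suc.hyps(1)[OF _ c(1)] Suc.hyps(1)[OF _ c(2)] Suc.hyps(2) Suc.prems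
        coarsenings_Cons_Cons(1)[of a b t] unfolding \<alpha> Cons by auto
  qed
qed

lemma sum_coarsenings_Cons_Cons:
  assumes "composition (a # b # r)"
  shows "(\<Sum>\<gamma>\<in>coarsenings (a # b # r). g \<gamma>) =
    (\<Sum>\<gamma>\<in>coarsenings (b # r). g (a # \<gamma>)) + (\<Sum>\<gamma>\<in>coarsenings ((a + b) # r). g \<gamma>)"
proof -
  have c: "composition (b # r)" "composition ((a + b) # r)"
    using assms by (auto simp: composition_Cons)
  show ?thesis
    unfolding coarsenings_Cons_Cons(1)[OF assms]
    by (subst sum.union_disjoint)
      (auto simp: finite_coarsenings c coarsenings_Cons_Cons(2)[OF assms] sum.reindex)
qed

text \<open>The total weight 1 is part of the induction: prefixing the part \<open>a\<close> to all
  coarsenings of the tail adds \<open>f a\<close> times their total weight.\<close>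

lemma sum_coarsenings_eq_coarse_sum:
  fixes v w :: "'a::comm_ring_1"
  assumes "v + w = 1" "composition \<alpha>"
  shows "(\<Sum>\<gamma>\<in>coarsenings \<alpha>. v ^ (length \<gamma> - 1) * w ^ (length \<alpha> - length \<gamma>)) = 1"
    and "(\<Sum>\<gamma>\<in>coarsenings \<alpha>. v ^ (length \<gamma> - 1) * w ^ (length \<alpha> - length \<gamma>)
            * (\<Sum>c\<leftarrow>\<gamma>. f c)) = coarse_sum v w f \<alpha>"
  using assms(2)
proof (induction "length \<alpha>" arbitrary: \<alpha>)
  case 0
  { case 1 then show ?case using 0 by simp next case 2 then show ?case using 0 by simp }
next
  case (Suc n)
  let ?w = "\<lambda>\<alpha> \<gamma>. v ^ (length \<gamma> - 1) * w ^ (length \<alpha> - length \<gamma>)"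
  have *: "(\<Sum>\<gamma>\<in>coarsenings \<alpha>. ?w \<alpha> \<gamma>) = 1 \<and>
     (\<Sum>\<gamma>\<in>coarsenings \<alpha>. ?w \<alpha> \<gamma> * (\<Sum>c\<leftarrow>\<gamma>. f c)) = coarse_sum v w f \<alpha>" if comp: "composition \<alpha>"
  proof -
    obtain a r where \<alpha>: "\<alpha> = a # r" using comp by (cases \<alpha>) auto
    show ?thesis
    proof (cases r)
      case Nil
      then show ?thesis using comp coarsenings_singleton[of a] unfolding \<alpha>
        by (auto simp: composition_Cons)
    next
      case (Cons b t)
      have c: "composition (b # t)" "composition ((a + b) # t)" "composition (a # b # t)"
        using comp unfolding \<alpha> Cons by (auto simp: composition_Cons)
      have n: "n = length (b # t)" "n = length ((a + b) # t)" using Suc.hyps(3) by (auto simp: \<alpha> Cons)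
      \<comment> \<open>Prefixing \<open>a\<close> lengthens both compositions, so only the exponent
        of \<open>v\<close> grows. Undoing a merge lengthens only the composition being coarsened,
        so in \<open>w2\<close> the exponent of \<open>w\<close> grows.\<close>
      have w1: "?w (a # b # t) (a # \<gamma>) = v * ?w (b # t) \<gamma>" if "\<gamma> \<in> coarsenings (b # t)" for \<gamma>
        using length_coarsening[OF c(1) that] by (cases \<gamma>) auto
      have w2: "?w (a # b # t) \<gamma> = w * ?w ((a + b) # t) \<gamma>" if "\<gamma> \<in> coarsenings ((a + b) # t)" for \<gamma>
      proof -
        have "Suc (length ((a + b) # t)) - length \<gamma> = Suc (length ((a + b) # t) - length \<gamma>)"
          using length_coarsening[OF c(2) that] by (intro Suc_diff_le) auto
        then show ?thesis by (simp add: mult_ac)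
      qed
      note IH1 = Suc.hyps(1,2)[OF n(1) c(1)]
      note IH2 = Suc.hyps(1,2)[OF n(2) c(2)]
      let ?B = "coarsenings (b # t)" and ?C = "coarsenings ((a + b) # t)"
      have "(\<Sum>\<gamma>\<in>coarsenings \<alpha>. ?w \<alpha> \<gamma>) =
        (\<Sum>\<gamma>\<in>?B. v * ?w (b # t) \<gamma>) + (\<Sum>\<gamma>\<in>?C. w * ?w ((a + b) # t) \<gamma>)"
        unfolding \<alpha> Cons sum_coarsenings_Cons_Cons[OF c(3)]
        by (intro arg_cong2[where f = "(+)"] sum.cong refl w1 w2)
      also have "\<dots> = v * 1 + w * 1"
        unfolding sum_distrib_left[symmetric] IH1 IH2 ..
      finally have total: "(\<Sum>\<gamma>\<in>coarsenings \<alpha>. ?w \<alpha> \<gamma>) = 1" using assms(1) by simp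
      have "(\<Sum>\<gamma>\<in>coarsenings \<alpha>. ?w \<alpha> \<gamma> * (\<Sum>c\<leftarrow>\<gamma>. f c)) =
        (\<Sum>\<gamma>\<in>?B. v * ?w (b # t) \<gamma> * (f a + (\<Sum>c\<leftarrow>\<gamma>. f c))) +
        (\<Sum>\<gamma>\<in>?C. w * ?w ((a + b) # t) \<gamma> * (\<Sum>c\<leftarrow>\<gamma>. f c))"
        unfolding \<alpha> Cons sum_coarsenings_Cons_Cons[OF c(3)] list.map sum_list.Cons
        by (intro arg_cong2[where f = "(+)"] arg_cong2[where f = "(*)"] sum.cong refl w1 w2)
      also have "(\<Sum>\<gamma>\<in>?B. v * ?w (b # t) \<gamma> * (f a + (\<Sum>c\<leftarrow>\<gamma>. f c))) =
        v * ((\<Sum>\<gamma>\<in>?B. ?w (b # t) \<gamma>) * f a + (\<Sum>\<gamma>\<in>?B. ?w (b # t) \<gamma> * (\<Sum>c\<leftarrow>\<gamma>. f c)))"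
        unfolding sum_distrib_right sum.distrib[symmetric] sum_distrib_left
        by (intro sum.cong refl) (simp only: distrib_left mult.assoc)
      also have "(\<Sum>\<gamma>\<in>?C. w * ?w ((a + b) # t) \<gamma> * (\<Sum>c\<leftarrow>\<gamma>. f c)) =
        w * (\<Sum>\<gamma>\<in>?C. ?w ((a + b) # t) \<gamma> * (\<Sum>c\<leftarrow>\<gamma>. f c))"
        unfolding sum_distrib_left by (intro sum.cong refl) (simp only: mult.assoc)
      finally have "(\<Sum>\<gamma>\<in>coarsenings \<alpha>. ?w \<alpha> \<gamma> * (\<Sum>c\<leftarrow>\<gamma>. f c)) = coarse_sum v w f \<alpha>"
        unfolding IH1 IH2 \<alpha> Cons coarse_sum_Cons_Cons[OF assms(1)] by simp
      then show ?thesis using total by simp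
    qed
  qed
  { case 1 then show ?case using * by simp next case 2 then show ?case using * by simp }
qed

text \<open>By linearity, every run of parts \<open>i..j\<close> contributes \<open>f\<close> of its
  sum times the probability of being a block: \<open>v\<close> for each of its two ends that is
  interior to \<open>\<alpha>\<close>, and \<open>w\<close> for each of the \<open>j - i\<close>
  partial sums inside. This form matches the trunks of subtrees of a caterpillar.\<close>

lemma coarse_sum_conv_intervals:
  "coarse_sum v w f \<alpha> = (\<Sum>i<length \<alpha>. (if 0 < i then v else 1) *
     (\<Sum>j=i..<length \<alpha>. (if Suc j < length \<alpha> then v else 1) * w ^ (j - i) * f (\<Sum>k=i..j. \<alpha> ! k)))"
proof -
  have fb: "first_block v w f a r =
    (\<Sum>j<Suc (length r). (if j < length r then v else 1) * w ^ j * f (a + (\<Sum>k<j. r ! k)))" for a r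
  proof (induction r arbitrary: a)
    case (Cons b r)
    have *: "(\<Sum>k<Suc j. (b # r) ! k) = b + (\<Sum>k<j. r ! k)" for j
      by (subst sum.lessThan_Suc_shift) simp
    have "(\<Sum>j<Suc (length (b # r)). (if j < length (b # r) then v else 1) * w ^ j * f (a + (\<Sum>k<j. (b # r) ! k)))
      = v * f a + (\<Sum>j<Suc (length r). (if j < length r then v else 1) * w ^ Suc j * f (a + b + (\<Sum>k<j. r ! k)))"
      unfolding list.size(4) add_Suc_right add_0_right by (subst sum.lessThan_Suc_shift, unfold *) (simp add: add.assoc)
    also have "(\<Sum>j<Suc (length r). (if j < length r then v else 1) * w ^ Suc j * f (a + b + (\<Sum>k<j. r ! k)))
      = w * first_block v w f (a + b) r"
      unfolding Cons.IH sum_distrib_left by (intro sum.cong refl) (simp add: mult_ac)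
    finally show ?case by simp
  qed simp
  define g where "g r i = (\<Sum>j=i..<length r. (if Suc j < length r then v else 1) * w ^ (j - i) *
    f (\<Sum>k=i..j. r ! k))" for r i
  have g0: "first_block v w f a r = g (a # r) 0" for a r
  proof -
    have "(\<Sum>k=0..j. (a # r) ! k) = a + (\<Sum>k<j. r ! k)" for j
      by (simp add: atLeast0AtMost sum.atMost_shift)
    then show ?thesis by (simp add: fb g_def atLeast0LessThan)
  qed
  have gS: "g (a # r) (Suc i) = g r i" for a r i
  proof -
    have *: "(\<Sum>k=Suc i..Suc j. (a # r) ! k) = (\<Sum>k=i..j. r ! k)" for j
      by (subst sum.shift_bounds_cl_Suc_ivl) simp
    have "g (a # r) (Suc i) = (\<Sum>j=i..<length r. (if Suc (Suc j) < length (a # r) then v else 1) *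
        w ^ (Suc j - Suc i) * f (\<Sum>k=Suc i..Suc j. (a # r) ! k))"
      unfolding g_def list.size(4) add_Suc_right add_0_right by (rule sum.shift_bounds_Suc_ivl)
    then show ?thesis unfolding * by (simp add: g_def)
  qed
  have bs: "blocks_sum v w f r = (\<Sum>i<length r. g r i)" for r
    by (induction r) (simp_all add: g0 gS sum.lessThan_Suc_shift del: sum.lessThan_Suc)
  have "coarse_sum v w f \<alpha> = (\<Sum>i<length \<alpha>. (if 0 < i then v else 1) * g \<alpha> i)"
    by (cases \<alpha>) (simp_all add: bs g0 gS sum.lessThan_Suc_shift sum_distrib_left del: sum.lessThan_Suc)
  then show ?thesis by (simp add: g_def)
qed

lemma H_poly_eq_coarse_sum:
  assumes "composition \<alpha>"
  defines "y \<equiv> Fract var1 1" and "z \<equiv> Fract var2 1"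
  shows "C (y / (y + z)) + C (z / (y + z)) = 1"
    and "H_poly \<alpha> = coarse_sum (C (y / (y + z))) (C (z / (y + z))) X \<alpha>"
proof -
  have "var1 + var2 \<noteq> 0" by (simp add: var1_def var2_def)
  then have yz: "y + z \<noteq> 0" by (simp add: y_def z_def eq_fract Zero_fract_def)
  have C_mult: "C (a * b) = C a * C b" for a b :: "int poly poly fract"
    by (simp add: C_def mult_single)
  have C_power: "C (a ^ n) = C a ^ n" for a :: "int poly poly fract" and n
    by (induction n) (simp_all add: C_mult, simp add: C_def)
  show sum1: "C (y / (y + z)) + C (z / (y + z)) = 1"
  proof -
    have "C (y / (y + z)) + C (z / (y + z)) = C ((y + z) / (y + z))"
      by (simp only: C_def single_add add_divide_distrib)
    then show ?thesis using yz by (simp add: C_def)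
  qed
  have "C (y ^ (length \<gamma> - 1) * z ^ (length \<alpha> - length \<gamma>) / (y + z) ^ (length \<alpha> - 1)) =
    C (y / (y + z)) ^ (length \<gamma> - 1) * C (z / (y + z)) ^ (length \<alpha> - length \<gamma>)"
    if "\<gamma> \<in> coarsenings \<alpha>" for \<gamma>
  proof -
    \<comment> \<open>The exponents of \<open>y\<close> and \<open>z\<close> add up to that of
      \<open>y + z\<close>, so the denominator can be distributed over the two powers.\<close>
    have "length \<alpha> - 1 = (length \<gamma> - 1) + (length \<alpha> - length \<gamma>)"
      using length_coarsening[OF assms(1) that] by simp
    then show ?thesis
      by (simp only: C_power[symmetric] C_mult[symmetric] power_divide power_add times_divide_times_eq)
  qed
  then show "H_poly \<alpha> = coarse_sum (C (y / (y + z))) (C (z / (y + z))) X \<alpha>"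
    unfolding H_poly_def Let_def y_def[symmetric] z_def[symmetric]
      sum_coarsenings_eq_coarse_sum(2)[OF sum1 assms(1), symmetric]
    by (intro sum.cong refl) (simp add: sum_list_sum_nth atLeast0LessThan)
qed

subsection \<open>Partial sums of products and reversals\<close>

lemma partial_sums_append: "partial_sums (\<alpha> @ \<beta>) = partial_sums \<alpha> \<union> (+) (sum_list \<alpha>) ` partial_sums \<beta>"
  by (induction \<alpha>) (auto simp: image_image add.assoc)

section \<open>Near-concatenation and its powers\<close>

lemma near_concat_Cons_Cons:
  "[a] \<odot> (b # r) = (a + b) # r" "(a # a' # s) \<odot> \<beta> = a # ((a' # s) \<odot> \<beta>)"
  by (auto simp: near_concat_def)

lemma near_concat_Nil [simp]: "[] \<odot> \<beta> = \<beta>" "\<alpha> \<odot> [] = \<alpha>"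
  by (auto simp: near_concat_def)

lemma near_concat_properties:
  assumes "composition \<alpha>" "composition \<beta>"
  shows "composition (\<alpha> \<odot> \<beta>)" "sum_list (\<alpha> \<odot> \<beta>) = sum_list \<alpha> + sum_list \<beta>"
    "Suc (length (\<alpha> \<odot> \<beta>)) = length \<alpha> + length \<beta>"
    "partial_sums (\<alpha> \<odot> \<beta>) = (partial_sums \<alpha> - {sum_list \<alpha>}) \<union> (+) (sum_list \<alpha>) ` partial_sums \<beta>"
proof -
  obtain b r where \<beta>: "\<beta> = b # r" using assms(2) by (cases \<beta>) auto
  have "composition (\<alpha> \<odot> \<beta>) \<and> sum_list (\<alpha> \<odot> \<beta>) = sum_list \<alpha> + sum_list \<beta> \<and>
    Suc (length (\<alpha> \<odot> \<beta>)) = length \<alpha> + length \<beta> \<and>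
    partial_sums (\<alpha> \<odot> \<beta>) = (partial_sums \<alpha> - {sum_list \<alpha>}) \<union> (+) (sum_list \<alpha>) ` partial_sums \<beta>"
    using assms(1)
  proof (induction \<alpha>)
    case Nil
    then show ?case by simp
  next
    case (Cons a s)
    show ?case
    proof (cases s)
      case Nil
      then show ?thesis using Cons.prems assms(2)
        by (auto simp: \<beta> near_concat_Cons_Cons composition_Cons image_image add.assoc)
    next
      case (Cons a' t)
      have s: "composition s" "0 < a" using Cons.prems Cons by (auto simp: composition_Cons)
      have "partial_sums (a # (s \<odot> \<beta>)) =
        insert a ((+) a ` ((partial_sums s - {sum_list s}) \<union> (+) (sum_list s) ` partial_sums \<beta>))"
        using Cons.IH[OF s(1)] by simp
      also have "\<dots> = (partial_sums (a # s) - {sum_list (a # s)}) \<union> (+) (sum_list (a # s)) ` partial_sums \<beta>"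
        using sum_list_pos[OF s(1)] by (auto simp: image_image add.assoc)
      finally show ?thesis using Cons.IH[OF s(1)] s unfolding Cons near_concat_Cons_Cons
        by (simp add: composition_Cons)
    qed
  qed
  then show "composition (\<alpha> \<odot> \<beta>)" "sum_list (\<alpha> \<odot> \<beta>) = sum_list \<alpha> + sum_list \<beta>"
    "Suc (length (\<alpha> \<odot> \<beta>)) = length \<alpha> + length \<beta>"
    "partial_sums (\<alpha> \<odot> \<beta>) = (partial_sums \<alpha> - {sum_list \<alpha>}) \<union> (+) (sum_list \<alpha>) ` partial_sums \<beta>"
    by auto
qed

lemma near_power_0 [simp]: "near_power \<beta> 0 = []"
  by (simp add: near_power_def)

lemma near_power_Suc [simp]: "near_power \<beta> (Suc a) = \<beta> \<odot> near_power \<beta> a"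
  by (simp add: near_power_def)

text \<open>Each near-concatenation drops the partial sum at its joint, so among the multiples of
  the size of \<open>\<beta>\<close> only the last survives, while the other positions repeat
  \<open>\<beta>\<close> periodically. The exponent is \<open>Suc a\<close> because the zeroth power
  is the empty list, which is no composition.\<close>

lemma near_power_properties:
  assumes "composition \<beta>"
  shows "composition (near_power \<beta> (Suc a))" "sum_list (near_power \<beta> a) = a * sum_list \<beta>"
    "length (near_power \<beta> (Suc a)) = Suc (Suc a * (length \<beta> - 1))"
    "p \<in> partial_sums (near_power \<beta> (Suc a)) \<longleftrightarrow> p = Suc a * sum_list \<beta> \<or>
      p < Suc a * sum_list \<beta> \<and> \<not> sum_list \<beta> dvd p \<and> p mod sum_list \<beta> \<in> partial_sums \<beta>"
proof -
  define n where "n = sum_list \<beta>"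
  have n: "0 < n" using sum_list_pos[OF assms] by (simp add: n_def)
  have len: "0 < length \<beta>" "\<beta> \<noteq> []" using assms by (auto simp: composition_def)
  have "composition (near_power \<beta> (Suc a)) \<and> sum_list (near_power \<beta> (Suc a)) = Suc a * n \<and>
    length (near_power \<beta> (Suc a)) = Suc (Suc a * (length \<beta> - 1)) \<and>
    (\<forall>p. p \<in> partial_sums (near_power \<beta> (Suc a)) \<longleftrightarrow> p = Suc a * n \<or>
      p < Suc a * n \<and> \<not> n dvd p \<and> p mod n \<in> partial_sums \<beta>)" for a
  proof (induction a)
    case 0
    have "p \<in> partial_sums \<beta> \<longleftrightarrow> p = n \<or> p < n \<and> \<not> n dvd p \<and> p mod n \<in> partial_sums \<beta>" for p
      using partial_sums_le[of p \<beta>] partial_sums_pos[OF assms, of p] sum_list_in_partial_sums[OF len(2)]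
      unfolding n_def[symmetric] by (cases "p = n") (auto simp: n_def nat_dvd_not_less)
    moreover have "near_power \<beta> (Suc 0) = \<beta>" "Suc 0 * n = n"
      "length \<beta> = Suc (Suc 0 * (length \<beta> - 1))" "sum_list \<beta> = n"
      using len by (simp_all add: n_def)
    ultimately show ?case using assms by metis
  next
    case (Suc a)
    let ?np = "near_power \<beta> (Suc a)"
    have eq: "near_power \<beta> (Suc (Suc a)) = \<beta> \<odot> ?np" by (rule near_power_Suc)
    note np = near_concat_properties[OF assms conjunct1[OF Suc.IH]]
    have "p \<in> partial_sums (\<beta> \<odot> ?np) \<longleftrightarrow> p = Suc (Suc a) * n \<or>
      p < Suc (Suc a) * n \<and> \<not> n dvd p \<and> p mod n \<in> partial_sums \<beta>" for p
    proof (cases "p \<le> n")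
      case True
      then have "p \<notin> (+) n ` partial_sums ?np"
        using partial_sums_pos[OF conjunct1[OF Suc.IH]] by fastforce
      then have "p \<in> partial_sums (\<beta> \<odot> ?np) \<longleftrightarrow> p \<in> partial_sums \<beta> \<and> p \<noteq> n"
        unfolding np(4) n_def[symmetric] by auto
      moreover have "p \<in> partial_sums \<beta> \<Longrightarrow> 0 < p" by (rule partial_sums_pos[OF assms])
      ultimately show ?thesis using True n by (cases "p = n") (auto simp: nat_dvd_not_less)
    next
      case False
      then obtain q where q: "p = n + q" "0 < q" by (metis less_imp_add_positive not_le)
      have "p \<notin> partial_sums \<beta>" using False partial_sums_le[of p \<beta>] by (auto simp: n_def)
      then have "p \<in> partial_sums (\<beta> \<odot> ?np) \<longleftrightarrow> q \<in> partial_sums ?np"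
        unfolding np(4) n_def[symmetric] q(1) by auto
      then show ?thesis using Suc.IH by (simp add: q(1))
    qed
    moreover have "length (\<beta> \<odot> ?np) = Suc (Suc (Suc a) * (length \<beta> - 1))"
      using np(3) Suc.IH len by simp
    ultimately show ?case unfolding eq using np(1,2) Suc.IH by (simp add: n_def)
  qed
  note * = this
  show "composition (near_power \<beta> (Suc a))"
    "length (near_power \<beta> (Suc a)) = Suc (Suc a * (length \<beta> - 1))"
    "p \<in> partial_sums (near_power \<beta> (Suc a)) \<longleftrightarrow> p = Suc a * sum_list \<beta> \<or>
      p < Suc a * sum_list \<beta> \<and> \<not> sum_list \<beta> dvd p \<and> p mod sum_list \<beta> \<in> partial_sums \<beta>"
    using *[of a] unfolding n_def by blast+
  show "sum_list (near_power \<beta> a) = a * sum_list \<beta>"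
    using * unfolding n_def by (cases a) (auto simp del: near_power_Suc mult_Suc)
qed

section \<open>The product of compositions\<close>

lemma composition_append: "composition \<alpha> \<Longrightarrow> composition \<beta> \<Longrightarrow> composition (\<alpha> @ \<beta>)"
  by (auto simp: composition_def)

lemma comp_circ_Nil [simp]: "[] \<circ>\<^sub>c \<beta> = []"
  by (simp add: comp_circ_def)

lemma comp_circ_Cons [simp]: "(a # r) \<circ>\<^sub>c \<beta> = near_power \<beta> a @ (r \<circ>\<^sub>c \<beta>)"
  by (simp add: comp_circ_def)

lemma composition_comp_circ:
  assumes "composition \<alpha>" "composition \<beta>"
  shows "composition (\<alpha> \<circ>\<^sub>c \<beta>)"
  using assms(1)
proof (induction \<alpha>)
  case (Cons a r)
  then obtain k where a: "a = Suc k" by (cases a) (auto simp: composition_Cons)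
  show ?case using Cons near_power_properties(1)[OF assms(2), of k]
    by (auto simp: a composition_Cons composition_append simp del: near_power_Suc)
qed simp

lemma sum_list_comp_circ:
  assumes "composition \<beta>"
  shows "sum_list (\<alpha> \<circ>\<^sub>c \<beta>) = sum_list \<alpha> * sum_list \<beta>"
  by (induction \<alpha>) (simp_all add: near_power_properties(2)[OF assms] distrib_right)

lemma length_comp_circ:
  assumes "composition \<alpha>" "composition \<beta>"
  shows "length (\<alpha> \<circ>\<^sub>c \<beta>) = length \<alpha> + sum_list \<alpha> * (length \<beta> - 1)"
  using assms(1)
proof (induction \<alpha>)
  case (Cons a r)
  then obtain k where a: "a = Suc k" by (cases a) (auto simp: composition_Cons)
  show ?case using Cons near_power_properties(3)[OF assms(2), of k]
    by (auto simp: a composition_Cons distrib_right simp del: near_power_Suc)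
qed simp

text \<open>The multiples of the size of \<open>\<beta>\<close> are the joints between copies of
  \<open>\<beta>\<close>; a joint is a concatenation, and thus visible, exactly at a partial sum of
  \<open>\<alpha>\<close>. Off the joints the pattern of \<open>\<beta>\<close> repeats.
  Associativity, reversal, cancellation and the window sums of products all reduce to this
  test.\<close>

lemma partial_sums_comp_circ:
  assumes "composition \<alpha>" "composition \<beta>" "0 < p" "p \<le> sum_list \<alpha> * sum_list \<beta>"
  shows "p \<in> partial_sums (\<alpha> \<circ>\<^sub>c \<beta>) \<longleftrightarrow>
    (if sum_list \<beta> dvd p then p div sum_list \<beta> \<in> partial_sums \<alpha> else p mod sum_list \<beta> \<in> partial_sums \<beta>)"
proof -
  define n where "n = sum_list \<beta>"
  have n: "0 < n" using sum_list_pos[OF assms(2)] by (simp add: n_def)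
  have "p \<in> partial_sums (\<alpha> \<circ>\<^sub>c \<beta>) \<longleftrightarrow>
    (if n dvd p then p div n \<in> partial_sums \<alpha> else p mod n \<in> partial_sums \<beta>)"
    if "\<alpha> = [] \<or> composition \<alpha>" "0 < p" "p \<le> sum_list \<alpha> * n"
    using that
  proof (induction \<alpha> arbitrary: p)
    case Nil
    then show ?case by simp
  next
    case (Cons a r)
    then obtain k where a: "a = Suc k" by (cases a) (auto simp: composition_Cons)
    have r: "r = [] \<or> composition r" using Cons.prems by (auto simp: composition_Cons)
    have ps: "p \<in> partial_sums ((a # r) \<circ>\<^sub>c \<beta>) \<longleftrightarrow>
      (p = a * n \<or> p < a * n \<and> \<not> n dvd p \<and> p mod n \<in> partial_sums \<beta>) \<or>
      (\<exists>q. p = a * n + q \<and> q \<in> partial_sums (r \<circ>\<^sub>c \<beta>))"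
      unfolding comp_circ_Cons partial_sums_append near_power_properties(2)[OF assms(2)] Un_iff
        n_def[symmetric] a near_power_properties(4)[OF assms(2)] by auto
    have pos: "0 < q" if "q \<in> partial_sums (r \<circ>\<^sub>c \<beta>)" for q
      using r that partial_sums_pos[OF composition_comp_circ[OF _ assms(2)]] by auto
    show ?case
    proof (cases "p \<le> a * n")
      case True
      have "p div n \<notin> (+) a ` partial_sums r"
      proof
        assume "p div n \<in> (+) a ` partial_sums r"
        then have "a < p div n" using r partial_sums_pos by fastforce
        then show False using True n div_le_mono[OF True, of n] by simp
      qed
      then show ?thesis
      proof (cases "p = a * n")
        case True
        then show ?thesis unfolding ps using n by simp
      next
        case False
        then have "\<not> (n dvd p \<and> p div n = a)" using dvd_div_mult_self by auto
        then show ?thesis unfolding ps using False True pos \<open>p div n \<notin> _\<close> by auto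
      qed
    next
      case False
      then obtain q where q: "p = a * n + q" "0 < q" by (metis less_imp_add_positive not_le)
      have "p \<in> partial_sums ((a # r) \<circ>\<^sub>c \<beta>) \<longleftrightarrow> q \<in> partial_sums (r \<circ>\<^sub>c \<beta>)"
        unfolding ps using q by auto
      also have "\<dots> \<longleftrightarrow> (if n dvd q then q div n \<in> partial_sums r else q mod n \<in> partial_sums \<beta>)"
        using Cons.prems(3) q r by (intro Cons.IH) (auto simp: distrib_right)
      also have "n dvd q \<longleftrightarrow> n dvd p" unfolding q(1) by simp
      also have "q mod n = p mod n" unfolding q(1) by simp
      also have "(if n dvd p then q div n \<in> partial_sums r else p mod n \<in> partial_sums \<beta>) \<longleftrightarrow>
        (if n dvd p then p div n \<in> partial_sums (a # r) else p mod n \<in> partial_sums \<beta>)"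
      proof (cases "n dvd p")
        case True
        then have "n dvd q" unfolding q(1) by simp
        then have "0 < q div n" using q(2) n by (simp add: dvd_imp_le div_greater_zero_iff)
        then show ?thesis using True n unfolding q(1) by auto
      qed simp
      finally show ?thesis .
    qed
  qed
  then show ?thesis using assms unfolding n_def by blast
qed

section \<open>Reversal and associativity\<close>

lemma composition_rev: "composition (rev \<alpha>) \<longleftrightarrow> composition \<alpha>"
  by (simp add: composition_def)

text \<open>Confined to interior positions: the size is a partial sum of every composition, but its
  mirror image 0 is never one.\<close>

lemma partial_sums_rev:
  "0 < p \<Longrightarrow> p < sum_list \<alpha> \<Longrightarrow> p \<in> partial_sums (rev \<alpha>) \<longleftrightarrow> sum_list \<alpha> - p \<in> partial_sums \<alpha>"
proof (induction \<alpha>)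
  case (Cons a r)
  have ps: "p \<in> partial_sums (rev (a # r)) \<longleftrightarrow> p \<in> partial_sums (rev r)"
    using Cons.prems by (auto simp: partial_sums_append)
  have le: "q \<in> partial_sums (rev r) \<Longrightarrow> q \<le> sum_list r" for q
    using partial_sums_le[of q "rev r"] by simp
  have self: "r \<noteq> [] \<Longrightarrow> sum_list r \<in> partial_sums (rev r)"
    using sum_list_in_partial_sums[of "rev r"] by simp
  consider "p < sum_list r" | "p = sum_list r" | "p > sum_list r" by linarith
  then show ?case
  proof cases
    case 1
    then have "\<exists>k>0. sum_list r - p = k \<and> sum_list (a # r) - p = a + k" by auto
    then obtain k where k: "0 < k" "sum_list r - p = k" "sum_list (a # r) - p = a + k" by blast
    have "p \<in> partial_sums (rev r) \<longleftrightarrow> k \<in> partial_sums r"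
      using Cons.IH[OF Cons.prems(1) 1] unfolding k(2) .
    then show ?thesis unfolding ps k(3) using k(1) by auto
  next
    case 2
    then have "r \<noteq> []" using Cons.prems by auto
    then show ?thesis unfolding ps using self 2 by auto
  next
    case 3
    then show ?thesis unfolding ps using le[of p] Cons.prems by auto
  qed
qed simp

text \<open>Both sides read \<open>p\<close> in mixed radix: a position not divisible by
  \<open>l\<close> is decided by \<open>\<gamma>\<close>, one divisible by \<open>l\<close> but not
  by \<open>n * l\<close> by \<open>\<beta>\<close> at \<open>(p div l) mod n\<close>, and the
  others by \<open>\<alpha>\<close>.\<close>

lemma comp_circ_assoc:
  assumes "composition \<alpha>" "composition \<beta>" "composition \<gamma>"
  shows "(\<alpha> \<circ>\<^sub>c \<beta>) \<circ>\<^sub>c \<gamma> = \<alpha> \<circ>\<^sub>c (\<beta> \<circ>\<^sub>c \<gamma>)"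
proof (rule composition_eqI)
  let ?A = "(\<alpha> \<circ>\<^sub>c \<beta>) \<circ>\<^sub>c \<gamma>" and ?B = "\<alpha> \<circ>\<^sub>c (\<beta> \<circ>\<^sub>c \<gamma>)"
  define m n l where "m = sum_list \<alpha>" "n = sum_list \<beta>" "l = sum_list \<gamma>"
  have pos: "0 < m" "0 < n" "0 < l" using assms sum_list_pos by (auto simp: m_n_l_def)
  have c: "composition (\<alpha> \<circ>\<^sub>c \<beta>)" "composition (\<beta> \<circ>\<^sub>c \<gamma>)"
    using assms composition_comp_circ by auto
  show "composition ?A" "composition ?B" using assms composition_comp_circ by auto
  have sum: "sum_list ?A = m * n * l" "sum_list ?B = m * n * l"
    using assms c by (simp_all add: sum_list_comp_circ m_n_l_def)
  have "p \<in> partial_sums ?A \<longleftrightarrow> p \<in> partial_sums ?B" if p: "0 < p" "p \<le> m * n * l" for p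
  proof -
    have A: "p \<in> partial_sums ?A \<longleftrightarrow>
      (if l dvd p then p div l \<in> partial_sums (\<alpha> \<circ>\<^sub>c \<beta>) else p mod l \<in> partial_sums \<gamma>)"
      unfolding m_n_l_def using p c assms
      by (intro partial_sums_comp_circ) (auto simp: sum_list_comp_circ m_n_l_def)
    have B: "p \<in> partial_sums ?B \<longleftrightarrow>
      (if n * l dvd p then p div (n * l) \<in> partial_sums \<alpha> else p mod (n * l) \<in> partial_sums (\<beta> \<circ>\<^sub>c \<gamma>))"
      unfolding m_n_l_def sum_list_comp_circ[OF assms(3), symmetric] using p c assms
      by (intro partial_sums_comp_circ) (auto simp: sum_list_comp_circ m_n_l_def mult_ac)
    have B': "p mod (n * l) \<in> partial_sums (\<beta> \<circ>\<^sub>c \<gamma>) \<longleftrightarrow>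
      (if l dvd p then (p div l) mod n \<in> partial_sums \<beta> else p mod l \<in> partial_sums \<gamma>)"
      if "\<not> n * l dvd p"
    proof -
      have "0 < p mod (n * l)" "p mod (n * l) \<le> n * l"
        using that pos by (auto simp: dvd_eq_mod_eq_0)
      then have "p mod (n * l) \<in> partial_sums (\<beta> \<circ>\<^sub>c \<gamma>) \<longleftrightarrow> (if l dvd p mod (n * l)
          then p mod (n * l) div l \<in> partial_sums \<beta> else p mod (n * l) mod l \<in> partial_sums \<gamma>)"
        unfolding m_n_l_def using assms by (intro partial_sums_comp_circ)
      also have "l dvd p mod (n * l) \<longleftrightarrow> l dvd p" by (rule dvd_mod_iff) simp
      also have "p mod (n * l) div l = (p div l) mod n"
        using mod_mult2_eq[of p l n] pos by (simp add: mult.commute)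
      also have "p mod (n * l) mod l = p mod l" by (rule mod_mod_cancel) simp
      finally show ?thesis .
    qed
    have D: "p div l \<in> partial_sums (\<alpha> \<circ>\<^sub>c \<beta>) \<longleftrightarrow>
      (if n dvd p div l then p div l div n \<in> partial_sums \<alpha> else p div l mod n \<in> partial_sums \<beta>)"
      if l: "l dvd p"
    proof -
      obtain q where q: "p = l * q" using l by auto
      show ?thesis unfolding m_n_l_def(2) using p pos q assms
        by (intro partial_sums_comp_circ) (auto simp: m_n_l_def[symmetric])
    qed
    have E: "n * l dvd p \<longleftrightarrow> n dvd p div l" if "l dvd p"
      using that pos by (auto simp: dvd_div_iff_mult)
    have F: "p div l div n = p div (n * l)" by (simp add: div_mult2_eq[symmetric] mult.commute)
    have G: "n * l dvd p \<Longrightarrow> l dvd p" by (rule dvd_mult_right)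
    show ?thesis
    proof (cases "l dvd p")
      case True
      then show ?thesis using A B B' D[OF True] E[OF True] F by auto
    next
      case False
      then show ?thesis using A B B' G by auto
    qed
  qed
  moreover have "p \<in> partial_sums ?A \<union> partial_sums ?B \<Longrightarrow> 0 < p \<and> p \<le> m * n * l" for p
    using partial_sums_le[of p ?A] partial_sums_le[of p ?B] \<open>composition ?A\<close> \<open>composition ?B\<close>
      partial_sums_pos sum by auto
  ultimately show "partial_sums ?A = partial_sums ?B" by blast
qed

text \<open>The reflection of \<open>p\<close> to \<open>m * n - p\<close> preserves divisibility by
  \<open>n\<close> and turns a nonzero remainder into \<open>n\<close> minus that remainder, so the
  joints and the copies of \<open>\<beta>\<close> are reversed separately.\<close>

lemma comp_circ_rev:
  assumes "composition \<alpha>" "composition \<beta>"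
  shows "rev (\<alpha> \<circ>\<^sub>c \<beta>) = rev \<alpha> \<circ>\<^sub>c rev \<beta>"
proof (rule composition_eqI)
  let ?A = "rev (\<alpha> \<circ>\<^sub>c \<beta>)" and ?B = "rev \<alpha> \<circ>\<^sub>c rev \<beta>"
  define m n where "m = sum_list \<alpha>" "n = sum_list \<beta>"
  have pos: "0 < m" "0 < n" using assms sum_list_pos by (auto simp: m_n_def)
  show c: "composition ?A" "composition ?B" using assms composition_comp_circ composition_rev by auto
  have sum: "sum_list ?A = m * n" "sum_list ?B = m * n"
    using assms by (simp_all add: sum_list_comp_circ m_n_def composition_rev)
  have "p \<in> partial_sums ?A \<longleftrightarrow> p \<in> partial_sums ?B" if p: "0 < p" "p < m * n" for p
  proof -
    have "p \<in> partial_sums ?A \<longleftrightarrow> m * n - p \<in> partial_sums (\<alpha> \<circ>\<^sub>c \<beta>)"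
      using partial_sums_rev[of p "\<alpha> \<circ>\<^sub>c \<beta>"] p assms by (simp add: sum_list_comp_circ m_n_def)
    also have "\<dots> \<longleftrightarrow> (if n dvd m * n - p then (m * n - p) div n \<in> partial_sums \<alpha>
        else (m * n - p) mod n \<in> partial_sums \<beta>)"
      unfolding m_n_def(2) using p assms by (intro partial_sums_comp_circ) (auto simp: m_n_def)
    finally have A: "p \<in> partial_sums ?A \<longleftrightarrow> (if n dvd m * n - p then (m * n - p) div n \<in> partial_sums \<alpha>
        else (m * n - p) mod n \<in> partial_sums \<beta>)" .
    have B: "p \<in> partial_sums ?B \<longleftrightarrow> (if n dvd p then p div n \<in> partial_sums (rev \<alpha>)
        else p mod n \<in> partial_sums (rev \<beta>))"
      using partial_sums_comp_circ[of "rev \<alpha>" "rev \<beta>" p] p assms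
      by (simp add: m_n_def composition_rev)
    show ?thesis
    proof (cases "n dvd p")
      case True
      then obtain q where q: "p = n * q" by auto
      then have *: "m * n - p = n * (m - q)" by (simp add: right_diff_distrib' mult.commute)
      have "q \<in> partial_sums (rev \<alpha>) \<longleftrightarrow> m - q \<in> partial_sums \<alpha>"
        unfolding m_n_def(1) using p q pos by (intro partial_sums_rev) (auto simp: m_n_def mult.commute)
      then show ?thesis unfolding A B * using pos by (simp add: q)
    next
      case False
      have "n dvd m * n - p \<longleftrightarrow> n dvd p" using p by (metis dvd_diff_nat dvd_triv_right diff_diff_cancel less_imp_le)
      moreover have "(m * n - p) mod n = n - p mod n"
      proof -
        have "p = n * (p div n) + p mod n" by simp
        moreover have "p div n < m" using p by (simp add: div_less_iff_less_mult pos)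
        \<comment> \<open>One period is set aside in \<open>Suc k\<close> to hold the new remainder
          \<open>n - p mod n\<close>.\<close>
        then obtain k where k: "m = p div n + Suc k" using less_imp_Suc_add by fastforce
        have r: "p mod n < n" "0 < p mod n" using pos False by (auto simp: dvd_eq_mod_eq_0)
        have "m * n - p = n * k + (n - p mod n)"
        proof -
          have "m * n = n * (p div n) + n * k + n" by (subst k) (simp add: algebra_simps)
          also have "\<dots> = p + (n * k + (n - p mod n))" using r mult_div_mod_eq[of n p] by linarith
          finally show ?thesis by simp
        qed
        moreover have "n - p mod n < n" using r by simp
        ultimately show ?thesis by (simp only: mod_mult_self4 mod_less)
      qed
      moreover have "p mod n \<in> partial_sums (rev \<beta>) \<longleftrightarrow> n - p mod n \<in> partial_sums \<beta>"
        unfolding m_n_def(2) using False pos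
        by (intro partial_sums_rev) (auto simp: m_n_def dvd_eq_mod_eq_0)
      ultimately show ?thesis unfolding A B using False by simp
    qed
  qed
  moreover have "p \<in> partial_sums ?A \<union> partial_sums ?B \<Longrightarrow> 0 < p \<and> p \<le> m * n" for p
    using partial_sums_le[of p ?A] partial_sums_le[of p ?B] c partial_sums_pos sum by auto
  moreover have "m * n \<in> partial_sums ?A" "m * n \<in> partial_sums ?B"
    using sum_list_in_partial_sums[of ?A] sum_list_in_partial_sums[of ?B] c sum
    by (auto simp: composition_def)
  ultimately show "partial_sums ?A = partial_sums ?B"
    by (intro equalityI subsetI) (metis UnI1 UnI2 le_neq_implies_less)+
qed

subsection \<open>Window sums\<close>

text \<open>A block of size \<open>a\<close> contains \<open>max (a - d) 0\<close> windows \<open>{s<..s + d}\<close> of interior positions, which explains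
  \<open>coarse_sum_truncated\<close> below.\<close>

definition window_sum :: "'a::comm_ring_1 \<Rightarrow> nat list \<Rightarrow> nat \<Rightarrow> 'a" where
  "window_sum w \<alpha> d =
    (\<Sum>s<sum_list \<alpha> - d. \<Prod>p\<in>{s<..s + d}. if p \<in> partial_sums \<alpha> then w else 1)"

text \<open>Reflection maps windows to windows. A window excludes its left end \<open>s\<close>, so
  the new left end is one less than the distance of \<open>s + d\<close> from the right end.\<close>

lemma window_sum_rev: "window_sum w (rev \<alpha>) d = window_sum w \<alpha> d"
proof -
  let ?n = "sum_list \<alpha>"
  have "window_sum w (rev \<alpha>) d =
    (\<Sum>s<?n - d. \<Prod>p\<in>{?n - d - Suc s<..?n - d - Suc s + d}. if p \<in> partial_sums (rev \<alpha>) then w else 1)"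
    unfolding window_sum_def sum_list_rev by (rule sum.nat_diff_reindex[symmetric])
  also have "\<dots> = window_sum w \<alpha> d"
    unfolding window_sum_def
  proof (intro sum.cong refl)
    fix s assume s: "s \<in> {..<?n - d}"
    show "(\<Prod>p\<in>{?n - d - Suc s<..?n - d - Suc s + d}. if p \<in> partial_sums (rev \<alpha>) then w else 1) =
      (\<Prod>p\<in>{s<..s + d}. if p \<in> partial_sums \<alpha> then w else 1)"
    proof (rule prod.reindex_bij_witness[of _ "\<lambda>p. ?n - p" "\<lambda>p. ?n - p"])
      fix p assume p: "p \<in> {?n - d - Suc s<..?n - d - Suc s + d}"
      then have "0 < p" "p < ?n" using s by auto
      then show "(if ?n - p \<in> partial_sums \<alpha> then w else 1) = (if p \<in> partial_sums (rev \<alpha>) then w else 1)"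
        using partial_sums_rev[of p \<alpha>] by simp
    qed (use s in auto)
  qed
  finally show ?thesis .
qed

text \<open>Write the left end of a window as \<open>j * n + \<rho>\<close> with
  \<open>\<rho> < n\<close>. The multiples of \<open>n\<close> in it, divided by \<open>n\<close>,
  form the window of length \<open>(\<rho> + d) div n\<close> of \<open>\<alpha>\<close> starting at
  \<open>j\<close>; the other positions give a factor determined by \<open>\<rho>\<close>,
  \<open>d\<close> and \<open>\<beta>\<close>. Summing over \<open>j\<close> leaves window sums of
  \<open>\<alpha>\<close>.\<close>

lemma window_sum_comp_circ:
  assumes "composition \<alpha>" "composition \<beta>"
  shows "window_sum w (\<alpha> \<circ>\<^sub>c \<beta>) d = (\<Sum>\<rho><sum_list \<beta>.
    (\<Prod>p\<in>{\<rho><..\<rho> + d}. if \<not> sum_list \<beta> dvd p \<and> p mod sum_list \<beta> \<in> partial_sums \<beta> then w else 1) *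
    window_sum w \<alpha> ((\<rho> + d) div sum_list \<beta>))"
proof -
  define m n where "m = sum_list \<alpha>" "n = sum_list \<beta>"
  have n: "0 < n" using assms sum_list_pos by (auto simp: m_n_def)
  let ?K = "\<lambda>p. if \<not> n dvd p \<and> p mod n \<in> partial_sums \<beta> then w else 1"
  let ?P = "\<lambda>\<alpha> p. if p \<in> partial_sums \<alpha> then w else 1"
  have split: "(\<Prod>p\<in>{j * n + \<rho><..j * n + \<rho> + d}. ?P (\<alpha> \<circ>\<^sub>c \<beta>) p) =
    (\<Prod>p\<in>{\<rho><..\<rho> + d}. ?K p) * (\<Prod>i\<in>{j<..j + (\<rho> + d) div n}. ?P \<alpha> i)"
    if \<rho>: "\<rho> < n" and le: "j * n + \<rho> + d < m * n" for j \<rho>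
  proof -
    let ?I = "{j * n + \<rho><..j * n + \<rho> + d}"
    have "(\<Prod>p\<in>?I. ?P (\<alpha> \<circ>\<^sub>c \<beta>) p) = (\<Prod>p\<in>?I. ?K p * (if n dvd p then ?P \<alpha> (p div n) else 1))"
    proof (intro prod.cong refl)
      fix p assume p: "p \<in> ?I"
      then have "p \<in> partial_sums (\<alpha> \<circ>\<^sub>c \<beta>) \<longleftrightarrow>
          (if n dvd p then p div n \<in> partial_sums \<alpha> else p mod n \<in> partial_sums \<beta>)"
        unfolding m_n_def(2) using assms le by (intro partial_sums_comp_circ) (auto simp: m_n_def)
      then show "?P (\<alpha> \<circ>\<^sub>c \<beta>) p = ?K p * (if n dvd p then ?P \<alpha> (p div n) else 1)" by simp
    qed
    also have "\<dots> = (\<Prod>p\<in>?I. ?K p) * (\<Prod>p\<in>?I. if n dvd p then ?P \<alpha> (p div n) else 1)"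
      by (rule prod.distrib)
    also have "(\<Prod>p\<in>?I. ?K p) = (\<Prod>p\<in>{\<rho><..\<rho> + d}. ?K p)"
      by (rule sym, rule prod.reindex_bij_witness[of _ "\<lambda>p. p - j * n" "\<lambda>p. j * n + p"]) auto
    also have "(\<Prod>p\<in>?I. if n dvd p then ?P \<alpha> (p div n) else 1) = (\<Prod>p\<in>{p\<in>?I. n dvd p}. ?P \<alpha> (p div n))"
      by (rule prod.inter_filter[symmetric]) simp
    also have "\<dots> = (\<Prod>i\<in>{j<..j + (\<rho> + d) div n}. ?P \<alpha> i)"
    proof (rule prod.reindex_bij_witness[of _ "\<lambda>i. n * i" "\<lambda>p. p div n"])
      have *: "j + (\<rho> + d) div n = (j * n + \<rho> + d) div n" using n by (simp add: add.assoc)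
      fix p assume p: "p \<in> {p\<in>?I. n dvd p}"
      then obtain i where i: "p = n * i" by auto
      have p': "j * n + \<rho> < p" "p \<le> j * n + \<rho> + d" using p by auto
      have "j * n < i * n" using p'(1) unfolding i mult.commute[of n i] by linarith
      then have "j < i" using n by simp
      moreover have "i \<le> (j * n + \<rho> + d) div n" using p'(2) n unfolding i mult.commute[of n i]
        by (simp only: less_eq_div_iff_mult_less_eq)
      ultimately show "p div n \<in> {j<..j + (\<rho> + d) div n}" unfolding * i using n by simp
      show "n * (p div n) = p" using p by simp
    next
      have *: "j + (\<rho> + d) div n = (j * n + \<rho> + d) div n" using n by (simp add: add.assoc)
      fix i assume i: "i \<in> {j<..j + (\<rho> + d) div n}"
      then have "i * n \<le> j * n + \<rho> + d" unfolding * using n by (simp add: less_eq_div_iff_mult_less_eq)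
      moreover have "Suc j * n \<le> i * n" using i by (intro mult_le_mono1) simp
      ultimately show "n * i \<in> {p\<in>?I. n dvd p}" using \<rho> by (simp add: mult.commute)
    qed (use n in auto)
    finally show ?thesis .
  qed
  \<comment> \<open>A window fits into the product exactly if the window it induces fits into
    \<open>\<alpha>\<close>.\<close>
  have range: "j * n + \<rho> + d < m * n \<longleftrightarrow> j < m - (\<rho> + d) div n" for j \<rho>
  proof -
    have "j * n + \<rho> + d < m * n \<longleftrightarrow> (j * n + \<rho> + d) div n < m" using n by (simp add: div_less_iff_less_mult)
    also have "(j * n + \<rho> + d) div n = j + (\<rho> + d) div n" using n by (simp add: add.assoc)
    finally show ?thesis by auto
  qed
  have "window_sum w (\<alpha> \<circ>\<^sub>c \<beta>) d = (\<Sum>s<m * n - d. \<Prod>p\<in>{s<..s + d}. ?P (\<alpha> \<circ>\<^sub>c \<beta>) p)"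
    by (simp add: window_sum_def sum_list_comp_circ[OF assms(2)] m_n_def)
  \<comment> \<open>Windows sticking out on the right are added with weight 0, so that the left ends
    fill whole periods of length \<open>n\<close> and can be grouped by \<open>j\<close>.\<close>
  also have "\<dots> = (\<Sum>s<m * n. if s + d < m * n then \<Prod>p\<in>{s<..s + d}. ?P (\<alpha> \<circ>\<^sub>c \<beta>) p else 0)"
    by (rule sum.mono_neutral_cong_left) auto
  also have "\<dots> = (\<Sum>j<m. \<Sum>s = j * n..<j * n + n.
      if s + d < m * n then \<Prod>p\<in>{s<..s + d}. ?P (\<alpha> \<circ>\<^sub>c \<beta>) p else 0)"
    by (rule sum.nat_group[symmetric])
  also have "\<dots> = (\<Sum>j<m. \<Sum>\<rho><n. if j * n + \<rho> + d < m * n then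
      \<Prod>p\<in>{j * n + \<rho><..j * n + \<rho> + d}. ?P (\<alpha> \<circ>\<^sub>c \<beta>) p else 0)"
  proof (rule sum.cong[OF refl])
    fix j
    show "(\<Sum>s = j * n..<j * n + n. if s + d < m * n then \<Prod>p\<in>{s<..s + d}. ?P (\<alpha> \<circ>\<^sub>c \<beta>) p else 0) =
      (\<Sum>\<rho><n. if j * n + \<rho> + d < m * n then
        \<Prod>p\<in>{j * n + \<rho><..j * n + \<rho> + d}. ?P (\<alpha> \<circ>\<^sub>c \<beta>) p else 0)"
      by (rule sum.reindex_bij_witness[of _ "\<lambda>\<rho>. j * n + \<rho>" "\<lambda>s. s - j * n"]) auto
  qed
  also have "\<dots> = (\<Sum>j<m. \<Sum>\<rho><n. if j < m - (\<rho> + d) div n then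
      (\<Prod>p\<in>{\<rho><..\<rho> + d}. ?K p) * (\<Prod>i\<in>{j<..j + (\<rho> + d) div n}. ?P \<alpha> i) else 0)"
    by (intro sum.cong refl if_cong) (auto simp only: range split lessThan_iff)
  also have "\<dots> = (\<Sum>\<rho><n. \<Sum>j<m. if j < m - (\<rho> + d) div n then
      (\<Prod>p\<in>{\<rho><..\<rho> + d}. ?K p) * (\<Prod>i\<in>{j<..j + (\<rho> + d) div n}. ?P \<alpha> i) else 0)"
    by (rule sum.swap)
  also have "\<dots> = (\<Sum>\<rho><n. \<Sum>j<m - (\<rho> + d) div n.
      (\<Prod>p\<in>{\<rho><..\<rho> + d}. ?K p) * (\<Prod>i\<in>{j<..j + (\<rho> + d) div n}. ?P \<alpha> i))"
    by (intro sum.cong refl sum.mono_neutral_cong_right) auto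
  finally show ?thesis
    by (simp add: window_sum_def m_n_def sum_distrib_left)
qed

text \<open>Size and length belong to the relation because the reconstruction of
  \<open>coarse_sum\<close> runs up to the size, and because the number of leaves of the caterpillar
  depends on both.\<close>

definition window_equiv :: "'a::comm_ring_1 \<Rightarrow> nat list \<Rightarrow> nat list \<Rightarrow> bool" where
  "window_equiv w \<alpha> \<beta> \<longleftrightarrow> composition \<alpha> \<and> composition \<beta> \<and> sum_list \<alpha> = sum_list \<beta> \<and>
    length \<alpha> = length \<beta> \<and> window_sum w \<alpha> = window_sum w \<beta>"

lemma window_equiv_refl: "composition \<alpha> \<Longrightarrow> window_equiv w \<alpha> \<alpha>"
  by (simp add: window_equiv_def)

lemma window_equiv_sym: "window_equiv w \<alpha> \<beta> \<Longrightarrow> window_equiv w \<beta> \<alpha>"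
  by (simp add: window_equiv_def)

lemma window_equiv_trans [trans]:
  "window_equiv w \<alpha> \<beta> \<Longrightarrow> window_equiv w \<beta> \<gamma> \<Longrightarrow> window_equiv w \<alpha> \<gamma>"
  by (simp add: window_equiv_def)

lemma window_equiv_rev: "composition \<alpha> \<Longrightarrow> window_equiv w (rev \<alpha>) \<alpha>"
  by (simp add: window_equiv_def composition_rev window_sum_rev fun_eq_iff)

lemma window_equiv_comp_circ:
  assumes "window_equiv w \<alpha> \<alpha>'" "composition \<beta>"
  shows "window_equiv w (\<alpha> \<circ>\<^sub>c \<beta>) (\<alpha>' \<circ>\<^sub>c \<beta>)"
proof -
  have c: "composition \<alpha>" "composition \<alpha>'" using assms by (auto simp: window_equiv_def)
  show ?thesis using assms
    by (simp add: window_equiv_def composition_comp_circ sum_list_comp_circ length_comp_circ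
        window_sum_comp_circ[OF c(1)] window_sum_comp_circ[OF c(2)] fun_eq_iff)
qed

text \<open>\<open>window_sum_comp_circ\<close> controls changes of the left factor only. Reversing
  the whole product costs nothing and turns \<open>\<alpha> \<circ>\<^sub>c rev \<beta>\<close> into
  \<open>rev \<alpha> \<circ>\<^sub>c \<beta>\<close>, whose left factor can then be turned
  back.\<close>

lemma window_equiv_comp_circ_rev:
  assumes "composition \<alpha>" "composition \<beta>"
  shows "window_equiv w (\<alpha> \<circ>\<^sub>c rev \<beta>) (\<alpha> \<circ>\<^sub>c \<beta>)"
proof -
  have c: "composition (rev \<alpha> \<circ>\<^sub>c \<beta>)" using assms by (simp add: composition_comp_circ composition_rev)
  have "\<alpha> \<circ>\<^sub>c rev \<beta> = rev (rev \<alpha> \<circ>\<^sub>c \<beta>)" using assms by (simp add: comp_circ_rev composition_rev)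
  also have "window_equiv w \<dots> (rev \<alpha> \<circ>\<^sub>c \<beta>)" by (rule window_equiv_rev[OF c])
  also have "window_equiv w \<dots> (\<alpha> \<circ>\<^sub>c \<beta>)"
    by (intro window_equiv_comp_circ window_equiv_rev assms)
  finally show ?thesis .
qed

lemma circ_list_simps [simp]: "circ_list [] = [1]" "circ_list (a # as) = a \<circ>\<^sub>c circ_list as"
  by (simp_all add: circ_list_def)

lemma composition_one [simp]: "composition [Suc 0]"
  by (simp add: composition_def)

lemma composition_circ_list: "(\<And>a. a \<in> set as \<Longrightarrow> composition a) \<Longrightarrow> composition (circ_list as)"
  by (induction as) (auto simp: composition_comp_circ)

text \<open>The prefix \<open>\<alpha>\<close> is carried along so that each factor is first the
  right factor of \<open>\<alpha> \<circ>\<^sub>c b\<close>, where it can be reversed. The enlarged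
  prefix is a left factor of the rest, where only its window sums, size and length matter.\<close>

lemma window_equiv_comp_circ_list:
  assumes "list_all2 (\<lambda>b a. b = a \<or> b = rev a) bs as" "\<And>a. a \<in> set as \<Longrightarrow> composition a" "composition \<alpha>"
  shows "window_equiv w (\<alpha> \<circ>\<^sub>c circ_list bs) (\<alpha> \<circ>\<^sub>c circ_list as)"
  using assms
proof (induction arbitrary: \<alpha> rule: list_all2_induct)
  case Nil
  then show ?case by (simp add: window_equiv_refl composition_comp_circ)
next
  case (Cons b bs a as)
  have a: "composition a" "composition b" using Cons.hyps(1) Cons.prems(1)[of a]
    by (auto simp: composition_rev)
  have "set bs \<subseteq> set as \<union> rev ` set as"
    using Cons.hyps(2) by (induction rule: list_all2_induct) auto
  then have bs: "composition (circ_list bs)" and as: "composition (circ_list as)"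
    using Cons.prems(1) by (auto intro!: composition_circ_list simp: composition_rev)
  have "\<alpha> \<circ>\<^sub>c circ_list (b # bs) = (\<alpha> \<circ>\<^sub>c b) \<circ>\<^sub>c circ_list bs"
    using comp_circ_assoc[OF Cons.prems(2) a(2) bs] by simp
  also have "window_equiv w \<dots> ((\<alpha> \<circ>\<^sub>c a) \<circ>\<^sub>c circ_list bs)"
    using Cons.hyps(1) window_equiv_comp_circ_rev[OF Cons.prems(2) a(1)]
      window_equiv_refl[OF composition_comp_circ[OF Cons.prems(2) a(1)]] bs
    by (intro window_equiv_comp_circ) auto
  also have "window_equiv w \<dots> ((\<alpha> \<circ>\<^sub>c a) \<circ>\<^sub>c circ_list as)"
    using Cons.prems a by (intro Cons.IH composition_comp_circ) auto
  also have "(\<alpha> \<circ>\<^sub>c a) \<circ>\<^sub>c circ_list as = \<alpha> \<circ>\<^sub>c circ_list (a # as)"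
    using comp_circ_assoc[OF Cons.prems(2) a(1) as] by simp
  finally show ?case .
qed

lemma window_equiv_circ_list:
  assumes "list_all2 (\<lambda>b a. b = a \<or> b = rev a) bs as" "\<And>a. a \<in> set as \<Longrightarrow> composition a"
  shows "window_equiv w (circ_list bs) (circ_list as)"
  using window_equiv_comp_circ_list[OF assms, of "[1]" w] by simp

subsection \<open>Recovering coarsening sums from window sums\<close>

lemma coarse_sum_truncated:
  fixes v w :: "'a::comm_ring_1"
  assumes "v + w = 1" "composition \<alpha>"
  shows "coarse_sum v w (\<lambda>a. of_nat (a - d)) \<alpha> = window_sum w \<alpha> d"
  using assms(2)
proof (induction "length \<alpha>" arbitrary: \<alpha>)
  case 0
  then show ?case by simp
next
  case (Suc n)
  then obtain a r where \<alpha>: "\<alpha> = a # r" by (cases \<alpha>) auto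
  show ?case
  proof (cases r)
    case Nil
    have "(\<Prod>p\<in>{s<..s + d}. if p \<in> partial_sums [a] then w else 1) = 1" if "s < a - d" for s
      using that by (intro prod.neutral) auto
    then show ?thesis by (simp add: \<alpha> Nil window_sum_def)
  next
    case (Cons b t)
    let ?P = "\<lambda>\<alpha> s. \<Prod>p\<in>{s<..s + d}. if p \<in> partial_sums \<alpha> then w else 1"
    let ?\<alpha> = "a # b # t" and ?\<beta> = "b # t" and ?\<gamma> = "(a + b) # t"
    let ?S = "sum_list ?\<beta>"
    have c: "composition ?\<beta>" "composition ?\<gamma>" "0 < a" "0 < b"
      using Suc.prems(1) unfolding \<alpha> Cons by (auto simp: composition_Cons)
    have n: "n = length ?\<beta>" "n = length ?\<gamma>" using Suc.hyps(2) by (auto simp: \<alpha> Cons)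
    have ps: "partial_sums ?\<alpha> = insert a (partial_sums ?\<gamma>)"
      by (auto simp: image_image add.assoc)
    have nin: "a \<notin> partial_sums ?\<gamma>" using c by auto
    have shift: "a + p \<in> partial_sums ?\<gamma> \<longleftrightarrow> p \<in> partial_sums ?\<beta>" if "0 < p" for p
    proof -
      have "a + p \<in> partial_sums ?\<alpha> \<longleftrightarrow> p \<in> partial_sums ?\<beta>"
        unfolding partial_sums_Cons[of a] using that by auto
      then show ?thesis unfolding ps using that by simp
    qed
    have left: "?P ?\<gamma> s = 1" if "s + d < a" for s
      using that by (intro prod.neutral) auto
    have right: "?P ?\<gamma> (a + s) = ?P ?\<beta> s" for s
      by (rule prod.reindex_bij_witness[of _ "\<lambda>p. a + p" "\<lambda>p. p - a"])
        (auto simp: shift[symmetric] simp del: partial_sums_Cons)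
    have cross: "?P ?\<alpha> s = (if s < a \<and> a \<le> s + d then w else 1) * ?P ?\<gamma> s" for s
    proof -
      have "?P ?\<alpha> s = (\<Prod>p\<in>{s<..s + d}. (if p = a then w else 1) * (if p \<in> partial_sums ?\<gamma> then w else 1))"
        unfolding ps using nin by (intro prod.cong refl) auto
      then show ?thesis by (simp add: prod.distrib)
    qed
    let ?n = "a + ?S"
    \<comment> \<open>\<open>E\<close> collects the windows that avoid position \<open>a\<close> and
      \<open>F\<close> those that contain it, both weighted by \<open>?\<gamma>\<close>. As
      \<open>a\<close> is a partial sum of \<open>?\<alpha>\<close> but not of
      \<open>?\<gamma>\<close>, passing to \<open>?\<alpha>\<close> multiplies exactly
      \<open>F\<close> by \<open>w\<close>.\<close>
    define E where "E = (\<Sum>s<?n - d. if s < a \<and> a \<le> s + d then 0 else ?P ?\<gamma> s)"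
    define F where "F = (\<Sum>s<?n - d. if s < a \<and> a \<le> s + d then ?P ?\<gamma> s else 0)"
    have W\<alpha>: "window_sum w ?\<alpha> d = E + w * F"
      unfolding window_sum_def E_def F_def cross sum_distrib_left sum.distrib[symmetric]
      by (intro sum.cong) auto
    have W\<gamma>: "window_sum w ?\<gamma> d = E + F"
      unfolding window_sum_def E_def F_def sum.distrib[symmetric] by (intro sum.cong) auto
    \<comment> \<open>A window avoiding \<open>a\<close> lies to its left, where it meets no partial
      sum, or to its right, where it is a window of \<open>?\<beta>\<close>.\<close>
    have "E = (\<Sum>s\<in>{..<a - d} \<union> {a..<?n - d}. ?P ?\<gamma> s)"
      unfolding E_def by (rule sum.mono_neutral_cong_right) auto
    also have "\<dots> = (\<Sum>s\<in>{..<a - d}. ?P ?\<gamma> s) + (\<Sum>s\<in>{a..<?n - d}. ?P ?\<gamma> s)"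
      by (rule sum.union_disjoint) auto
    also have "(\<Sum>s\<in>{..<a - d}. ?P ?\<gamma> s) = (\<Sum>s\<in>{..<a - d}. 1)"
      by (intro sum.cong refl left) auto
    also have "(\<Sum>s\<in>{a..<?n - d}. ?P ?\<gamma> s) = window_sum w ?\<beta> d"
      unfolding window_sum_def right[symmetric]
      by (rule sum.reindex_bij_witness[of _ "\<lambda>s. a + s" "\<lambda>s. s - a"]) auto
    finally have E: "E = of_nat (a - d) + window_sum w ?\<beta> d" by simp
    have "coarse_sum v w (\<lambda>a. of_nat (a - d)) ?\<alpha> =
        v * (of_nat (a - d) + window_sum w ?\<beta> d) + w * window_sum w ?\<gamma> d"
      unfolding coarse_sum_Cons_Cons[OF assms(1)] Suc.hyps(1)[OF n(1) c(1)] Suc.hyps(1)[OF n(2) c(2)] ..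
    also have "\<dots> = (v + w) * E + w * F" unfolding W\<gamma> E[symmetric] by (simp add: algebra_simps)
    finally show ?thesis unfolding \<alpha> Cons W\<alpha> assms(1) by simp
  qed
qed

section \<open>Linearity of coarsening sums, and second differences\<close>

lemma first_block_sum:
  "first_block v w (\<lambda>a. \<Sum>e\<in>I. g e * h e a) a r = (\<Sum>e\<in>I. g e * first_block v w (h e) a r)"
  by (induction r arbitrary: a) (simp_all add: sum_distrib_left sum.distrib algebra_simps)

lemma blocks_sum_sum:
  "blocks_sum v w (\<lambda>a. \<Sum>e\<in>I. g e * h e a) r = (\<Sum>e\<in>I. g e * blocks_sum v w (h e) r)"
  by (induction r) (simp_all add: first_block_sum sum.distrib algebra_simps)

lemma coarse_sum_sum:
  "coarse_sum v w (\<lambda>a. \<Sum>e\<in>I. g e * h e a) \<alpha> = (\<Sum>e\<in>I. g e * coarse_sum v w (h e) \<alpha>)"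
  by (cases \<alpha>) (simp_all add: first_block_sum blocks_sum_sum sum_distrib_left sum.distrib algebra_simps)

lemma first_block_cong:
  assumes "\<And>b. 0 < b \<Longrightarrow> b \<le> a + sum_list r \<Longrightarrow> f b = g b" "0 < a"
  shows "first_block v w f a r = first_block v w g a r"
  using assms by (induction r arbitrary: a) auto

lemma blocks_sum_cong:
  assumes "\<And>b. 0 < b \<Longrightarrow> b \<le> sum_list r \<Longrightarrow> f b = g b" "\<And>a. a \<in> set r \<Longrightarrow> 0 < a"
  shows "blocks_sum v w f r = blocks_sum v w g r"
  using assms by (induction r) (auto intro!: arg_cong2[where f = "(+)"] first_block_cong)

lemma coarse_sum_cong:
  assumes "composition \<alpha>" "\<And>b. 0 < b \<Longrightarrow> b \<le> sum_list \<alpha> \<Longrightarrow> f b = g b"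
  shows "coarse_sum v w f \<alpha> = coarse_sum v w g \<alpha>"
proof (cases \<alpha>)
  case (Cons a r)
  then show ?thesis using assms first_block_cong[of a r f g] blocks_sum_cong[of r f g]
    by (auto simp: composition_def)
qed simp

text \<open>The second difference of \<open>a \<mapsto> max (a - e) 0\<close> is the indicator of \<open>a = e\<close>.\<close>

lemma coarse_sum_conv_window_sums:
  fixes v w :: "'a::comm_ring_1"
  assumes "v + w = 1" "composition \<alpha>"
  shows "coarse_sum v w f \<alpha> = (\<Sum>e<sum_list \<alpha>. f (Suc e) *
    (window_sum w \<alpha> e - 2 * window_sum w \<alpha> (Suc e) + window_sum w \<alpha> (Suc (Suc e))))"
proof -
  let ?t = "\<lambda>d a. of_nat (a - d) :: 'a"
  have ind: "?t e a - 2 * ?t (Suc e) a + ?t (Suc (Suc e)) a = (if a = Suc e then 1 else 0)" for e a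
  proof -
    consider "a \<le> e" | "a = Suc e" | k where "a = Suc (Suc e) + k"
      by (metis less_eq_Suc_le nat_less_le not_less_eq_eq le_iff_add)
    then show ?thesis by cases (simp_all add: algebra_simps)
  qed
  have diff: "coarse_sum v w (\<lambda>a. ?t e a - 2 * ?t (Suc e) a + ?t (Suc (Suc e)) a) \<alpha> =
    window_sum w \<alpha> e - 2 * window_sum w \<alpha> (Suc e) + window_sum w \<alpha> (Suc (Suc e))" for e
  proof -
    \<comment> \<open>The second difference is written as a sum over three indices to bring it under
      the linearity lemma \<open>coarse_sum_sum\<close>.\<close>
    have "coarse_sum v w (\<lambda>a. \<Sum>i<3. [1, - 2, 1] ! i * ?t (e + i) a) \<alpha> =
      (\<Sum>i<3. [1, - 2, 1] ! i * window_sum w \<alpha> (e + i))"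
      unfolding coarse_sum_sum coarse_sum_truncated[OF assms] ..
    then show ?thesis by (simp add: numeral_3_eq_3)
  qed
  have "coarse_sum v w f \<alpha> = coarse_sum v w (\<lambda>a. \<Sum>e<sum_list \<alpha>. f (Suc e) *
      (?t e a - 2 * ?t (Suc e) a + ?t (Suc (Suc e)) a)) \<alpha>"
  proof (rule coarse_sum_cong[OF assms(2)])
    fix b assume "0 < b" "b \<le> sum_list \<alpha>"
    then obtain k where "b = Suc k" "k < sum_list \<alpha>" by (cases b) auto
    then show "f b = (\<Sum>e<sum_list \<alpha>. f (Suc e) *
      (?t e b - 2 * ?t (Suc e) b + ?t (Suc (Suc e)) b))" unfolding ind by (simp add: if_distrib cong: if_cong)
  qed
  also have "\<dots> = (\<Sum>e<sum_list \<alpha>. f (Suc e) *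
      coarse_sum v w (\<lambda>a. ?t e a - 2 * ?t (Suc e) a + ?t (Suc (Suc e)) a) \<alpha>)"
    by (rule coarse_sum_sum)
  finally show ?thesis unfolding diff .
qed

lemma coarse_sum_eq_if_window_equiv:
  assumes "v + w = 1" "window_equiv w \<alpha> \<beta>"
  shows "coarse_sum v w f \<alpha> = coarse_sum v w f \<beta>"
  using assms by (simp add: coarse_sum_conv_window_sums window_equiv_def)

lemma H_poly_eq_if_window_equiv:
  assumes "\<And>w :: int poly poly fract mpoly. window_equiv w \<alpha> \<beta>"
  shows "H_poly \<alpha> = H_poly \<beta>"
proof -
  have c: "composition \<alpha>" "composition \<beta>" using assms by (auto simp: window_equiv_def)
  show ?thesis
    unfolding H_poly_eq_coarse_sum(2)[OF c(1)] H_poly_eq_coarse_sum(2)[OF c(2)]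
    by (intro coarse_sum_eq_if_window_equiv H_poly_eq_coarse_sum(1)[OF c(1)] assms)
qed

subsection \<open>Counting switches\<close>

lemma composition_eqI_interior:
  assumes "composition \<alpha>" "composition \<beta>" "sum_list \<alpha> = sum_list \<beta>"
    "\<And>p. 0 < p \<Longrightarrow> p < sum_list \<beta> \<Longrightarrow> p \<in> partial_sums \<alpha> \<longleftrightarrow> p \<in> partial_sums \<beta>"
  shows "\<alpha> = \<beta>"
proof (rule composition_eqI[OF assms(1,2)], rule set_eqI)
  fix p
  have "sum_list \<beta> \<in> partial_sums \<alpha>" "sum_list \<beta> \<in> partial_sums \<beta>"
    using assms(1-3) sum_list_in_partial_sums by (metis composition_Nil)+
  moreover have "p \<in> partial_sums \<alpha> \<union> partial_sums \<beta> \<Longrightarrow> 0 < p \<and> p \<le> sum_list \<beta>"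
    using assms(1-3) partial_sums_pos partial_sums_le by (metis Un_iff)
  ultimately show "p \<in> partial_sums \<alpha> \<longleftrightarrow> p \<in> partial_sums \<beta>"
    using assms(4)[of p] by (cases "p = sum_list \<beta>") auto
qed

text \<open>Right factors of equal size put the joints at the same positions:
  \<open>\<alpha>\<close> is read off at the multiples of \<open>n\<close>, and
  \<open>\<beta>\<close> at the positions below \<open>n\<close>.\<close>

lemma comp_circ_inject:
  assumes "composition \<alpha>" "composition \<alpha>'" "composition \<beta>" "composition \<beta>'"
    "sum_list \<beta> = sum_list \<beta>'" "\<alpha> \<circ>\<^sub>c \<beta> = \<alpha>' \<circ>\<^sub>c \<beta>'"
  shows "\<alpha> = \<alpha>' \<and> \<beta> = \<beta>'"
proof -
  define m n where "m = sum_list \<alpha>" "n = sum_list \<beta>"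
  have pos: "0 < m" "0 < n" using assms sum_list_pos by (auto simp: m_n_def)
  have "m * n = sum_list \<alpha>' * n"
    using assms(3-6) unfolding m_n_def by (metis sum_list_comp_circ)
  then have m': "sum_list \<alpha>' = m" using pos by simp
  note m = m_n_def(1)[symmetric] and n = m_n_def(2)[symmetric] and n' = assms(5)[symmetric, folded m_n_def(2)]
  have ps: "(if n dvd p then p div n \<in> partial_sums \<alpha> else p mod n \<in> partial_sums \<beta>) \<longleftrightarrow>
    (if n dvd p then p div n \<in> partial_sums \<alpha>' else p mod n \<in> partial_sums \<beta>')"
    if "0 < p" "p \<le> m * n" for p
    using partial_sums_comp_circ[OF assms(1,3) that(1)] partial_sums_comp_circ[OF assms(2,4) that(1)] that
    unfolding m n n' m' assms(6) by simp
  have "i \<in> partial_sums \<alpha> \<longleftrightarrow> i \<in> partial_sums \<alpha>'" if "0 < i" "i \<le> m" for i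
    using ps[of "i * n"] that pos by simp
  then have "\<alpha> = \<alpha>'" using m m' assms(1,2)
    by (intro composition_eqI_interior) auto
  moreover have "i \<in> partial_sums \<beta> \<longleftrightarrow> i \<in> partial_sums \<beta>'" if "0 < i" "i < n" for i
  proof -
    have "i \<le> m * n" using that pos by (metis le_trans less_imp_le_nat mult_le_mono1 nat_mult_1 One_nat_def Suc_leI)
    then show ?thesis using ps[of i] that by (simp add: nat_dvd_not_less)
  qed
  ultimately have "\<beta> = \<beta>'" using n n' assms(3,4)
    by (intro composition_eqI_interior) auto
  then show ?thesis using \<open>\<alpha> = \<alpha>'\<close> by simp
qed

text \<open>Two switches of the same list have tails of equal size, which is what cancellation of
  the first factors requires.\<close>

lemma circ_list_inject:
  assumes "list_all2 (\<lambda>b a. b = a \<or> b = rev a) bs as" "list_all2 (\<lambda>b a. b = a \<or> b = rev a) bs' as"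
    "\<And>a. a \<in> set as \<Longrightarrow> composition a" "circ_list bs = circ_list bs'"
  shows "bs = bs'"
  using assms
proof (induction as arbitrary: bs bs' rule: list.induct)
  case Nil
  then show ?case by simp
next
  case (Cons a as)
  obtain b cs b' cs' where bs: "bs = b # cs" "bs' = b' # cs'"
    "list_all2 (\<lambda>b a. b = a \<or> b = rev a) cs as" "list_all2 (\<lambda>b a. b = a \<or> b = rev a) cs' as"
    "b = a \<or> b = rev a" "b' = a \<or> b' = rev a"
    using Cons.prems(1,2) by (auto simp: list_all2_Cons2)
  have comp: "composition b" "composition b'" using bs(5,6) Cons.prems(3)[of a] by (auto simp: composition_rev)
  \<comment> \<open>Only the equality of sizes is drawn from this; the ring and the value 0 are
    arbitrary.\<close>
  have "window_equiv (0::int) (circ_list cs) (circ_list as)" "window_equiv (0::int) (circ_list cs') (circ_list as)"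
    using Cons.prems(3) by (auto intro!: window_equiv_circ_list bs(3,4))
  then have "b = b' \<and> circ_list cs = circ_list cs'"
    using Cons.prems(4) comp unfolding bs(1,2)
    by (intro comp_circ_inject) (auto simp: window_equiv_def)
  then show ?case using Cons.IH[OF bs(3,4)] Cons.prems(3) unfolding bs(1,2) by auto
qed

lemma card_switched_factors:
  "finite {bs. list_all2 (\<lambda>b a. b = a \<or> b = rev a) bs as} \<and>
   card {bs. list_all2 (\<lambda>b a. b = a \<or> b = rev a) bs as} = 2 ^ length (filter (\<lambda>a. \<not> palindrome a) as)"
proof (induction as)
  case Nil
  then show ?case by simp
next
  case (Cons a as)
  let ?S = "{bs. list_all2 (\<lambda>b a. b = a \<or> b = rev a) bs as}"
  have eq: "{bs. list_all2 (\<lambda>b a. b = a \<or> b = rev a) bs (a # as)} = (\<lambda>(b, bs). b # bs) ` ({a, rev a} \<times> ?S)"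
    by (auto simp: list_all2_Cons2 image_iff)
  have "card {a, rev a} = (if palindrome a then 1 else 2)"
    by (auto simp: palindrome_def card_insert_if)
  moreover have "card ((\<lambda>(b, bs). b # bs) ` ({a, rev a} \<times> ?S)) = card {a, rev a} * card ?S"
    by (subst card_image) (auto simp: inj_on_def card_cartesian_product)
  ultimately show ?case using Cons.IH unfolding eq by auto
qed

section \<open>Representatives up to reversal\<close>

lemma rev_circ_list:
  "(\<And>a. a \<in> set as \<Longrightarrow> composition a) \<Longrightarrow> rev (circ_list as) = circ_list (map rev as)"
  by (induction as) (auto simp: comp_circ_rev composition_circ_list)

text \<open>Classes under reversal have at most two elements, so choosing one of each keeps at least
  half of \<open>F\<close>. The class of \<open>a\<close> is represented by \<open>a\<close> itself,
  since the family of caterpillars has to contain the given one.\<close>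

lemma rev_class_representatives:
  fixes F :: "'a list set"
  assumes "finite F" "\<And>x. x \<in> F \<Longrightarrow> rev x \<in> F" "a \<in> F"
  obtains B where "B \<subseteq> F" "a \<in> B" "card F \<le> 2 * card B" "pairwise (\<lambda>x y. x \<noteq> y \<and> x \<noteq> rev y) B"
proof
  define cl where "cl x = {x, rev x}" for x :: "'a list"
  define ch where "ch o' = (if a \<in> o' then a else (SOME x. x \<in> o'))" for o' :: "'a list set"
  define B where "B = ch ` cl ` F"
  have ch: "ch (cl x) \<in> cl x" for x
    unfolding ch_def cl_def using someI[of "\<lambda>y. y \<in> {x, rev x}" x] by auto
  have cl_eq: "y \<in> cl x \<Longrightarrow> cl y = cl x" for x y unfolding cl_def by auto
  have inj: "inj_on ch (cl ` F)"
  proof (rule inj_onI)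
    fix X Y assume "X \<in> cl ` F" "Y \<in> cl ` F" "ch X = ch Y"
    then show "X = Y" using ch cl_eq by (metis imageE)
  qed
  have "cl x \<subseteq> F" if "x \<in> F" for x using that assms(2) by (auto simp: cl_def)
  then show "B \<subseteq> F" using ch unfolding B_def by blast
  have "ch (cl a) = a" by (simp add: ch_def cl_def)
  then show "a \<in> B" using assms(3) unfolding B_def by force
  have "F \<subseteq> \<Union> (cl ` F)" by (auto simp: cl_def)
  then have "card F \<le> card (\<Union> (cl ` F))" using assms(1) by (intro card_mono) (auto simp: cl_def)
  also have "\<dots> \<le> (\<Sum>X\<in>cl ` F. card X)" using assms(1) by (intro card_Union_le_sum_card)
  also have "\<dots> \<le> (\<Sum>X\<in>cl ` F. 2)"
    by (intro sum_mono) (auto simp: cl_def card_insert_if)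
  also have "\<dots> = 2 * card B" unfolding B_def by (simp add: card_image[OF inj])
  finally show "card F \<le> 2 * card B" .
  show "pairwise (\<lambda>x y. x \<noteq> y \<and> x \<noteq> rev y) B"
  proof (rule pairwiseI)
    fix x y assume xy: "x \<in> B" "y \<in> B" "x \<noteq> y"
    then obtain X Y where X: "X \<in> cl ` F" "x = ch X" and Y: "Y \<in> cl ` F" "y = ch Y"
      unfolding B_def by auto
    then have "cl x = X" "cl y = Y" using ch cl_eq by auto
    then have "cl x \<noteq> cl y" using xy X Y by auto
    then show "x \<noteq> y \<and> x \<noteq> rev y" by (auto simp: cl_def)
  qed
qed

lemma switch_representatives:
  assumes "\<And>a. a \<in> set as \<Longrightarrow> composition a"
  obtains B where "finite B" "circ_list as \<in> B"
    "2 ^ (length (filter (\<lambda>a. \<not> palindrome a) as) - 1) \<le> card B"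
    "pairwise (\<lambda>\<beta> \<gamma>. \<beta> \<noteq> \<gamma> \<and> \<beta> \<noteq> rev \<gamma>) B"
    "\<And>\<beta>. \<beta> \<in> B \<Longrightarrow> \<exists>bs. list_all2 (\<lambda>b a. b = a \<or> b = rev a) bs as \<and> \<beta> = circ_list bs"
proof -
  define q where "q = length (filter (\<lambda>a. \<not> palindrome a) as)"
  define S where "S = {bs. list_all2 (\<lambda>b a. b = a \<or> b = rev a) bs as}"
  have S: "finite S" "card S = 2 ^ q" unfolding S_def q_def using card_switched_factors by auto
  have inj: "inj_on circ_list S" unfolding S_def by (intro inj_onI) (auto intro: circ_list_inject assms)
  have comp: "composition b" if "bs \<in> S" "b \<in> set bs" for b bs
    using that assms unfolding S_def list_all2_conv_all_nth mem_Collect_eq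
    by (metis composition_rev in_set_conv_nth)
  have closed: "rev x \<in> circ_list ` S" if x: "x \<in> circ_list ` S" for x
  proof -
    obtain bs where bs: "bs \<in> S" "x = circ_list bs" using x by auto
    have "map rev bs \<in> S" using bs(1) by (auto simp: S_def list_all2_conv_all_nth)
    then show ?thesis using rev_circ_list[of bs] comp[OF bs(1)] bs(2) by auto
  qed
  have "as \<in> S" by (simp add: S_def list_all2_refl)
  then obtain B where B: "B \<subseteq> circ_list ` S" "circ_list as \<in> B" "card (circ_list ` S) \<le> 2 * card B"
    "pairwise (\<lambda>x y. x \<noteq> y \<and> x \<noteq> rev y) B"
    using rev_class_representatives[of "circ_list ` S" "circ_list as"] closed S(1) by blast
  have fin: "finite B" using B(1) S(1) by (auto intro: finite_subset)
  \<comment> \<open>For \<open>q = 0\<close> truncated subtraction makes the bound 1, which holds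
    because \<open>B\<close> contains the given product.\<close>
  have "2 ^ (q - 1) \<le> card B"
  proof (cases q)
    case 0
    then show ?thesis using B(2) fin by (auto simp: Suc_le_eq card_gt_0_iff)
  next
    case (Suc k)
    then show ?thesis using B(3) S(2) by (simp add: card_image[OF inj])
  qed
  then show ?thesis using that[OF fin B(2)] B(1,4) unfolding q_def S_def by blast
qed

subsection \<open>Isomorphic caterpillars\<close>

text \<open>The caterpillar is rooted at \<open>(0, 0)\<close>, which by truncated subtraction is
  its own parent. Edges correspond to the vertices with \<open>v \<noteq> parent v\<close>, each
  joined to its parent, so they can be counted as vertices.\<close>

definition parent :: "nat \<times> nat \<Rightarrow> nat \<times> nat" where
  "parent v = (if snd v = 0 then (fst v - 1, 0) else (fst v, 0))"

lemma parent_simps [simp]: "parent (i, 0) = (i - 1, 0)" "0 < j \<Longrightarrow> parent (i, j) = (i, 0)"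
  by (auto simp: parent_def)

lemma pverts_Cat: "(i, j) \<in> pverts (Cat c) \<longleftrightarrow> i < length c \<and> j < c ! i"
  by (simp add: Cat_def)

lemma spine_in_pverts_Cat: "composition c \<Longrightarrow> (i, 0) \<in> pverts (Cat c) \<longleftrightarrow> i < length c"
  by (auto simp: pverts_Cat composition_def)

lemma finite_pverts_Cat: "finite (pverts (Cat c))"
  by (rule finite_subset[of _ "Sigma {..<length c} (\<lambda>i. {..<c ! i})"]) (auto simp: pverts_Cat)

lemma parent_in_pverts_Cat: "v \<in> pverts (Cat c) \<Longrightarrow> composition c \<Longrightarrow> parent v \<in> pverts (Cat c)"
  by (cases v) (auto simp: pverts_Cat parent_def composition_def)

lemma parcs_Cat:
  assumes "composition c"
  shows "(u, v) \<in> parcs (Cat c) \<longleftrightarrow>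
    u \<in> pverts (Cat c) \<and> v \<in> pverts (Cat c) \<and> u \<noteq> v \<and> (u = parent v \<or> v = parent u)"
proof -
  have arcs: "(u, v) \<in> Cat_arcs c \<longleftrightarrow> u \<in> pverts (Cat c) \<and> v \<in> pverts (Cat c) \<and> u \<noteq> v \<and> u = parent v" for u v
  proof (cases v)
    case (Pair i j)
    show ?thesis
    proof (cases "j = 0")
      case True
      then show ?thesis using assms
        by (cases i) (auto simp: Pair Cat_arcs_def spine_in_pverts_Cat, (simp add: Cat_def composition_def)?)
    next
      case False
      then show ?thesis using assms
        by (auto simp: Pair Cat_arcs_def spine_in_pverts_Cat pverts_Cat)
    qed
  qed
  have "parcs (Cat c) = Cat_arcs c \<union> (Cat_arcs c)\<inverse>" by (simp add: Cat_def)
  then show ?thesis using arcs[of u v] arcs[of v u] by auto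
qed

lemma Cat_inject:
  assumes "composition c" "composition c'" "Cat c = Cat c'"
  shows "c = c'"
proof -
  have V: "i < length c \<and> j < c ! i \<longleftrightarrow> i < length c' \<and> j < c' ! i" for i j
    using assms(3) pverts_Cat by metis
  have l: "length c = length c'"
    using spine_in_pverts_Cat[OF assms(1)] spine_in_pverts_Cat[OF assms(2)] assms(3)
    by (metis linorder_neqE_nat less_irrefl)
  show ?thesis
    using V l by (intro nth_equalityI) (auto, metis linorder_neqE_nat less_irrefl)
qed

lemma card_neighbours_Cat:
  assumes "composition c"
  shows "i < length c \<Longrightarrow> card {u. ((i, 0), u) \<in> parcs (Cat c)} =
      c ! i - 1 + (if 0 < i then 1 else 0) + (if Suc i < length c then 1 else 0)"
    and "0 < j \<Longrightarrow> (i, j) \<in> pverts (Cat c) \<Longrightarrow> {u. ((i, j), u) \<in> parcs (Cat c)} = {(i, 0)}"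
proof -
  assume i: "i < length c"
  have "{u. ((i, 0), u) \<in> parcs (Cat c)} = (Pair i ` {0<..<c ! i}) \<union>
    ((if 0 < i then {(i - 1, 0)} else {}) \<union> (if Suc i < length c then {(Suc i, 0)} else {}))" (is "?A = ?B")
  proof (intro set_eqI)
    fix u :: "nat \<times> nat"
    show "u \<in> ?A \<longleftrightarrow> u \<in> ?B"
    proof (cases u)
      case (Pair a b)
      show ?thesis
      proof (cases "b = 0")
        case True
        then show ?thesis using i unfolding Pair mem_Collect_eq parcs_Cat[OF assms]
          by (cases a) (auto simp: spine_in_pverts_Cat[OF assms])
      next
        case False
        then show ?thesis using i unfolding Pair mem_Collect_eq parcs_Cat[OF assms]
          by (auto simp: spine_in_pverts_Cat[OF assms] pverts_Cat parent_def)
      qed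
    qed
  qed
  also have "card ?B = card (Pair i ` {0<..<c ! i}) +
    card ((if 0 < i then {(i - 1, 0)} else {}) \<union> (if Suc i < length c then {(Suc i, 0::nat)} else {}))"
    by (rule card_Un_disjoint) auto
  also have "card (Pair i ` {0<..<c ! i}) = c ! i - 1" by (simp add: card_image inj_on_def)
  finally show "card {u. ((i, 0), u) \<in> parcs (Cat c)} =
      c ! i - 1 + (if 0 < i then 1 else 0) + (if Suc i < length c then 1 else 0)" by simp
next
  assume "0 < j" "(i, j) \<in> pverts (Cat c)"
  then show "{u. ((i, j), u) \<in> parcs (Cat c)} = {(i, 0)}"
    using assms unfolding parcs_Cat[OF assms]
    by (auto simp: parent_def spine_in_pverts_Cat pverts_Cat split: if_splits)
qed

text \<open>An injective walk along a path cannot turn back, so its direction is constant, and the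
  bound \<open>k\<close> determines where it starts.\<close>

lemma path_automorphism:
  fixes \<pi> :: "nat \<Rightarrow> nat"
  assumes inj: "inj_on \<pi> {..<k}" and bound: "\<And>i. i < k \<Longrightarrow> \<pi> i < k"
    and adj: "\<And>i. Suc i < k \<Longrightarrow> \<pi> (Suc i) = Suc (\<pi> i) \<or> \<pi> i = Suc (\<pi> (Suc i))"
  shows "(\<forall>i<k. \<pi> i = i) \<or> (\<forall>i<k. \<pi> i = k - 1 - i)"
proof (cases "Suc 0 < k")
  case False
  then show ?thesis using bound by (cases k) auto
next
  case True
  have no_turn: "\<pi> (Suc (Suc i)) \<noteq> \<pi> i" if "Suc (Suc i) < k" for i
    using inj_onD[OF inj, of "Suc (Suc i)" i] that by auto
  show ?thesis
  proof (cases "\<pi> (Suc 0) = Suc (\<pi> 0)")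
    case up: True
    have "Suc i < k \<Longrightarrow> \<pi> (Suc i) = Suc (\<pi> i)" for i
    proof (induction i)
      case (Suc i)
      then show ?case using adj[of "Suc i"] no_turn[of i] by auto
    qed (use up in simp)
    then have *: "i < k \<Longrightarrow> \<pi> i = \<pi> 0 + i" for i by (induction i) auto
    have "\<pi> 0 = 0" using *[of "k - 1"] bound[of "k - 1"] True by linarith
    then show ?thesis using * by (metis add_0)
  next
    case False
    have "Suc i < k \<Longrightarrow> \<pi> i = Suc (\<pi> (Suc i))" for i
    proof (induction i)
      case (Suc i)
      then show ?case using adj[of "Suc i"] no_turn[of i] by auto
    qed (use adj[OF True] False in simp)
    then have *: "i < k \<Longrightarrow> \<pi> i + i = \<pi> 0" for i by (induction i) auto
    have "\<pi> 0 = k - 1" using *[of "k - 1"] bound[of 0] True by linarith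
    then show ?thesis using * by (metis add_diff_cancel_right')
  qed
qed

text \<open>The spine vertices are those of degree at least 2, so an isomorphism restricts to a
  bijection between the spines, and then the degrees reveal the parts. The bound 3 on the size
  excludes \<open>[2]\<close>, whose caterpillar is a single edge with a spine vertex of degree
  1.\<close>

lemma isomorphic_Cat_imp:
  assumes "composition c" "2 \<le> hd c" "2 \<le> last c" "3 \<le> sum_list c"
    and "composition c'" "2 \<le> hd c'" "2 \<le> last c'" "3 \<le> sum_list c'"
    and "isomorphic (Cat c) (Cat c')"
  shows "c' = c \<or> c' = rev c"
proof -
  let ?V = "\<lambda>c. pverts (Cat c)" and ?E = "\<lambda>c. parcs (Cat c)"
  let ?N = "\<lambda>c v. {u. (v, u) \<in> parcs (Cat c)}"
  obtain f where f: "pre_digraph.digraph_isomorphism (with_proj (Cat c)) f"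
    "with_proj (Cat c') = app_iso f (with_proj (Cat c))"
    using assms(9) by (auto simp: isomorphic_def digraph_iso_def)
  define \<phi> where "\<phi> = iso_verts f"
  have tl: "iso_tail f = fst" "iso_head f = snd"
    using arg_cong[OF f(2), of tail] arg_cong[OF f(2), of head] by simp_all
  have inj: "inj_on \<phi> (?V c)" using f(1) by (simp add: pre_digraph.digraph_isomorphism_def \<phi>_def)
  have V': "?V c' = \<phi> ` ?V c" using arg_cong[OF f(2), of verts] by (simp add: \<phi>_def)
  have "iso_arcs f e = map_prod \<phi> \<phi> e" if "e \<in> ?E c" for e
    using f(1) that by (auto simp: pre_digraph.digraph_isomorphism_def tl \<phi>_def prod_eq_iff)
  then have E': "?E c' = map_prod \<phi> \<phi> ` ?E c"
    using arg_cong[OF f(2), of arcs] by simp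
  have N': "?N c' (\<phi> v) = \<phi> ` ?N c v" if "v \<in> ?V c" for v
  proof (intro equalityI subsetI)
    fix u assume "u \<in> ?N c' (\<phi> v)"
    then obtain a b where ab: "(a, b) \<in> ?E c" "\<phi> v = \<phi> a" "u = \<phi> b" unfolding E' by auto
    then have "v = a" using inj_onD[OF inj ab(2) that] by (simp add: parcs_Cat[OF assms(1)])
    then show "u \<in> \<phi> ` ?N c v" using ab by auto
  next
    fix u assume "u \<in> \<phi> ` ?N c v"
    then show "u \<in> ?N c' (\<phi> v)" unfolding E' by force
  qed
  have deg: "card (?N c' (\<phi> v)) = card (?N c v)" if "v \<in> ?V c" for v
  proof -
    have "inj_on \<phi> (?N c v)" by (rule inj_on_subset[OF inj]) (auto simp: parcs_Cat[OF assms(1)])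
    then show ?thesis unfolding N'[OF that] by (rule card_image)
  qed
  have spine: "snd v = 0 \<longleftrightarrow> 2 \<le> card (?N c v)"
    if "composition c" "2 \<le> hd c" "2 \<le> last c" "3 \<le> sum_list c" "v \<in> ?V c" for c v
  proof (cases v)
    case (Pair i j)
    show ?thesis
    proof (cases "j = 0")
      case True
      have i: "i < length c" using that(5) unfolding Pair pverts_Cat by simp
      have "2 \<le> c ! i - 1 + (if 0 < i then 1 else 0) + (if Suc i < length c then 1 else 0)"
      proof (cases "length c = 1")
        case one: True
        then obtain a where "c = [a]" by (auto simp: length_Suc_conv)
        then show ?thesis using that(4) i by simp
      next
        case False
        have "c ! 0 \<ge> 2" "c ! (length c - 1) \<ge> 2"
          using that(1-3) by (auto simp: hd_conv_nth last_conv_nth composition_def)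
        then show ?thesis using i False by (cases "i = 0"; cases "i = length c - 1") auto
      qed
      then show ?thesis using True i unfolding Pair by (simp add: card_neighbours_Cat(1)[OF that(1)])
    next
      case False
      then show ?thesis using card_neighbours_Cat(2)[OF that(1), of j i] that(5) unfolding Pair by simp
    qed
  qed
  have spine_iff: "snd (\<phi> v) = 0 \<longleftrightarrow> snd v = 0" if "v \<in> ?V c" for v
    using spine[OF assms(1-4) that] spine[OF assms(5-8), of "\<phi> v"] deg[OF that] that V' by auto
  define \<pi> where "\<pi> i = fst (\<phi> (i, 0))" for i
  have \<phi>: "\<phi> (i, 0) = (\<pi> i, 0)" if "i < length c" for i
    using spine_iff[of "(i, 0)"] that by (simp add: \<pi>_def spine_in_pverts_Cat[OF assms(1)] prod_eq_iff)
  have bound: "\<pi> i < length c'" if "i < length c" for i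
    using that V' \<phi>[OF that] spine_in_pverts_Cat[OF assms(1)] spine_in_pverts_Cat[OF assms(5)]
    by (metis imageI)
  have inj\<pi>: "inj_on \<pi> {..<length c}"
  proof (rule inj_onI)
    fix i j assume ij: "i \<in> {..<length c}" "j \<in> {..<length c}" "\<pi> i = \<pi> j"
    then have "\<phi> (i, 0) = \<phi> (j, 0)" using \<phi> by simp
    then show "i = j" using inj_onD[OF inj, of "(i, 0)" "(j, 0)"] ij spine_in_pverts_Cat[OF assms(1)] by simp
  qed
  have surj: "{..<length c'} \<subseteq> \<pi> ` {..<length c}"
  proof
    fix k assume "k \<in> {..<length c'}"
    then have "(k, 0) \<in> \<phi> ` ?V c" unfolding V'[symmetric] by (simp add: spine_in_pverts_Cat[OF assms(5)])
    then obtain v where v: "v \<in> ?V c" "\<phi> v = (k, 0)" by auto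
    then have "snd v = 0" using spine_iff[of v] by simp
    then obtain i where "v = (i, 0)" by (cases v) auto
    then show "k \<in> \<pi> ` {..<length c}" using v \<phi>[of i] spine_in_pverts_Cat[OF assms(1)] by auto
  qed
  have len: "length c' = length c"
  proof (rule antisym)
    show "length c' \<le> length c" using surj_card_le[OF _ surj] by simp
    show "length c \<le> length c'" using card_inj_on_le[OF inj\<pi>, of "{..<length c'}"] bound by auto
  qed
  have adj: "\<pi> (Suc i) = Suc (\<pi> i) \<or> \<pi> i = Suc (\<pi> (Suc i))" if "Suc i < length c" for i
  proof -
    have "((i, 0), (Suc i, 0)) \<in> ?E c" using that by (simp add: parcs_Cat[OF assms(1)] spine_in_pverts_Cat[OF assms(1)])
    then have "(\<phi> (i, 0), \<phi> (Suc i, 0)) \<in> ?E c'" unfolding E' by force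
    then show ?thesis using that by (auto simp: \<phi> parcs_Cat[OF assms(5)])
  qed
  \<comment> \<open>Equality of degrees. The indicator terms count the spine neighbours and cancel
    once \<open>\<pi>\<close> is the identity or the reflection.\<close>
  have val: "c ! i - 1 + (if 0 < i then 1 else 0) + (if Suc i < length c then 1 else (0::nat)) =
    c' ! \<pi> i - 1 + (if 0 < \<pi> i then 1 else 0) + (if Suc (\<pi> i) < length c then 1 else 0)"
    if "i < length c" for i
    using deg[of "(i, 0)"] that bound[OF that] \<phi>[OF that]
    by (simp add: card_neighbours_Cat(1)[OF assms(1)] card_neighbours_Cat(1)[OF assms(5)]
        spine_in_pverts_Cat[OF assms(1)] len)
  have pos: "0 < c ! i" "0 < c' ! i" if "i < length c" for i
    using that assms(1,5) len by (auto simp: composition_def)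
  from path_automorphism[OF inj\<pi> _ adj] bound len
  have "(\<forall>i<length c. \<pi> i = i) \<or> (\<forall>i<length c. \<pi> i = length c - 1 - i)" by auto
  then show ?thesis
  proof
    assume id: "\<forall>i<length c. \<pi> i = i"
    have "c ! i = c' ! i" if "i < length c" for i using val[OF that] pos[OF that] id that by auto
    then show ?thesis using len by (metis nth_equalityI)
  next
    assume r: "\<forall>i<length c. \<pi> i = length c - 1 - i"
    have "c ! i = rev c' ! i" if "i < length c" for i
    proof -
      have l: "length c - 1 - i < length c" using that by simp
      have "rev c' ! i = c' ! (length c - 1 - i)" using that len by (simp add: rev_nth)
      moreover have "0 < length c - 1 - i \<longleftrightarrow> Suc i < length c" "Suc (length c - 1 - i) < length c \<longleftrightarrow> 0 < i"
        using that by auto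
      ultimately show ?thesis using val[OF that] pos[OF that] pos[OF l] r that by simp
    qed
    then have "c = rev c'" using len by (intro nth_equalityI) auto
    then show ?thesis by simp
  qed
qed

subsection \<open>Subtrees of caterpillars\<close>

definition induced :: "'a pair_pre_digraph \<Rightarrow> 'a set \<Rightarrow> 'a pair_pre_digraph" where
  "induced G W = \<lparr>pverts = W, parcs = parcs G \<inter> W \<times> W\<rparr>"

lemma induced_simps [simp]: "pverts (induced G W) = W" "parcs (induced G W) = parcs G \<inter> W \<times> W"
  by (simp_all add: induced_def)

definition trunk :: "nat \<Rightarrow> nat \<Rightarrow> (nat \<times> nat) set" where
  "trunk a b = (\<lambda>i. (i, 0)) ` {a..b}"

definition leaves :: "nat list \<Rightarrow> nat \<Rightarrow> nat \<Rightarrow> (nat \<times> nat) set" where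
  "leaves c a b = {(i, j). a \<le> i \<and> i \<le> b \<and> 0 < j \<and> j < c ! i}"

lemma mem_trunk [simp]: "(i, j) \<in> trunk a b \<longleftrightarrow> a \<le> i \<and> i \<le> b \<and> j = 0"
  by (auto simp: trunk_def)

lemma mem_leaves [simp]: "(i, j) \<in> leaves c a b \<longleftrightarrow> a \<le> i \<and> i \<le> b \<and> 0 < j \<and> j < c ! i"
  by (simp add: leaves_def)

lemma leaves_conv_Sigma: "leaves c a b = Sigma {a..b} (\<lambda>i. {0<..<c ! i})"
  by (auto simp: leaves_def)

lemma finite_leaves: "finite (leaves c a b)"
  by (simp add: leaves_conv_Sigma)

lemma card_leaves: "card (leaves c a b) = (\<Sum>i=a..b. c ! i - 1)"
  by (simp add: leaves_conv_Sigma)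

lemma snd_parent [simp]: "snd (parent v) = 0"
  by (simp add: parent_def)

lemma parent_parent_eq: "u = parent v \<Longrightarrow> v = parent u \<Longrightarrow> u = v"
  by (auto simp: parent_def prod_eq_iff split: if_splits)

text \<open>Connectivity is exploited through cuts: if only one arc of the caterpillar leaves
  \<open>U\<close>, that arc must belong to the subtree.\<close>

lemma subtree_cut:
  assumes "S \<in> subtrees T" "x \<in> pverts S" "y \<in> pverts S" "x \<in> U" "y \<notin> U"
  obtains u v where "(u, v) \<in> parcs S" "u \<in> U" "v \<notin> U"
proof -
  have "pair_graph S" and conn: "Digraph_Component.connected (with_proj S)"
    using assms(1) by (auto simp: subtrees_def)
  then interpret S: pair_graph S by simp
  have "symcl (parcs S) = parcs S"
    using S.pair_sym_arcs by (auto simp: symcl_def symmetric_def dest: symD)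
  then have "(x, y) \<in> rtrancl_on (pverts S) (parcs S)"
    using conn assms(2,3) by (auto simp: connected_conv)
  then have "y \<notin> U \<longrightarrow> (\<exists>u v. (u, v) \<in> parcs S \<and> u \<in> U \<and> v \<notin> U)"
    using assms(4) by (induction rule: rtrancl_on_induct) blast+
  then show ?thesis using assms(5) that by blast
qed

lemma subtree_parcs:
  assumes "S \<in> subtrees T" "(u, v) \<in> parcs S"
  shows "(u, v) \<in> parcs T" "u \<in> pverts S" "v \<in> pverts S" "(v, u) \<in> parcs S"
proof -
  have "pair_graph S" and sub: "subgraph (with_proj S) (with_proj T)"
    using assms(1) by (auto simp: subtrees_def)
  then interpret S: pair_graph S by simp
  show "(u, v) \<in> parcs T" using sub assms(2) by (auto simp: subgraph_def)
  show "u \<in> pverts S" "v \<in> pverts S" using S.wellformed'[OF assms(2)] by auto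
  show "(v, u) \<in> parcs S" using S.pair_sym_arcs assms(2) by (auto simp: symmetric_def dest: symD)
qed

lemma subtree_pverts: "S \<in> subtrees T \<Longrightarrow> pverts S \<subseteq> pverts T \<and> pverts S \<noteq> {}"
  by (auto simp: subtrees_def subgraph_def connected_conv)

text \<open>Every arc \<open>(v, parent v)\<close> is a bridge: it is the only one leaving the set of descendants of \<open>v\<close>.\<close>

lemma parent_arc_in_subtree:
  assumes "composition c" "S \<in> subtrees (Cat c)" "v \<in> pverts S" "y \<in> pverts S"
    "if snd v = 0 then fst y < fst v else y \<noteq> v"
  shows "(v, parent v) \<in> parcs S"
proof -
  define U where "U = (if snd v = 0 then {x. fst v \<le> fst x} else {v})"
  have "v \<in> U" "y \<notin> U" using assms(5) by (auto simp: U_def split: if_splits)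
  then obtain p q where pq: "(p, q) \<in> parcs S" "p \<in> U" "q \<notin> U"
    using subtree_cut[OF assms(2,3,4)] by metis
  have "(p, q) \<in> parcs (Cat c)" by (rule subtree_parcs(1)[OF assms(2) pq(1)])
  then have adj: "p \<noteq> q" "p = parent q \<or> q = parent p" by (auto simp: parcs_Cat[OF assms(1)])
  have "p = v \<and> q = parent v"
  proof (cases "snd v = 0")
    case True
    then have f: "fst v \<le> fst p" "fst q < fst v" using pq by (auto simp: U_def)
    then have "p \<noteq> parent q" by (auto simp: parent_def split: if_splits)
    then have "q = parent p" using adj by simp
    then show ?thesis using f True by (auto simp: parent_def prod_eq_iff split: if_splits)
  next
    case False
    then have "p = v" using pq by (auto simp: U_def)
    then show ?thesis using adj False by auto
  qed
  then show ?thesis using pq(1) by simp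
qed

text \<open>If both ends of an edge belong to \<open>S\<close>, the parent end lies outside the
  descendants of the other end, so connectivity forces this bridge into \<open>S\<close>. Sums over
  subtrees thereby become sums over vertex sets.\<close>

lemma subtree_is_induced:
  assumes "composition c" "S \<in> subtrees (Cat c)"
  shows "S = induced (Cat c) (pverts S)"
proof -
  have "parcs S = parcs (Cat c) \<inter> pverts S \<times> pverts S"
  proof (intro equalityI subsetI)
    fix e assume "e \<in> parcs S"
    then show "e \<in> parcs (Cat c) \<inter> pverts S \<times> pverts S" using subtree_parcs[OF assms(2)] by (cases e) auto
  next
    fix e assume "e \<in> parcs (Cat c) \<inter> pverts S \<times> pverts S"
    then obtain u v where e: "e = (u, v)" "u \<in> pverts S" "v \<in> pverts S" "u \<noteq> v" "u = parent v \<or> v = parent u"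
      by (cases e) (auto simp: parcs_Cat[OF assms(1)])
    have arc: "(x, parent x) \<in> parcs S" if "x \<in> pverts S" "parent x \<in> pverts S" "x \<noteq> parent x" for x
      using that by (intro parent_arc_in_subtree[OF assms, of x "parent x"])
        (auto simp: parent_def prod_eq_iff split: if_splits)
    have "(u, v) \<in> parcs S"
    proof (cases "v = parent u")
      case True
      then show ?thesis using arc[of u] e by simp
    next
      case False
      then have "(v, u) \<in> parcs S" using arc[of v] e by auto
      then show ?thesis by (rule subtree_parcs(4)[OF assms(2)])
    qed
    then show "e \<in> parcs S" by (simp add: e(1))
  qed
  then show ?thesis by (simp add: induced_def)
qed

text \<open>A leaf in a subtree brings along its spine vertex unless it is alone, and the spine
  vertices of a subtree leave no gap, since the edges of the spine are bridges.\<close>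

lemma subtree_pverts_cases:
  assumes "composition c" "S \<in> subtrees (Cat c)"
  obtains v where "v \<in> pverts (Cat c)" "snd v \<noteq> 0" "pverts S = {v}"
  | a b L where "a \<le> b" "b < length c" "L \<subseteq> leaves c a b" "pverts S = trunk a b \<union> L"
proof -
  define W where "W = pverts S"
  have W: "W \<subseteq> pverts (Cat c)" "W \<noteq> {}" using subtree_pverts[OF assms(2)] by (auto simp: W_def)
  have par: "parent v \<in> W" if "v \<in> W" "y \<in> W" "if snd v = 0 then fst y < fst v else y \<noteq> v" for v y
    using subtree_parcs(3)[OF assms(2) parent_arc_in_subtree[OF assms, of v y]] that by (auto simp: W_def)
  show ?thesis
  proof (cases "\<exists>i. (i, 0) \<in> W")
    case False
    then have nosp: "snd v \<noteq> 0" if "v \<in> W" for v using that by (metis prod.collapse)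
    obtain v where v: "v \<in> W" using W(2) by auto
    have "y = v" if "y \<in> W" for y using par[OF v that] nosp[OF v] nosp[of "parent v"] by auto
    then have "W = {v}" using v by blast
    then show ?thesis using that(1)[of v] v W(1) nosp[OF v] by (auto simp: W_def)
  next
    case True
    define I where "I = {i. (i, 0) \<in> W}"
    have "I \<subseteq> {..<length c}" using W(1) by (auto simp: I_def pverts_Cat)
    then have I: "finite I" "I \<noteq> {}" using True by (auto intro: finite_subset simp: I_def)
    define a b where "a = Min I" and "b = Max I"
    have ab: "a \<in> I" "b \<in> I" "a \<le> b" "b < length c" "\<And>i. i \<in> I \<Longrightarrow> a \<le> i \<and> i \<le> b"
      using I \<open>I \<subseteq> _\<close> by (auto simp: a_def b_def)
    \<comment> \<open>The trunk is filled from its right end; \<open>(a, 0)\<close> serves as the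
      vertex on the far side of each bridge.\<close>
    have down: "a \<le> b - n \<Longrightarrow> n \<le> b \<Longrightarrow> (b - n, 0) \<in> W" for n
    proof (induction n)
      case 0
      then show ?case using ab by (simp add: I_def)
    next
      case (Suc n)
      then have "(b - n, 0) \<in> W" "a < b - n" by auto
      then show ?case using par[of "(b - n, 0)" "(a, 0)"] ab(1) by (simp add: I_def)
    qed
    have trunkW: "(i, 0) \<in> W" if "a \<le> i" "i \<le> b" for i using down[of "b - i"] that by simp
    define L where "L = {v \<in> W. snd v \<noteq> 0}"
    have "L \<subseteq> leaves c a b"
    proof
      fix v assume v: "v \<in> L"
      obtain i j where ij: "v = (i, j)" by (cases v)
      have j: "0 < j" "v \<in> W" using v by (auto simp: L_def ij)
      have "(i, 0) \<in> W" using par[of v "(a, 0)"] ab(1) j by (auto simp: ij I_def)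
      then show "v \<in> leaves c a b" using ab(5)[of i] j W(1) by (auto simp: ij I_def pverts_Cat)
    qed
    moreover have "W = trunk a b \<union> L"
    proof (intro equalityI subsetI)
      fix v assume "v \<in> W"
      then show "v \<in> trunk a b \<union> L" using ab(5)[of "fst v"] by (cases v) (auto simp: L_def I_def)
    qed (auto simp: L_def trunk_def trunkW)
    ultimately show ?thesis using that(2)[OF ab(3,4)] by (simp add: W_def)
  qed
qed

text \<open>Paths to a single vertex \<open>r\<close> give connectedness because the arcs are
  symmetric.\<close>

lemma induced_in_subtrees:
  assumes "composition c" "W \<subseteq> pverts (Cat c)" "r \<in> W"
    and "\<And>v. v \<in> W \<Longrightarrow> (v, r) \<in> rtrancl_on W (parcs (Cat c) \<inter> W \<times> W)"
  shows "induced (Cat c) W \<in> subtrees (Cat c)"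
proof -
  let ?S = "induced (Cat c) W" and ?R = "parcs (Cat c) \<inter> W \<times> W"
  have wf: "wf_digraph (with_proj (Cat c))"
    by unfold_locales (auto simp: parcs_Cat[OF assms(1)])
  have sym: "sym ?R" by (auto simp: sym_def parcs_Cat[OF assms(1)])
  have finW: "finite W" by (rule finite_subset[OF assms(2) finite_pverts_Cat])
  have pg: "pair_graph ?S"
  proof
    show "finite (parcs ?S)" using finW by simp
    show "symmetric (with_proj ?S)" using sym by (simp add: symmetric_def)
  qed (use finW in \<open>auto simp: parcs_Cat[OF assms(1)]\<close>)
  then interpret S: pair_graph ?S .
  have "wf_digraph (with_proj ?S)" by (rule S.wf_digraph_axioms)
  then have "subgraph (with_proj ?S) (with_proj (Cat c))"
    using wf assms(2) by (auto simp: subgraph_def compatible_def)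
  moreover have "Digraph_Component.connected (with_proj ?S)"
  proof -
    have "symcl ?R = ?R" using sym by (auto simp: symcl_def dest: symD)
    moreover have "(u, v) \<in> rtrancl_on W ?R" if "u \<in> W" "v \<in> W" for u v
      using assms(4)[OF that(1)] symD[OF rtrancl_on_sym[OF sym] assms(4)[OF that(2)]]
      by (rule rtrancl_on_trans)
    ultimately show ?thesis using assms(3) by (auto simp: connected_conv)
  qed
  ultimately show ?thesis using pg by (simp add: subtrees_def)
qed

lemma trunk_in_subtrees:
  assumes "composition c" "a \<le> b" "b < length c" "L \<subseteq> leaves c a b"
  shows "induced (Cat c) (trunk a b \<union> L) \<in> subtrees (Cat c)"
proof (rule induced_in_subtrees[OF assms(1), where r = "(a, 0)"])
  let ?W = "trunk a b \<union> L"
  let ?R = "parcs (Cat c) \<inter> ?W \<times> ?W"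
  have "leaves c a b \<subseteq> pverts (Cat c)" "trunk a b \<subseteq> pverts (Cat c)"
    using assms(1,3) by (auto simp: pverts_Cat composition_def)
  then show V: "?W \<subseteq> pverts (Cat c)" using assms(4) by blast
  show "(a, 0) \<in> ?W" using assms(2) by simp
  have arc: "(v, parent v) \<in> ?R" if "v \<in> ?W" "parent v \<in> ?W" "v \<noteq> parent v" for v
    using that V by (auto simp: parcs_Cat[OF assms(1)])
  have sp: "a + n \<le> b \<Longrightarrow> ((a + n, 0), (a, 0)) \<in> rtrancl_on ?W ?R" for n
  proof (induction n)
    case 0
    then show ?case by auto
  next
    case (Suc n)
    have "((a + Suc n, 0), (a + n, 0)) \<in> ?R" using arc[of "(a + Suc n, 0)"] Suc.prems by simp
    then show ?case by (rule converse_rtrancl_on_into_rtrancl_on) (use Suc in auto)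
  qed
  fix v assume v: "v \<in> ?W"
  obtain i j where ij: "v = (i, j)" by (cases v)
  have i: "a \<le> i" "i \<le> b" using v assms(4) by (auto simp: ij)
  have sp_i: "((i, 0), (a, 0)) \<in> rtrancl_on ?W ?R" using sp[of "i - a"] i by simp
  show "(v, (a, 0)) \<in> rtrancl_on ?W ?R"
  proof (cases "j = 0")
    case True
    then show ?thesis using sp_i ij by simp
  next
    case False
    then have "(v, (i, 0)) \<in> ?R" using arc[of v] v i unfolding ij by simp
    then show ?thesis using sp_i v by (rule converse_rtrancl_on_into_rtrancl_on)
  qed
qed

lemma subtrees_Cat:
  assumes "composition c"
  shows "subtrees (Cat c) = induced (Cat c) ` ((\<lambda>v. {v}) ` {v \<in> pverts (Cat c). snd v \<noteq> 0} \<union>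
    (\<lambda>((a, b), L). trunk a b \<union> L) ` Sigma {(a, b). a \<le> b \<and> b < length c} (\<lambda>(a, b). Pow (leaves c a b)))"
    (is "_ = _ ` (?A \<union> ?B)")
proof (intro equalityI subsetI)
  fix S assume S: "S \<in> subtrees (Cat c)"
  have "pverts S \<in> ?A \<union> ?B" 
  proof (rule subtree_pverts_cases[OF assms S])
    fix a b L assume "a \<le> b" "b < length c" "L \<subseteq> leaves c a b" and W: "pverts S = trunk a b \<union> L"
    then have "((a, b), L) \<in> Sigma {(a, b). a \<le> b \<and> b < length c} (\<lambda>(a, b). Pow (leaves c a b))" by simp
    then have "(\<lambda>((a, b), L). trunk a b \<union> L) ((a, b), L) \<in> ?B" by (rule imageI)
    then show ?thesis by (simp add: W)
  qed auto
  then show "S \<in> induced (Cat c) ` (?A \<union> ?B)" 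
    by (rule image_eqI[where f = "induced (Cat c)" and x = "pverts S", OF subtree_is_induced[OF assms S]])
next
  fix S assume "S \<in> induced (Cat c) ` (?A \<union> ?B)"
  then consider v where "v \<in> pverts (Cat c)" "S = induced (Cat c) {v}"
    | a b L where "a \<le> b" "b < length c" "L \<subseteq> leaves c a b" "S = induced (Cat c) (trunk a b \<union> L)"
    by auto
  then show "S \<in> subtrees (Cat c)"
  proof cases
    case 1
    then show ?thesis using induced_in_subtrees[OF assms, of "{v}" v] by auto
  next
    case 2
    then show ?thesis using trunk_in_subtrees[OF assms] by simp
  qed
qed

lemma finite_intervals: "finite {(a, b). a \<le> b \<and> b < (k::nat)}"
  by (rule finite_subset[of _ "{..<k} \<times> {..<k}"]) auto

lemma sum_subtrees_Cat:
  fixes F :: "(nat \<times> nat) pair_pre_digraph \<Rightarrow> 'a::comm_monoid_add"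
  assumes "composition c"
  shows "(\<Sum>S\<in>subtrees (Cat c). F S) =
    (\<Sum>v\<in>{v \<in> pverts (Cat c). snd v \<noteq> 0}. F (induced (Cat c) {v})) +
    (\<Sum>(a, b)\<in>{(a, b). a \<le> b \<and> b < length c}. \<Sum>L\<in>Pow (leaves c a b). F (induced (Cat c) (trunk a b \<union> L)))"
proof -
  let ?P = "{(a, b). a \<le> b \<and> b < length c}"
  let ?A = "(\<lambda>v. {v}) ` {v \<in> pverts (Cat c). snd v \<noteq> 0}"
  let ?D = "Sigma ?P (\<lambda>(a, b). Pow (leaves c a b))"
  let ?g = "\<lambda>((a, b), L). trunk a b \<union> L"
  have inj: "inj_on (induced (Cat c)) X" for X
    by (rule inj_onI) (metis induced_simps(1))
  \<comment> \<open>The vertex set determines its parameters: the spine vertices give the interval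
    and the others give \<open>L\<close>.\<close>
  have g1: "(i, 0) \<in> trunk a b \<union> L \<longleftrightarrow> a \<le> i \<and> i \<le> b"
    and g2: "{v \<in> trunk a b \<union> L. snd v \<noteq> 0} = L" if "((a, b), L) \<in> ?D" for a b L i
    using that by (auto simp: leaves_def)
  have injg: "inj_on ?g ?D"
  proof (rule inj_onI)
    fix x y assume x: "x \<in> ?D" and y: "y \<in> ?D" and eq: "?g x = ?g y"
    obtain a b L a' b' L' where xy: "x = ((a, b), L)" "y = ((a', b'), L')" by (metis prod.collapse)
    have eq': "trunk a b \<union> L = trunk a' b' \<union> L'" using eq by (simp add: xy)
    have "L = L'" using g2[OF x[unfolded xy]] g2[OF y[unfolded xy]] unfolding eq' by (rule trans[OF sym])
    moreover have "a \<le> i \<and> i \<le> b \<longleftrightarrow> a' \<le> i \<and> i \<le> b'" for i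
      using g1[OF x[unfolded xy]] g1[OF y[unfolded xy]] unfolding eq' by (rule trans[OF sym])
    note this[of a] this[of a'] this[of b] this[of b']
    moreover have "a \<le> b" "a' \<le> b'" using x y by (auto simp: xy)
    ultimately show "x = y" by (simp add: xy)
  qed
  have disj: "?A \<inter> ?g ` ?D = {}"
  proof -
    have "W \<notin> ?A" if "W \<in> ?g ` ?D" for W
    proof -
      obtain a b L where "((a, b), L) \<in> ?D" "W = trunk a b \<union> L" using \<open>W \<in> ?g ` ?D\<close> by auto
      then have "(a, 0) \<in> W" using g1[of a b L a] by auto
      then show ?thesis by auto
    qed
    then show ?thesis by (meson disjoint_iff)
  qed
  have fin: "finite ?A" "finite ?P" "\<forall>p\<in>?P. finite ((\<lambda>(a, b). Pow (leaves c a b)) p)"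
    using finite_pverts_Cat[of c] finite_intervals finite_leaves by auto
  then have finD: "finite (?g ` ?D)" by (intro finite_imageI finite_SigmaI) auto
  have "(\<Sum>S\<in>subtrees (Cat c). F S) = (\<Sum>W\<in>?A \<union> ?g ` ?D. F (induced (Cat c) W))"
    unfolding subtrees_Cat[OF assms] by (simp add: sum.reindex[OF inj])
  also have "\<dots> = (\<Sum>W\<in>?A. F (induced (Cat c) W)) + (\<Sum>W\<in>?g ` ?D. F (induced (Cat c) W))"
    by (rule sum.union_disjoint[OF fin(1) finD disj])
  also have "(\<Sum>W\<in>?A. F (induced (Cat c) W)) = (\<Sum>v\<in>{v \<in> pverts (Cat c). snd v \<noteq> 0}. F (induced (Cat c) {v}))"
    by (subst sum.reindex) auto
  also have "(\<Sum>W\<in>?g ` ?D. F (induced (Cat c) W)) = (\<Sum>x\<in>?D. F (induced (Cat c) (?g x)))"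
    by (simp add: sum.reindex[OF injg])
  also have "\<dots> = (\<Sum>(p, L)\<in>?D. F (induced (Cat c) (?g (p, L))))"
    by (intro sum.cong) auto
  also have "\<dots> = (\<Sum>p\<in>?P. \<Sum>L\<in>(\<lambda>(a, b). Pow (leaves c a b)) p. F (induced (Cat c) (?g (p, L))))"
    by (rule sum.Sigma[OF fin(2,3), symmetric])
  also have "\<dots> = (\<Sum>(a, b)\<in>?P. \<Sum>L\<in>Pow (leaves c a b). F (induced (Cat c) (trunk a b \<union> L)))"
    by (intro sum.cong) auto
  finally show ?thesis .
qed

section \<open>Edges counted by their end farther from the root\<close>

lemma inj_on_parent_edge: "inj_on (\<lambda>v. {v, parent v}) {v. v \<noteq> parent v}"
  by (rule inj_onI) (metis doubleton_eq_iff mem_Collect_eq parent_parent_eq)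

lemma edgesI: "(u, v) \<in> parcs G \<Longrightarrow> {u, v} \<in> edges G"
  by (auto simp only: edges_def)

lemma edgesE:
  assumes "e \<in> edges G"
  obtains u v where "e = {u, v}" "(u, v) \<in> parcs G"
  using assms by (auto simp only: edges_def)

lemma edges_Cat:
  assumes "composition c"
  shows "edges (Cat c) = (\<lambda>v. {v, parent v}) ` {v \<in> pverts (Cat c). v \<noteq> parent v}"
proof (intro equalityI subsetI)
  fix e assume "e \<in> edges (Cat c)"
  then obtain u v where uv: "e = {u, v}" "(u, v) \<in> parcs (Cat c)" by (rule edgesE)
  then consider "v = parent u" "u \<noteq> parent u" "u \<in> pverts (Cat c)"
    | "u = parent v" "v \<noteq> parent v" "v \<in> pverts (Cat c)"
    by (auto simp: parcs_Cat[OF assms])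
  then show "e \<in> (\<lambda>v. {v, parent v}) ` {v \<in> pverts (Cat c). v \<noteq> parent v}"
    using uv(1) by cases (auto simp: insert_commute)
next
  fix e assume "e \<in> (\<lambda>v. {v, parent v}) ` {v \<in> pverts (Cat c). v \<noteq> parent v}"
  then obtain v where v: "e = {v, parent v}" "v \<in> pverts (Cat c)" "v \<noteq> parent v" by blast
  then have "(v, parent v) \<in> parcs (Cat c)"
    using parent_in_pverts_Cat[OF _ assms] by (simp add: parcs_Cat[OF assms])
  then show "e \<in> edges (Cat c)" unfolding v(1) by (rule edgesI)
qed

lemma edges_induced_Cat:
  assumes "composition c" "W \<subseteq> pverts (Cat c)"
  shows "edges (induced (Cat c) W) = (\<lambda>v. {v, parent v}) ` {v \<in> W. parent v \<in> W \<and> v \<noteq> parent v}"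
proof -
  have "edges (induced (Cat c) W) = {e \<in> edges (Cat c). e \<subseteq> W}"
    by (rule set_eqI) (auto elim!: edgesE intro!: edgesI simp del: split_paired_Ex)
  then show ?thesis using assms(2) unfolding edges_Cat[OF assms(1)] by auto
qed

lemma card_parent_edges:
  "card {e \<in> (\<lambda>v. {v, parent v}) ` {v \<in> V. v \<noteq> parent v}. Q e} = card {v \<in> V. v \<noteq> parent v \<and> Q {v, parent v}}"
proof -
  have "{e \<in> (\<lambda>v. {v, parent v}) ` {v \<in> V. v \<noteq> parent v}. Q e} =
    (\<lambda>v. {v, parent v}) ` {v \<in> V. v \<noteq> parent v \<and> Q {v, parent v}}" by auto
  moreover have "inj_on (\<lambda>v. {v, parent v}) {v \<in> V. v \<noteq> parent v \<and> Q {v, parent v}}"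
    by (rule inj_on_subset[OF inj_on_parent_edge]) auto
  ultimately show ?thesis by (simp add: card_image)
qed

lemma num_edges_in_Cat:
  assumes "composition c" "W \<subseteq> pverts (Cat c)"
  shows "num_edges_in (Cat c) (induced (Cat c) W) = card {v \<in> W. parent v \<in> W \<and> v \<noteq> parent v}"
proof -
  have "{v \<in> pverts (Cat c). v \<noteq> parent v \<and> {v, parent v} \<subseteq> W} = {v \<in> W. parent v \<in> W \<and> v \<noteq> parent v}"
    using assms(2) by auto
  then show ?thesis
    by (simp only: num_edges_in_def induced_simps edges_Cat[OF assms(1)] card_parent_edges)
qed

text \<open>The root, being its own parent, never satisfies the condition on the right.\<close>

lemma num_edges_boundary_Cat:
  assumes "composition c"
  shows "num_edges_boundary (Cat c) (induced (Cat c) W) = card {v \<in> pverts (Cat c). v \<in> W \<longleftrightarrow> parent v \<notin> W}"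
proof -
  have "card ({v, parent v} \<inter> W) = 1 \<longleftrightarrow> (v \<in> W \<longleftrightarrow> parent v \<notin> W)" if "v \<noteq> parent v" for v
    using that by (cases "v \<in> W"; cases "parent v \<in> W") auto
  then have "{v \<in> pverts (Cat c). v \<noteq> parent v \<and> card ({v, parent v} \<inter> W) = 1} =
    {v \<in> pverts (Cat c). v \<in> W \<longleftrightarrow> parent v \<notin> W}" by (intro Collect_cong) metis
  then show ?thesis
    by (simp only: num_edges_boundary_def induced_simps edges_Cat[OF assms(1)] card_parent_edges)
qed

lemma leaf_induced_Cat:
  assumes "composition c"
  shows "leaf (induced (Cat c) W) v \<longleftrightarrow> v \<in> W \<and> card {u \<in> W. (v, u) \<in> parcs (Cat c)} = 1"
proof -
  have "{e \<in> edges (induced (Cat c) W). v \<in> e} = (\<lambda>u. {v, u}) ` {u \<in> W. (v, u) \<in> parcs (Cat c)}" if v: "v \<in> W"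
  proof (intro equalityI subsetI)
    fix e assume "e \<in> {e \<in> edges (induced (Cat c) W). v \<in> e}"
    then have e: "e \<in> edges (induced (Cat c) W)" "v \<in> e" by auto
    then obtain x y where xy: "e = {x, y}" "(x, y) \<in> parcs (induced (Cat c) W)" by (elim edgesE)
    then have "(y, x) \<in> parcs (induced (Cat c) W)" by (auto simp: parcs_Cat[OF assms])
    then show "e \<in> (\<lambda>u. {v, u}) ` {u \<in> W. (v, u) \<in> parcs (Cat c)}" using xy e(2) by auto
  next
    fix e assume "e \<in> (\<lambda>u. {v, u}) ` {u \<in> W. (v, u) \<in> parcs (Cat c)}"
    then obtain u where "e = {v, u}" "(v, u) \<in> parcs (induced (Cat c) W)" using v by auto
    then show "e \<in> {e \<in> edges (induced (Cat c) W). v \<in> e}" by (simp add: edgesI)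
  qed
  moreover have "inj_on (\<lambda>u. {v, u}) A" for A by (auto simp: inj_on_def doubleton_eq_iff)
  ultimately show ?thesis by (auto simp: leaf_def card_image)
qed

lemma num_leaf_edges_Cat:
  assumes "composition c" "W \<subseteq> pverts (Cat c)"
  shows "num_leaf_edges (induced (Cat c) W) = card {v \<in> W. parent v \<in> W \<and> v \<noteq> parent v \<and>
    (leaf (induced (Cat c) W) v \<or> leaf (induced (Cat c) W) (parent v))}"
proof -
  have "edges (induced (Cat c) W) = (\<lambda>v. {v, parent v}) ` {v \<in> {v \<in> W. parent v \<in> W}. v \<noteq> parent v}"
    unfolding edges_induced_Cat[OF assms] by (rule arg_cong[where f = "image _"]) auto
  then have "num_leaf_edges (induced (Cat c) W) =
    card {v \<in> {v \<in> W. parent v \<in> W}. v \<noteq> parent v \<and> (\<exists>u\<in>{v, parent v}. leaf (induced (Cat c) W) u)}"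
    unfolding num_leaf_edges_def by (simp only: card_parent_edges)
  also have "{v \<in> {v \<in> W. parent v \<in> W}. v \<noteq> parent v \<and> (\<exists>u\<in>{v, parent v}. leaf (induced (Cat c) W) u)} =
    {v \<in> W. parent v \<in> W \<and> v \<noteq> parent v \<and> (leaf (induced (Cat c) W) v \<or> leaf (induced (Cat c) W) (parent v))}"
    by auto
  finally show ?thesis .
qed

lemma single_leaf_statistics:
  assumes "composition c" "v \<in> pverts (Cat c)" "snd v \<noteq> 0"
  shows "num_edges_in (Cat c) (induced (Cat c) {v}) = 0"
    "num_edges_boundary (Cat c) (induced (Cat c) {v}) = 1"
    "num_leaf_edges (induced (Cat c) {v}) = 0"
proof -
  have "{u \<in> pverts (Cat c). u \<in> {v} \<longleftrightarrow> parent u \<notin> {v}} = {v}"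
    using assms by (auto simp: prod_eq_iff)
  moreover have "{u \<in> {v}. parent u \<in> {v} \<and> u \<noteq> parent u \<and> P u} = {}" for P by auto
  ultimately show "num_edges_in (Cat c) (induced (Cat c) {v}) = 0"
    "num_edges_boundary (Cat c) (induced (Cat c) {v}) = 1"
    "num_leaf_edges (induced (Cat c) {v}) = 0"
    using assms by (auto simp: num_edges_in_Cat num_edges_boundary_Cat num_leaf_edges_Cat)
qed

section \<open>Statistics of the subtree with trunk \<open>a..b\<close> and leaf set
  \<open>L\<close>\<close>

context
  fixes c :: "nat list" and a b :: nat and L W
  assumes c: "composition c" and ab: "a \<le> b" "b < length c" and L: "L \<subseteq> leaves c a b"
  defines "W \<equiv> trunk a b \<union> L"
begin

lemma trunk_union_subset: "W \<subseteq> pverts (Cat c)"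
proof -
  have "leaves c a b \<subseteq> pverts (Cat c)" "trunk a b \<subseteq> pverts (Cat c)"
    using c ab by (auto simp: pverts_Cat composition_def)
  then show ?thesis using L by (auto simp: W_def)
qed

lemma trunk_union_edge_iff: "v \<in> W \<and> parent v \<in> W \<and> v \<noteq> parent v \<longleftrightarrow> v \<in> (\<lambda>i. (i, 0)) ` {a<..b} \<union> L"
proof (cases v)
  case (Pair i j)
  have "(i, j) \<in> L \<Longrightarrow> a \<le> i \<and> i \<le> b \<and> 0 < j" for i j using L by auto
  then show ?thesis unfolding Pair W_def by (cases "j = 0") (auto simp: image_iff)
qed

lemma num_edges_in_trunk_union: "num_edges_in (Cat c) (induced (Cat c) W) = b - a + card L"
proof -
  have "{v \<in> W. parent v \<in> W \<and> v \<noteq> parent v} = (\<lambda>i. (i, 0)) ` {a<..b} \<union> L"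
    using trunk_union_edge_iff by blast
  moreover have "card ((\<lambda>i. (i, 0)) ` {a<..b} \<union> L) = card ((\<lambda>i. (i, 0::nat)) ` {a<..b}) + card L"
    using L finite_subset[OF L finite_leaves] by (intro card_Un_disjoint) auto
  moreover have "card ((\<lambda>i. (i, 0::nat)) ` {a<..b}) = b - a" by (simp add: card_image inj_on_def)
  ultimately show ?thesis by (simp only: num_edges_in_Cat[OF c trunk_union_subset])
qed

lemma num_edges_boundary_trunk_union:
  "num_edges_boundary (Cat c) (induced (Cat c) W) =
    (if 0 < a then 1 else 0) + (if Suc b < length c then 1 else 0) + (card (leaves c a b) - card L)"
proof -
  let ?A = "if 0 < a then {(a, 0)} else {} :: (nat \<times> nat) set"
  let ?B = "if Suc b < length c then {(Suc b, 0)} else {} :: (nat \<times> nat) set"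
  have "v \<in> pverts (Cat c) \<and> (v \<in> W \<longleftrightarrow> parent v \<notin> W) \<longleftrightarrow> v \<in> (?A \<union> ?B) \<union> (leaves c a b - L)" for v
  proof (cases v)
    case (Pair i j)
    have Lij: "(i, j) \<in> L \<Longrightarrow> a \<le> i \<and> i \<le> b \<and> 0 < j" for i j using L by auto
    show ?thesis
    proof (cases "j = 0")
      case True
      then show ?thesis using ab Lij[of i 0] Lij[of "i - 1" 0]
        by (cases i) (auto simp: Pair W_def spine_in_pverts_Cat[OF c])
    next
      case False
      then show ?thesis using ab Lij[of i j] Lij[of i 0] by (auto simp: Pair W_def pverts_Cat)
    qed
  qed
  then have "{v \<in> pverts (Cat c). v \<in> W \<longleftrightarrow> parent v \<notin> W} = (?A \<union> ?B) \<union> (leaves c a b - L)" by blast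
  moreover have "card ((?A \<union> ?B) \<union> (leaves c a b - L)) = card (?A \<union> ?B) + card (leaves c a b - L)"
    using finite_leaves by (intro card_Un_disjoint) auto
  moreover have "card (?A \<union> ?B) = (if 0 < a then 1 else 0) + (if Suc b < length c then 1 else 0)"
    using ab by auto
  moreover have "card (leaves c a b - L) = card (leaves c a b) - card L"
    using L finite_leaves by (meson card_Diff_subset finite_subset)
  ultimately show ?thesis by (simp only: num_edges_boundary_Cat[OF c])
qed

text \<open>The degree of a spine vertex is the number of its chosen leaves plus that of its
  neighbours on the trunk. The last two claims concern trunks with \<open>a < b\<close>; for a
  one-vertex trunk every edge ends in a chosen leaf and is counted there.\<close>

lemma leaf_trunk_union:
  "(i, j) \<in> L \<Longrightarrow> leaf (induced (Cat c) W) (i, j)"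
  "a < i \<Longrightarrow> i \<le> b \<Longrightarrow> leaf (induced (Cat c) W) (i, 0) \<longleftrightarrow> i = b \<and> (\<forall>j. (b, j) \<notin> L)"
  "a \<le> i \<Longrightarrow> i < b \<Longrightarrow> leaf (induced (Cat c) W) (i, 0) \<longleftrightarrow> i = a \<and> (\<forall>j. (a, j) \<notin> L)"
proof -
  have Lij: "(i, j) \<in> L \<Longrightarrow> a \<le> i \<and> i \<le> b \<and> 0 < j" for i j using L by auto
  have V: "v \<in> W \<Longrightarrow> v \<in> pverts (Cat c)" for v using trunk_union_subset by auto
  have finL: "finite L" by (rule finite_subset[OF L finite_leaves])
  show "leaf (induced (Cat c) W) (i, j)" if ij: "(i, j) \<in> L" for i j
  proof -
    have "(i, j) \<in> pverts (Cat c)" using V ij by (simp add: W_def)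
    then have nb: "{u. ((i, j), u) \<in> parcs (Cat c)} = {(i, 0)}"
      using card_neighbours_Cat(2)[OF c] Lij[OF ij] by simp
    have "(i, 0) \<in> W" using Lij[OF ij] by (simp add: W_def)
    then have "{u \<in> W. ((i, j), u) \<in> parcs (Cat c)} = {(i, 0)}" using nb by blast
    then show ?thesis using ij by (simp add: leaf_induced_Cat[OF c] W_def)
  qed
  have spine: "leaf (induced (Cat c) W) (i, 0) \<longleftrightarrow>
      card {j. (i, j) \<in> L} + ((if a < i then 1 else 0) + (if i < b then 1 else 0)) = 1"
    if i: "a \<le> i" "i \<le> b" for i
  proof -
    let ?A = "if a < i then {(i - 1, 0)} else {} :: (nat \<times> nat) set"
    let ?B = "if i < b then {(Suc i, 0)} else {} :: (nat \<times> nat) set"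
    have "u \<in> W \<and> ((i, 0), u) \<in> parcs (Cat c) \<longleftrightarrow> u \<in> Pair i ` {j. (i, j) \<in> L} \<union> (?A \<union> ?B)" for u
    proof (cases u)
      case (Pair p q)
      have W0: "(i, 0) \<in> W" using i by (simp add: W_def)
      show ?thesis
      proof (cases "q = 0")
        case True
        have "(p, 0) \<in> W \<longleftrightarrow> a \<le> p \<and> p \<le> b" "(i, 0) \<notin> L" using Lij[of p 0] Lij[of i 0] by (auto simp: W_def)
        then show ?thesis using i True V[OF W0] V[of "(p, 0)"]
          by (cases p; cases i) (auto simp: Pair parcs_Cat[OF c])
      next
        case False
        then show ?thesis using i V[OF W0] V[of "(p, q)"]
          by (auto simp: Pair parcs_Cat[OF c] W_def)
      qed
    qed
    then have "{u \<in> W. ((i, 0), u) \<in> parcs (Cat c)} = Pair i ` {j. (i, j) \<in> L} \<union> (?A \<union> ?B)" by blast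
    moreover have fin: "finite {j. (i, j) \<in> L}"
      by (rule finite_subset[of _ "snd ` L"]) (use finL in \<open>force+\<close>)
    moreover have "card (Pair i ` {j. (i, j) \<in> L} \<union> (?A \<union> ?B)) = card (Pair i ` {j. (i, j) \<in> L}) + card (?A \<union> ?B)"
      using fin Lij by (intro card_Un_disjoint) auto
    moreover have "card (Pair i ` {j. (i, j) \<in> L}) = card {j. (i, j) \<in> L}" by (simp add: card_image inj_on_def)
    moreover have "card (?A \<union> ?B) = (if a < i then 1 else 0) + (if i < b then 1 else 0)" by auto
    ultimately show ?thesis using i by (simp add: leaf_induced_Cat[OF c] W_def)
  qed
  have fin: "finite {j. (i, j) \<in> L}" for i
    by (rule finite_subset[of _ "snd ` L"]) (use finL in \<open>force+\<close>)
  show "leaf (induced (Cat c) W) (i, 0) \<longleftrightarrow> i = b \<and> (\<forall>j. (b, j) \<notin> L)" if "a < i" "i \<le> b" for i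
    using spine[of i] that fin[of i] by (auto simp: card_eq_0_iff)
  show "leaf (induced (Cat c) W) (i, 0) \<longleftrightarrow> i = a \<and> (\<forall>j. (a, j) \<notin> L)" if "a \<le> i" "i < b" for i
    using spine[of i] that fin[of i] by (auto simp: card_eq_0_iff)
qed

text \<open>Besides the edges to chosen leaves, only the first and the last trunk edge can be leaf
  edges, namely if their end of the trunk carries no chosen leaf. In a subtree that is a single
  trunk edge the two coincide and count once.\<close>

lemma num_leaf_edges_trunk_union:
  "num_leaf_edges (induced (Cat c) W) = card L +
    (if a < b then
       (if b = Suc a \<and> L = {} then 1
        else (if \<forall>j. (a, j) \<notin> L then 1 else 0) + (if \<forall>j. (b, j) \<notin> L then 1 else 0))
     else 0)"
proof -
  \<comment> \<open>An edge is named by its end farther from the root, so the first trunk edge is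
    \<open>(Suc a, 0)\<close> and the last one \<open>(b, 0)\<close>.\<close>
  let ?A = "if a < b \<and> (\<forall>j. (a, j) \<notin> L) then {(Suc a, 0)} else {} :: (nat \<times> nat) set"
  let ?B = "if a < b \<and> (\<forall>j. (b, j) \<notin> L) then {(b, 0)} else {} :: (nat \<times> nat) set"
  have Lij: "(i, j) \<in> L \<Longrightarrow> a \<le> i \<and> i \<le> b \<and> 0 < j" for i j using L by auto
  have "v \<in> W \<and> parent v \<in> W \<and> v \<noteq> parent v \<and> (leaf (induced (Cat c) W) v \<or> leaf (induced (Cat c) W) (parent v))
    \<longleftrightarrow> v \<in> L \<union> (?A \<union> ?B)" for v
  proof (cases "v \<in> W \<and> parent v \<in> W \<and> v \<noteq> parent v")
    case False
    then have "v \<notin> (\<lambda>i. (i, 0)) ` {a<..b} \<union> L" using trunk_union_edge_iff by blast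
    then show ?thesis using False by auto
  next
    case True
    then consider "v \<in> L" | i where "v = (i, 0)" "a < i" "i \<le> b" using trunk_union_edge_iff by auto
    then show ?thesis
    proof cases
      case 1
      then show ?thesis using True leaf_trunk_union(1) by (cases v) auto
    next
      case 2
      then have "leaf (induced (Cat c) W) v \<longleftrightarrow> v \<in> ?B"
        using leaf_trunk_union(2)[of i] by auto
      moreover have "leaf (induced (Cat c) W) (parent v) \<longleftrightarrow> v \<in> ?A"
        using leaf_trunk_union(3)[of "i - 1"] 2 by auto
      moreover have "v \<notin> L" using Lij 2 by auto
      ultimately show ?thesis using True by blast
    qed
  qed
  then have "{v \<in> W. parent v \<in> W \<and> v \<noteq> parent v \<and>
      (leaf (induced (Cat c) W) v \<or> leaf (induced (Cat c) W) (parent v))} = L \<union> (?A \<union> ?B)" by blast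
  moreover have "card (L \<union> (?A \<union> ?B)) = card L + card (?A \<union> ?B)"
    using finite_subset[OF L finite_leaves] Lij by (intro card_Un_disjoint) auto
  moreover have "L = {}" if "b = Suc a" "\<forall>j. (a, j) \<notin> L" "\<forall>j. (b, j) \<notin> L"
  proof -
    have "(i, j) \<notin> L" for i j using that Lij[of i j] le_Suc_eq[of i a] by (metis antisym)
    then show ?thesis by auto
  qed
  then have "card (?A \<union> ?B) = (if a < b then
       (if b = Suc a \<and> L = {} then 1
        else (if \<forall>j. (a, j) \<notin> L then 1 else 0) + (if \<forall>j. (b, j) \<notin> L then 1 else 0))
     else 0)" by (auto simp: card_insert_if)
  ultimately show ?thesis by (simp only: num_leaf_edges_Cat[OF c trunk_union_subset])
qed

end

subsection \<open>The two polynomials of a caterpillar\<close>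

text \<open>Polynomial identities are checked at integer points, where one can divide by
  \<open>y + z\<close> in the rationals and substitute for \<open>y\<close>. The outer variable is
  evaluated first, at a constant polynomial.\<close>

definition eval2 :: "int \<Rightarrow> int \<Rightarrow> int poly poly \<Rightarrow> int" where
  "eval2 y z p = poly (poly p [:z:]) y"

lemma eval2_simps [simp]:
  "eval2 y z var1 = y" "eval2 y z var2 = z" "eval2 y z (p * p') = eval2 y z p * eval2 y z p'"
  "eval2 y z (p ^ n) = eval2 y z p ^ n" "eval2 y z (\<Sum>i\<in>I. f i) = (\<Sum>i\<in>I. eval2 y z (f i))"
  by (simp_all add: eval2_def var1_def var2_def poly_sum)

lemma poly_eqI_infinite:
  fixes p q :: "'a::idom poly"
  assumes "infinite A" "\<And>x. x \<in> A \<Longrightarrow> poly p x = poly q x"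
  shows "p = q"
proof (rule ccontr)
  assume "p \<noteq> q"
  then have "finite {x. poly (p - q) x = 0}" by (intro poly_roots_finite) simp
  moreover have "A \<subseteq> {x. poly (p - q) x = 0}" using assms(2) by auto
  ultimately show False using assms(1) finite_subset by blast
qed

text \<open>\<open>Y\<close> depends on \<open>z\<close> because the values of \<open>y\<close>
  reached by the substitution \<open>1 + z * (r - 1)\<close> do.\<close>

lemma eval2_eqI:
  assumes "infinite Z" "\<And>z. z \<in> Z \<Longrightarrow> infinite (Y z)"
    "\<And>y z. z \<in> Z \<Longrightarrow> y \<in> Y z \<Longrightarrow> eval2 y z p = eval2 y z q"
  shows "p = q"
proof (rule poly_eqI_infinite)
  show "infinite ((\<lambda>z. [:z:]) ` Z)" using assms(1) by (simp add: finite_image_iff inj_on_def)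
  fix x assume "x \<in> (\<lambda>z. [:z:]) ` Z"
  then obtain z where "x = [:z:]" "z \<in> Z" by auto
  then show "poly p x = poly q x"
    using poly_eqI_infinite[OF assms(2), of z "poly p x" "poly q x"] assms(3) by (simp add: eval2_def)
qed

lemma infinite_int_greaterThan: "infinite {n::int<..}"
  using infinite_Ioi by blast

lemma sum_Pow_powers:
  fixes y z :: "'a::comm_ring_1"
  assumes "finite A"
  shows "(\<Sum>L\<in>Pow A. y ^ (card A - card L) * z ^ card L) = (y + z) ^ card A"
proof -
  have "(y + z) ^ card A = (\<Prod>i\<in>A. z + y)" by (simp add: add.commute)
  also have "\<dots> = (\<Sum>L\<in>Pow A. (\<Prod>i\<in>L. z) * (\<Prod>i\<in>A - L. y))" using assms by (rule prod_add)
  also have "\<dots> = (\<Sum>L\<in>Pow A. y ^ (card A - card L) * z ^ card L)"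
    using assms by (intro sum.cong refl) (auto simp: card_Diff_subset finite_subset mult.commute)
  finally show ?thesis by simp
qed

definition intervals :: "nat \<Rightarrow> (nat \<times> nat) set" where
  "intervals k = {(a, b). a \<le> b \<and> b < k}"

lemma finite_intervals': "finite (intervals k)"
  using finite_intervals by (simp add: intervals_def)

lemma sum_intervals: "(\<Sum>(a, b)\<in>intervals k. g a b) = (\<Sum>a<k. \<Sum>b=a..<k. g a b)"
proof -
  have "intervals k = Sigma {..<k} (\<lambda>a. {a..<k})" by (auto simp: intervals_def)
  then show ?thesis by (simp add: sum.Sigma)
qed

lemma card_leaf_verts:
  assumes "composition c"
  shows "card {v \<in> pverts (Cat c). snd v \<noteq> 0} + length c = sum_list c"
proof -
  have "{v \<in> pverts (Cat c). snd v \<noteq> 0} = Sigma {..<length c} (\<lambda>i. {0<..<c ! i})"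
    by (auto simp: pverts_Cat)
  then have "card {v \<in> pverts (Cat c). snd v \<noteq> 0} + length c = (\<Sum>i<length c. c ! i - 1 + 1)"
    by (simp only: sum.distrib card_SigmaI) simp
  also have "\<dots> = (\<Sum>i<length c. c ! i)"
    using assms by (intro sum.cong refl) (auto simp: composition_def)
  finally show ?thesis by (simp add: sum_list_sum_nth atLeast0LessThan)
qed

text \<open>For a fixed trunk, each pendant leaf independently joins the subtree, giving
  \<open>z\<close>, or leaves a boundary edge, giving \<open>y\<close>; hence the power of
  \<open>y + z\<close>. The other factors are the spine edges at and inside the trunk, and the first
  term counts the one-leaf subtrees.\<close>

lemma eval2_half_gen_degree_poly:
  assumes "composition c"
  shows "eval2 y z (half_gen_degree_poly (Cat c)) = (int (sum_list c) - int (length c)) * y +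
    (\<Sum>(a, b)\<in>intervals (length c).
      y ^ ((if 0 < a then 1 else 0) + (if Suc b < length c then 1 else 0)) * z ^ (b - a) *
      (y + z) ^ card (leaves c a b))"
proof -
  let ?e = "\<lambda>a b. (if 0 < a then 1 else 0) + (if Suc b < length c then 1 else (0::nat))"
  let ?F = "\<lambda>S. y ^ num_edges_boundary (Cat c) S * z ^ num_edges_in (Cat c) S"
  let ?l = "{v \<in> pverts (Cat c). snd v \<noteq> 0}"
  have "eval2 y z (half_gen_degree_poly (Cat c)) = (\<Sum>S\<in>subtrees (Cat c). ?F S)"
    by (simp add: half_gen_degree_poly_def)
  also have "\<dots> = (\<Sum>v\<in>?l. ?F (induced (Cat c) {v})) +
    (\<Sum>(a, b)\<in>intervals (length c). \<Sum>L\<in>Pow (leaves c a b). ?F (induced (Cat c) (trunk a b \<union> L)))"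
    unfolding intervals_def by (rule sum_subtrees_Cat[OF assms])
  also have "(\<Sum>v\<in>?l. ?F (induced (Cat c) {v})) = (\<Sum>v\<in>?l. y)"
    using single_leaf_statistics[OF assms] by (intro sum.cong refl) simp
  also have "\<dots> = (int (sum_list c) - int (length c)) * y"
    using card_leaf_verts[OF assms] by simp
  also have "(\<Sum>(a, b)\<in>intervals (length c). \<Sum>L\<in>Pow (leaves c a b). ?F (induced (Cat c) (trunk a b \<union> L))) =
    (\<Sum>(a, b)\<in>intervals (length c). y ^ ?e a b * z ^ (b - a) * (y + z) ^ card (leaves c a b))"
  proof (intro sum.cong refl, clarify)
    fix a b assume "(a, b) \<in> intervals (length c)"
    then have ab: "a \<le> b" "b < length c" by (auto simp: intervals_def)
    have "(\<Sum>L\<in>Pow (leaves c a b). ?F (induced (Cat c) (trunk a b \<union> L))) =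
      (\<Sum>L\<in>Pow (leaves c a b). y ^ ?e a b * z ^ (b - a) * (y ^ (card (leaves c a b) - card L) * z ^ card L))"
      by (intro sum.cong refl)
        (simp only: Pow_iff num_edges_boundary_trunk_union[OF assms ab] num_edges_in_trunk_union[OF assms ab]
          power_add mult_ac)
    then show "(\<Sum>L\<in>Pow (leaves c a b). ?F (induced (Cat c) (trunk a b \<union> L))) =
      y ^ ?e a b * z ^ (b - a) * (y + z) ^ card (leaves c a b)"
      unfolding sum_distrib_left[symmetric] sum_Pow_powers[OF finite_leaves] .
  qed
  finally show ?thesis .
qed

text \<open>The product form treats the two trunk ends independently, which makes the sum over
  \<open>L\<close> computable. A single trunk edge has two bare ends but is one leaf edge, so there
  \<open>r\<^sup>2\<close> is corrected to \<open>r\<close>.\<close>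

lemma eval2_subtree_poly_sum:
  assumes "composition c"
  shows "eval2 q r (subtree_poly (Cat c)) = int (sum_list c) - int (length c) +
    (\<Sum>(a, b)\<in>intervals (length c). \<Sum>L\<in>Pow (leaves c a b).
      q ^ (b - a) * (q * r) ^ card L * (if a < b then
         (if \<forall>j. (a, j) \<notin> L then r else 1) * (if \<forall>j. (b, j) \<notin> L then r else 1)
         - (if b = Suc a \<and> L = {} then r\<^sup>2 - r else 0) else 1))"
proof -
  let ?F = "\<lambda>S. q ^ num_edges_in (Cat c) S * r ^ num_leaf_edges S"
  let ?l = "{v \<in> pverts (Cat c). snd v \<noteq> 0}"
  let ?G = "\<lambda>a b L. q ^ (b - a) * (q * r) ^ card L * (if a < b then
         (if \<forall>j. (a, j) \<notin> L then r else 1) * (if \<forall>j. (b, j) \<notin> L then r else 1)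
         - (if b = Suc a \<and> L = {} then r\<^sup>2 - r else 0) else 1)"
  have "eval2 q r (subtree_poly (Cat c)) = (\<Sum>S\<in>subtrees (Cat c). ?F S)"
    by (simp add: subtree_poly_def)
  also have "\<dots> = (\<Sum>v\<in>?l. ?F (induced (Cat c) {v})) +
    (\<Sum>(a, b)\<in>intervals (length c). \<Sum>L\<in>Pow (leaves c a b). ?F (induced (Cat c) (trunk a b \<union> L)))"
    unfolding intervals_def by (rule sum_subtrees_Cat[OF assms])
  also have "(\<Sum>v\<in>?l. ?F (induced (Cat c) {v})) = (\<Sum>v\<in>?l. 1)"
    using single_leaf_statistics[OF assms] by (intro sum.cong refl) simp
  also have "\<dots> = int (sum_list c) - int (length c)"
    using card_leaf_verts[OF assms] by simp
  also have "(\<Sum>(a, b)\<in>intervals (length c). \<Sum>L\<in>Pow (leaves c a b). ?F (induced (Cat c) (trunk a b \<union> L))) =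
    (\<Sum>(a, b)\<in>intervals (length c). \<Sum>L\<in>Pow (leaves c a b). ?G a b L)"
  proof (intro sum.cong refl, clarify, intro sum.cong refl)
    fix a b L assume "(a, b) \<in> intervals (length c)" "L \<in> Pow (leaves c a b)"
    then have ab: "a \<le> b" "b < length c" "L \<subseteq> leaves c a b" by (auto simp: intervals_def)
    show "?F (induced (Cat c) (trunk a b \<union> L)) = ?G a b L"
      unfolding num_edges_in_trunk_union[OF assms ab] num_leaf_edges_trunk_union[OF assms ab]
      by (cases "b = Suc a \<and> L = {}") (auto simp: power_add power_mult_distrib power2_eq_square)
  qed
  finally show ?thesis .
qed

text \<open>Expanding each factor \<open>1 + u\<close> marks some of the bare ends. A marked end
  forbids its leaves, so \<open>L\<close> ranges over the leaves of the interval shortened at that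
  end.\<close>

lemma sum_Pow_leaves_conditional:
  fixes x u :: "'a::comm_ring_1"
  assumes "a < b"
  shows "(\<Sum>L\<in>Pow (leaves c a b). x ^ card L *
      ((if \<forall>j. (a, j) \<notin> L then 1 + u else 1) * (if \<forall>j. (b, j) \<notin> L then 1 + u else 1))) =
    (1 + x) ^ card (leaves c a b) + u * (1 + x) ^ card (leaves c (Suc a) b) +
    u * (1 + x) ^ card (leaves c a (b - 1)) + u\<^sup>2 * (1 + x) ^ card (leaves c (Suc a) (b - 1))"
proof -
  have Q: "(\<Sum>L\<in>Pow A. x ^ card L) = (1 + x) ^ card A" if "finite A" for A :: "(nat \<times> nat) set"
    using sum_Pow_powers[OF that, of 1 x] by simp
  have fin: "finite (Pow (leaves c a b))" by (simp add: finite_leaves)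
  have restrict: "(\<Sum>L\<in>Pow (leaves c a b). if P L then x ^ card L else 0) = (1 + x) ^ card A"
    if "{L \<in> Pow (leaves c a b). P L} = Pow A" "A \<subseteq> leaves c a b" for P A
  proof -
    have "finite A" using that(2) finite_leaves by (rule finite_subset)
    then show ?thesis unfolding sum.inter_filter[OF fin, symmetric] that(1) by (rule Q)
  qed
  have "(\<Sum>L\<in>Pow (leaves c a b). x ^ card L *
      ((if \<forall>j. (a, j) \<notin> L then 1 + u else 1) * (if \<forall>j. (b, j) \<notin> L then 1 + u else 1))) =
    (\<Sum>L\<in>Pow (leaves c a b). x ^ card L + u * (if \<forall>j. (a, j) \<notin> L then x ^ card L else 0) +
      u * (if \<forall>j. (b, j) \<notin> L then x ^ card L else 0) +
      u\<^sup>2 * (if (\<forall>j. (a, j) \<notin> L) \<and> (\<forall>j. (b, j) \<notin> L) then x ^ card L else 0))"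
    by (intro sum.cong refl) (simp add: algebra_simps power2_eq_square)
  also have "\<dots> = (1 + x) ^ card (leaves c a b) + u * (1 + x) ^ card (leaves c (Suc a) b) +
    u * (1 + x) ^ card (leaves c a (b - 1)) + u\<^sup>2 * (1 + x) ^ card (leaves c (Suc a) (b - 1))"
  proof -
    have "leaves c (Suc a) b = leaves c a b - {v. fst v = a}"
      "leaves c a (b - 1) = leaves c a b - {v. fst v = b}"
      "leaves c (Suc a) (b - 1) = leaves c a b - {v. fst v = a} - {v. fst v = b}"
      using assms by (auto simp: leaves_def)
    then have 1: "{L \<in> Pow (leaves c a b). \<forall>j. (a, j) \<notin> L} = Pow (leaves c (Suc a) b)" "leaves c (Suc a) b \<subseteq> leaves c a b"
      and 2: "{L \<in> Pow (leaves c a b). \<forall>j. (b, j) \<notin> L} = Pow (leaves c a (b - 1))" "leaves c a (b - 1) \<subseteq> leaves c a b"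
      and 3: "{L \<in> Pow (leaves c a b). (\<forall>j. (a, j) \<notin> L) \<and> (\<forall>j. (b, j) \<notin> L)} = Pow (leaves c (Suc a) (b - 1))"
        "leaves c (Suc a) (b - 1) \<subseteq> leaves c a b"
      by auto
    show ?thesis
      unfolding sum.distrib sum_distrib_left[symmetric] restrict[OF 1] restrict[OF 2] restrict[OF 3] Q[OF finite_leaves] ..
  qed
  finally show ?thesis .
qed

lemma sum_if_intervals_reindex:
  assumes "\<And>x. x \<in> intervals k \<Longrightarrow> case_prod P x \<Longrightarrow>
      f x \<in> intervals k \<and> case_prod R (f x) \<and> f' (f x) = x \<and> case_prod h (f x) = case_prod g x"
    and "\<And>x. x \<in> intervals k \<Longrightarrow> case_prod R x \<Longrightarrow> f' x \<in> intervals k \<and> case_prod P (f' x) \<and> f (f' x) = x"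
  shows "(\<Sum>(a, b)\<in>intervals k. if P a b then g a b else 0) =
    (\<Sum>(a, b)\<in>intervals k. if R a b then h a b else (0::'a::comm_monoid_add))"
proof -
  have filt: "(\<Sum>(a, b)\<in>intervals k. if P a b then g a b else 0) =
    (\<Sum>(a, b)\<in>{x \<in> intervals k. case_prod P x}. g a b)" for P and g :: "nat \<Rightarrow> nat \<Rightarrow> 'a"
    by (subst sum.inter_filter[OF finite_intervals']) (intro sum.cong refl, auto)
  have "(\<Sum>x\<in>{x \<in> intervals k. case_prod P x}. case_prod g x) =
    (\<Sum>x\<in>{x \<in> intervals k. case_prod R x}. case_prod h x)"
  proof (rule sum.reindex_bij_witness[of _ f' f])
    fix x assume "x \<in> {x \<in> intervals k. case_prod P x}"
    then have x: "x \<in> intervals k" "case_prod P x" by simp_all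
    show "f' (f x) = x" "f x \<in> {x \<in> intervals k. case_prod R x}" "case_prod h (f x) = case_prod g x"
      using assms(1)[OF x] by simp_all
  next
    fix x assume "x \<in> {x \<in> intervals k. case_prod R x}"
    then have x: "x \<in> intervals k" "case_prod R x" by simp_all
    show "f (f' x) = x" "f' x \<in> {x \<in> intervals k. case_prod P x}"
      using assms(2)[OF x] by simp_all
  qed
  then show ?thesis unfolding filt .
qed

lemma sum_intervals_shift_left:
  "(\<Sum>(a, b)\<in>intervals k. if a < b then g (Suc a) b else 0) =
   (\<Sum>(a, b)\<in>intervals k. if 0 < a then g a b else (0::'a::comm_monoid_add))"
  by (rule sum_if_intervals_reindex[where f = "\<lambda>(a, b). (Suc a, b)" and f' = "\<lambda>(a, b). (a - 1, b)"])
    (auto simp: intervals_def)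

lemma sum_intervals_shift_right:
  "(\<Sum>(a, b)\<in>intervals k. if a < b then g a (b - 1) else 0) =
   (\<Sum>(a, b)\<in>intervals k. if Suc b < k then g a b else (0::'a::comm_monoid_add))"
  by (rule sum_if_intervals_reindex[where f = "\<lambda>(a, b). (a, b - 1)" and f' = "\<lambda>(a, b). (a, Suc b)"])
    (auto simp: intervals_def)

lemma sum_intervals_shift_both:
  "(\<Sum>(a, b)\<in>intervals k. if Suc a < b then g (Suc a) (b - 1) else 0) =
   (\<Sum>(a, b)\<in>intervals k. if 0 < a \<and> Suc b < k then g a b else (0::'a::comm_monoid_add))"
  by (rule sum_if_intervals_reindex[where f = "\<lambda>(a, b). (Suc a, b - 1)" and f' = "\<lambda>(a, b). (a - 1, Suc b)"])
    (auto simp: intervals_def)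

lemma sum_intervals_adjacent:
  "(\<Sum>(a, b)\<in>intervals k. if b = Suc a then m else 0) = of_nat (k - 1) * (m::'a::comm_ring_1)"
proof -
  have "(\<Sum>(a, b)\<in>intervals k. if b = Suc a then m else 0) = (\<Sum>x\<in>{x \<in> intervals k. snd x = Suc (fst x)}. m)"
    by (subst sum.inter_filter[OF finite_intervals']) (simp add: split_def)
  also have "\<dots> = (\<Sum>i<k - 1. m)"
    by (rule sum.reindex_bij_witness[of _ "\<lambda>i. (i, Suc i)" fst]) (auto simp: intervals_def)
  finally show ?thesis by simp
qed

text \<open>A pair of a subtree \<open>S\<close> and a set of \<open>j\<close> edges of its boundary, weighted by \<open>q ^ e(S) * (q * (r - 1)) ^ j\<close>,
  is the same as a larger subtree with a marked set of \<open>j\<close> leaf edges, except that the leaf edge of a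
  single-edge subtree can be marked in two ways.\<close>

lemma eval2_subtree_poly:
  assumes "composition c"
  shows "eval2 q r (subtree_poly (Cat c)) =
    eval2 (1 + q * (r - 1)) q (half_gen_degree_poly (Cat c)) - q * (r - 1) * (int (sum_list c) - 1)"
proof -
  define k n u where kn: "k = length c" "n = int (sum_list c)" "u = r - 1"
  define Q where "Q a b = (1 + q * r) ^ card (leaves c a b)" for a b
  define G where "G a b = q ^ (b - a) * Q a b" for a b
  have k: "0 < k" using assms by (auto simp: kn composition_def)
  have u: "1 + u = r" by (simp add: kn)
  let ?I = "intervals k"
  let ?T = "\<lambda>a b. \<Sum>L\<in>Pow (leaves c a b).
      q ^ (b - a) * (q * r) ^ card L * (if a < b then
         (if \<forall>j. (a, j) \<notin> L then r else 1) * (if \<forall>j. (b, j) \<notin> L then r else 1)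
         - (if b = Suc a \<and> L = {} then r\<^sup>2 - r else 0) else 1)"
  \<comment> \<open>Shortening an interval at one end lowers the power of \<open>q\<close> in
    \<open>G\<close> by 1, hence a factor \<open>q * u\<close> for each marked end.\<close>
  have T: "?T a b = G a b + (q * u) * (if a < b then G (Suc a) b else 0) +
      (q * u) * (if a < b then G a (b - 1) else 0) +
      (q * u)\<^sup>2 * (if Suc a < b then G (Suc a) (b - 1) else 0) -
      (if b = Suc a then q * (r - 1) else 0)" if "a \<le> b" for a b
  proof (cases "a < b")
    case False
    then have "?T a b = (\<Sum>L\<in>Pow (leaves c a b). 1 ^ (card (leaves c a b) - card L) * (q * r) ^ card L)"
      using that by simp
    then show ?thesis using False that unfolding sum_Pow_powers[OF finite_leaves] by (simp add: G_def Q_def)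
  next
    case True
    let ?X = "\<lambda>L. (if \<forall>j. (a, j) \<notin> L then 1 + u else 1) * (if \<forall>j. (b, j) \<notin> L then 1 + u else 1)"
    have "?T a b = (\<Sum>L\<in>Pow (leaves c a b). q ^ (b - a) * ((q * r) ^ card L * ?X L) -
        (if L = {} then (if b = Suc a then q * (r\<^sup>2 - r) else 0) else 0))"
      unfolding u using True by (intro sum.cong refl) (auto simp: algebra_simps)
    also have "\<dots> = q ^ (b - a) * (\<Sum>L\<in>Pow (leaves c a b). (q * r) ^ card L * ?X L) -
        (if b = Suc a then q * (r\<^sup>2 - r) else 0)"
      by (simp add: sum_subtractf sum_distrib_left finite_leaves)
    also have "\<dots> = q ^ (b - a) * (Q a b + u * Q (Suc a) b + u * Q a (b - 1) + u\<^sup>2 * Q (Suc a) (b - 1)) -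
        (if b = Suc a then q * (r\<^sup>2 - r) else 0)"
      unfolding sum_Pow_leaves_conditional[OF True] Q_def ..
    finally have *: "?T a b = \<dots>" .
    obtain d where d: "b = Suc (a + d)" using less_imp_Suc_add[OF True] by auto
    show ?thesis
    proof (cases d)
      \<comment> \<open>Marking both ends of a two-vertex trunk leaves an empty interval and
        contributes \<open>q * u\<^sup>2\<close>; minus the correction
        \<open>q * (r\<^sup>2 - r)\<close> this is \<open>- q * u\<close>, as
        \<open>r = 1 + u\<close>.\<close>
      case 0
      have "leaves c (Suc a) a = {}" by (auto simp: leaves_def)
      then have "Q (Suc a) a = 1" by (simp add: Q_def)
      then show ?thesis unfolding * using d 0 by (simp add: G_def kn algebra_simps power2_eq_square)
    next
      case (Suc e)
      then have "b - a = Suc (Suc e)" "b - Suc a = Suc e" "b - 1 - a = Suc e" "b - 1 - Suc a = e" "Suc a < b"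
        using d by auto
      then show ?thesis unfolding * using True by (simp add: G_def algebra_simps power2_eq_square)
    qed
  qed
  define A B E where ABE: "A = (\<Sum>(a, b)\<in>?I. G a b)"
    "B = (\<Sum>(a, b)\<in>?I. if 0 < a then G a b else 0) + (\<Sum>(a, b)\<in>?I. if Suc b < k then G a b else 0)"
    "E = (\<Sum>(a, b)\<in>?I. if 0 < a \<and> Suc b < k then G a b else 0)"
  have "(\<Sum>(a, b)\<in>?I. ?T a b) = (\<Sum>(a, b)\<in>?I. G a b + (q * u) * (if a < b then G (Suc a) b else 0) +
      (q * u) * (if a < b then G a (b - 1) else 0) +
      (q * u)\<^sup>2 * (if Suc a < b then G (Suc a) (b - 1) else 0) -
      (if b = Suc a then q * (r - 1) else 0))"
    by (intro sum.cong refl) (auto simp only: intervals_def T mem_Collect_eq split_conv)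
  also have "\<dots> = (\<Sum>(a, b)\<in>?I. G a b) + (q * u) * (\<Sum>(a, b)\<in>?I. if a < b then G (Suc a) b else 0) +
      (q * u) * (\<Sum>(a, b)\<in>?I. if a < b then G a (b - 1) else 0) +
      (q * u)\<^sup>2 * (\<Sum>(a, b)\<in>?I. if Suc a < b then G (Suc a) (b - 1) else 0) -
      (\<Sum>(a, b)\<in>?I. if b = Suc a then q * (r - 1) else 0)"
    by (simp add: split_def sum.distrib sum_subtractf sum_distrib_left)
  also have "\<dots> = A + q * u * B + (q * u)\<^sup>2 * E - int (k - 1) * (q * u)"
    unfolding sum_intervals_shift_left sum_intervals_shift_right sum_intervals_shift_both
      sum_intervals_adjacent ABE kn by (simp add: algebra_simps)
  finally have sub: "eval2 q r (subtree_poly (Cat c)) = n - int k + (A + q * u * B + (q * u)\<^sup>2 * E - int (k - 1) * (q * u))"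
    unfolding eval2_subtree_poly_sum[OF assms] kn by simp
  have Y: "(1 + q * u) ^ ((if 0 < a then 1 else 0) + (if Suc b < k then 1 else 0)) * q ^ (b - a) *
      (1 + q * u + q) ^ card (leaves c a b) =
      G a b + q * u * ((if 0 < a then G a b else 0) + (if Suc b < k then G a b else 0)) +
      (q * u)\<^sup>2 * (if 0 < a \<and> Suc b < k then G a b else 0)" for a b
  proof -
    have r: "1 + q * u + q = 1 + q * r" by (simp add: kn algebra_simps)
    have "q ^ (b - a) * (1 + q * u + q) ^ card (leaves c a b) = G a b" unfolding r G_def Q_def ..
    then show ?thesis unfolding mult.assoc by (simp add: power2_eq_square algebra_simps)
  qed
  have "eval2 (1 + q * u) q (half_gen_degree_poly (Cat c)) = (n - int k) * (1 + q * u) + (A + q * u * B + (q * u)\<^sup>2 * E)"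
    unfolding eval2_half_gen_degree_poly[OF assms] kn(1)[symmetric] Y ABE kn(2)
    by (simp add: split_def sum.distrib sum_distrib_left algebra_simps)
  \<comment> \<open>The \<open>k - 1\<close> two-vertex trunks and the \<open>n - k\<close> single
    leaves each contribute \<open>q * u\<close> to the difference, in total once for every edge of
    the tree.\<close>
  then show ?thesis unfolding sub kn(3)[symmetric] kn(2)[symmetric] using k
    by (simp add: algebra_simps of_nat_diff)
qed

text \<open>At \<open>z = 0\<close> only the edgeless subtrees survive, so this counts vertices. It
  makes the polynomial determine the size, which occurs in
  \<open>eval2_subtree_poly\<close>.\<close>

lemma eval2_half_gen_degree_poly_1_0:
  assumes "composition c"
  shows "eval2 1 0 (half_gen_degree_poly (Cat c)) = int (sum_list c)"
proof -
  let ?k = "length c"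
  have "(\<Sum>(a, b)\<in>intervals ?k. 0 ^ (b - a)) = (\<Sum>a<?k. \<Sum>b=a..<?k. 0 ^ (b - a) :: int)"
    by (rule sum_intervals)
  also have "\<dots> = (\<Sum>a<?k. 1)"
  proof (intro sum.cong refl)
    fix a assume "a \<in> {..<?k}"
    then have "(\<Sum>b=a..<?k. 0 ^ (b - a) :: int) = 0 ^ (a - a) + (\<Sum>b=Suc a..<?k. 0 ^ (b - a))"
      by (simp add: sum.atLeast_Suc_lessThan)
    also have "(\<Sum>b=Suc a..<?k. 0 ^ (b - a) :: int) = 0" by (intro sum.neutral) auto
    finally show "(\<Sum>b=a..<?k. 0 ^ (b - a) :: int) = 1" by simp
  qed
  finally show ?thesis unfolding eval2_half_gen_degree_poly[OF assms] by simp
qed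

lemma half_gen_degree_poly_eq_iff_subtree_poly_eq:
  assumes "composition c" "composition c'"
  shows "half_gen_degree_poly (Cat c) = half_gen_degree_poly (Cat c') \<longleftrightarrow>
    subtree_poly (Cat c) = subtree_poly (Cat c')"
proof
  assume D: "half_gen_degree_poly (Cat c) = half_gen_degree_poly (Cat c')"
  then have "sum_list c = sum_list c'"
    using eval2_half_gen_degree_poly_1_0[OF assms(1)] eval2_half_gen_degree_poly_1_0[OF assms(2)] by simp
  then have "eval2 q r (subtree_poly (Cat c)) = eval2 q r (subtree_poly (Cat c'))" for q r
    unfolding eval2_subtree_poly[OF assms(1)] eval2_subtree_poly[OF assms(2)] D by simp
  then show "subtree_poly (Cat c) = subtree_poly (Cat c')"
    by (intro eval2_eqI[of UNIV "\<lambda>_. UNIV"]) (auto simp: infinite_UNIV_int)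
next
  assume S: "subtree_poly (Cat c) = subtree_poly (Cat c')"
  \<comment> \<open>At \<open>q = r = 0\<close> the substitution gives \<open>y = 1\<close> and
    \<open>z = 0\<close>, so the subtree polynomial determines the size too.\<close>
  have "eval2 1 0 (half_gen_degree_poly (Cat c)) = eval2 0 0 (subtree_poly (Cat c))"
    "eval2 1 0 (half_gen_degree_poly (Cat c')) = eval2 0 0 (subtree_poly (Cat c'))"
    unfolding eval2_subtree_poly[OF assms(1)] eval2_subtree_poly[OF assms(2)] by simp_all
  then have "sum_list c = sum_list c'"
    using S eval2_half_gen_degree_poly_1_0[OF assms(1)] eval2_half_gen_degree_poly_1_0[OF assms(2)] by simp
  then have *: "eval2 (1 + q * (r - 1)) q (half_gen_degree_poly (Cat c)) =
      eval2 (1 + q * (r - 1)) q (half_gen_degree_poly (Cat c'))" for q r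
    using eval2_subtree_poly[OF assms(1), of q r] eval2_subtree_poly[OF assms(2), of q r] S by simp
  show "half_gen_degree_poly (Cat c) = half_gen_degree_poly (Cat c')"
  proof (rule eval2_eqI)
    show "infinite {0::int<..}" by (rule infinite_int_greaterThan)
    \<comment> \<open>For \<open>z > 0\<close> the map is injective in \<open>r\<close>; at
      \<open>z = 0\<close> it would reach only \<open>y = 1\<close>.\<close>
    show "infinite (range (\<lambda>r. 1 + z * (r - 1)))" if "z \<in> {0<..}" for z :: int
      using that by (simp add: finite_image_iff inj_on_def infinite_UNIV_int)
    show "eval2 y z (half_gen_degree_poly (Cat c)) = eval2 y z (half_gen_degree_poly (Cat c'))"
      if "z \<in> {0<..}" "y \<in> range (\<lambda>r. 1 + z * (r - 1))" for y z
      using that * by auto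
  qed
qed

subsection \<open>Half-generalized degree polynomials of caterpillars and coarsening sums\<close>

text \<open>The two corrections are added up because both hit the same part when there is only
  one.\<close>

lemma extend_nth:
  assumes "composition \<alpha>"
  shows "length ([1] \<odot> \<alpha> \<odot> [1]) = length \<alpha>"
    and "i < length \<alpha> \<Longrightarrow> ([1] \<odot> \<alpha> \<odot> [1]) ! i =
      \<alpha> ! i + ((if i = 0 then 1 else 0) + (if Suc i = length \<alpha> then 1 else 0))"
proof -
  have ne: "\<alpha> \<noteq> []" using assms by (auto simp: composition_def)
  let ?\<beta> = "butlast \<alpha> @ [last \<alpha> + 1]"
  have eq: "[1] \<odot> \<alpha> \<odot> [1] = (1 + hd ?\<beta>) # tl ?\<beta>" using ne by (simp add: near_concat_def)
  show "length ([1] \<odot> \<alpha> \<odot> [1]) = length \<alpha>" unfolding eq using ne by simp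
  assume i: "i < length \<alpha>"
  have \<beta>: "?\<beta> ! i = \<alpha> ! i + (if Suc i = length \<alpha> then 1 else 0)"
  proof (cases "Suc i = length \<alpha>")
    case True
    then have "i = length \<alpha> - 1" by simp
    then show ?thesis using ne by (simp add: nth_append last_conv_nth)
  next
    case False
    then have "i < length \<alpha> - 1" using i by simp
    then show ?thesis using False by (simp add: nth_append nth_butlast)
  qed
  have "((1 + hd ?\<beta>) # tl ?\<beta>) ! i = (if i = 0 then 1 else 0) + ?\<beta> ! i"
    by (cases i; cases ?\<beta>) auto
  then show "([1] \<odot> \<alpha> \<odot> [1]) ! i = \<alpha> ! i + ((if i = 0 then 1 else 0) + (if Suc i = length \<alpha> then 1 else 0))"
    unfolding eq \<beta> by simp
qed

lemma extend_properties:
  assumes "composition \<alpha>"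
  shows "composition ([1] \<odot> \<alpha> \<odot> [1])" "sum_list ([1] \<odot> \<alpha> \<odot> [1]) = sum_list \<alpha> + 2"
    "2 \<le> hd ([1] \<odot> \<alpha> \<odot> [1])" "2 \<le> last ([1] \<odot> \<alpha> \<odot> [1])"
proof -
  have one: "composition [1]" by (simp add: composition_def)
  note a1 = near_concat_properties[OF assms one]
  note nc = near_concat_properties[OF one a1(1)]
  show c: "composition ([1] \<odot> \<alpha> \<odot> [1])" by (rule nc(1))
  show "sum_list ([1] \<odot> \<alpha> \<odot> [1]) = sum_list \<alpha> + 2" using nc(2) a1(2) by simp
  have ne: "\<alpha> \<noteq> []" "[1] \<odot> \<alpha> \<odot> [1] \<noteq> []" using assms c by (auto simp: composition_def)
  have pos: "0 < \<alpha> ! i" if "i < length \<alpha>" for i using that assms by (auto simp: composition_def)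
  show "2 \<le> hd ([1] \<odot> \<alpha> \<odot> [1])"
    unfolding hd_conv_nth[OF ne(2)] using extend_nth(2)[OF assms, of 0] pos[of 0] ne(1) by simp
  show "2 \<le> last ([1] \<odot> \<alpha> \<odot> [1])"
    unfolding last_conv_nth[OF ne(2)] extend_nth(1)[OF assms]
    using extend_nth(2)[OF assms, of "length \<alpha> - 1"] pos[of "length \<alpha> - 1"] ne(1) by simp
qed

lemma extend_inject:
  assumes "composition \<alpha>" "composition \<beta>" "[1] \<odot> \<alpha> \<odot> [1] = [1] \<odot> \<beta> \<odot> [1]"
  shows "\<alpha> = \<beta>"
proof (rule nth_equalityI)
  show l: "length \<alpha> = length \<beta>" using extend_nth(1)[OF assms(1)] extend_nth(1)[OF assms(2)] assms(3) by simp
  show "\<alpha> ! i = \<beta> ! i" if "i < length \<alpha>" for i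
    using extend_nth(2)[OF assms(1), of i] extend_nth(2)[OF assms(2), of i] assms(3) l that by simp
qed

lemma extend_rev:
  assumes "composition \<alpha>"
  shows "[1] \<odot> rev \<alpha> \<odot> [1] = rev ([1] \<odot> \<alpha> \<odot> [1])"
proof (rule nth_equalityI)
  have c: "composition (rev \<alpha>)" using assms by (simp add: composition_rev)
  show l: "length ([1] \<odot> rev \<alpha> \<odot> [1]) = length (rev ([1] \<odot> \<alpha> \<odot> [1]))"
    using extend_nth(1)[OF assms] extend_nth(1)[OF c] by simp
  show "([1] \<odot> rev \<alpha> \<odot> [1]) ! i = rev ([1] \<odot> \<alpha> \<odot> [1]) ! i" if "i < length ([1] \<odot> rev \<alpha> \<odot> [1])" for i
  proof -
    have i: "i < length \<alpha>" using that extend_nth(1)[OF c] by simp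
    then have j: "length \<alpha> - Suc i < length \<alpha>" by simp
    have "length \<alpha> - Suc i = 0 \<longleftrightarrow> Suc i = length \<alpha>" "Suc (length \<alpha> - Suc i) = length \<alpha> \<longleftrightarrow> i = 0"
      using i by auto
    then have "([1] \<odot> \<alpha> \<odot> [1]) ! (length \<alpha> - Suc i) = ([1] \<odot> rev \<alpha> \<odot> [1]) ! i"
      using extend_nth(2)[OF assms j] extend_nth(2)[OF c, of i] i by (simp add: rev_nth)
    then show ?thesis using i extend_nth(1)[OF assms] by (simp add: rev_nth)
  qed
qed

text \<open>The edges with an end on the trunk \<open>a..b\<close> number 1 plus the sum of
  \<open>\<alpha>\<close> over \<open>a..b\<close>. Adding 1 to the first and the last part is what
  makes this uniform: at an end of the spine an extra leaf replaces the missing boundary edge. So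
  each trunk term is homogeneous in \<open>y\<close> and \<open>z\<close>, and taking out powers of
  \<open>t\<close> turns \<open>y\<close> and \<open>z\<close> into the two probabilities.\<close>

lemma half_gen_degree_poly_conv_coarse_sum:
  assumes "composition \<alpha>" "0 < y" "0 < z"
  defines "t \<equiv> of_int y + of_int z :: rat"
  shows "of_int (eval2 y z (half_gen_degree_poly (Cat ([1] \<odot> \<alpha> \<odot> [1])))) =
    (of_nat (sum_list \<alpha>) + 2 - of_nat (length \<alpha>)) * of_int y +
    t * coarse_sum (of_int y / t) (of_int z / t) (\<lambda>d. t ^ d) \<alpha>"
proof -
  let ?c = "[1] \<odot> \<alpha> \<odot> [1]" and ?k = "length \<alpha>"
  define v w where vw: "v = of_int y / t" "w = of_int z / t"
  have t: "0 < t" using assms by (simp add: t_def)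
  have yz: "of_int y = v * t" "of_int z = w * t" using t by (simp_all add: vw)
  have c: "composition ?c" "length ?c = ?k" using extend_properties extend_nth(1) assms(1) by auto
  let ?e = "\<lambda>a b. (if 0 < a then 1 else 0) + (if Suc b < ?k then 1 else (0::nat))"
  have term_eq: "of_int y ^ ?e a b * of_int z ^ (b - a) * (of_int y + of_int z) ^ card (leaves ?c a b) =
      t * ((if 0 < a then v else 1) * ((if Suc b < ?k then v else 1) * w ^ (b - a) * t ^ (\<Sum>i=a..b. \<alpha> ! i)))"
    if ab: "a \<le> b" "b < ?k" for a b
  proof -
    have "card (leaves ?c a b) + Suc (b - a) = (\<Sum>i=a..b. ?c ! i - 1 + 1)"
      unfolding card_leaves sum.distrib using ab by simp
    also have "\<dots> = (\<Sum>i=a..b. ?c ! i)"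
      using c ab by (intro sum.cong refl) (auto simp: composition_def)
    also have "\<dots> = (\<Sum>i=a..b. \<alpha> ! i + ((if i = 0 then 1 else 0) + (if i = ?k - 1 then 1 else 0)))"
      using ab by (intro sum.cong refl) (subst extend_nth(2)[OF assms(1)], auto)
    also have "\<dots> = (\<Sum>i=a..b. \<alpha> ! i) + ((if a = 0 then 1 else 0) + (if b = ?k - 1 then 1 else 0))"
      unfolding sum.distrib using ab by (auto simp: sum.delta)
    also have "(if a = 0 then 1 else 0::nat) = (if 0 < a then 0 else 1)" by simp
    also have "(if b = ?k - 1 then 1 else 0::nat) = (if Suc b < ?k then 0 else 1)" using ab by auto
    finally have "card (leaves ?c a b) + Suc (b - a) =
      (\<Sum>i=a..b. \<alpha> ! i) + ((if 0 < a then 0 else 1) + (if Suc b < ?k then 0 else 1))" .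
    moreover have "(if P then 1 else 0) + (if Q then 1 else 0) + d + M = Suc s"
      if "M + Suc d = s + ((if P then 0 else 1) + (if Q then 0 else 1))" for P Q and d M s :: nat
      using that by (cases P; cases Q) auto
    ultimately have "?e a b + (b - a) + card (leaves ?c a b) = Suc (\<Sum>i=a..b. \<alpha> ! i)" by blast
    then have *: "t ^ ?e a b * t ^ (b - a) * t ^ card (leaves ?c a b) = t * t ^ (\<Sum>i=a..b. \<alpha> ! i)"
      unfolding power_add[symmetric] power_Suc[symmetric] by (rule arg_cong)
    have "of_int y ^ ?e a b * of_int z ^ (b - a) * (of_int y + of_int z) ^ card (leaves ?c a b) =
      v ^ ?e a b * w ^ (b - a) * (t ^ ?e a b * t ^ (b - a) * t ^ card (leaves ?c a b))"
      unfolding t_def[symmetric] unfolding yz by (simp only: power_mult_distrib mult_ac)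
    then show ?thesis unfolding * by (simp add: mult_ac)
  qed
  have "(of_int (eval2 y z (half_gen_degree_poly (Cat ?c))) :: rat) =
    (of_nat (sum_list \<alpha>) + 2 - of_nat ?k) * of_int y +
    (\<Sum>(a, b)\<in>intervals ?k. of_int y ^ ?e a b * of_int z ^ (b - a) * (of_int y + of_int z) ^ card (leaves ?c a b))"
    unfolding eval2_half_gen_degree_poly[OF c(1)] c(2)
    by (simp add: extend_properties(2)[OF assms(1), simplified] split_def)
  also have "(\<Sum>(a, b)\<in>intervals ?k. of_int y ^ ?e a b * of_int z ^ (b - a) * (of_int y + of_int z) ^ card (leaves ?c a b)) =
    (\<Sum>(a, b)\<in>intervals ?k. t * ((if 0 < a then v else 1) * ((if Suc b < ?k then v else 1) * w ^ (b - a) * t ^ (\<Sum>i=a..b. \<alpha> ! i))))"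
    by (intro sum.cong refl, clarify, rule term_eq) (auto simp: intervals_def)
  also have "\<dots> = t * coarse_sum v w (\<lambda>d. t ^ d) \<alpha>"
    unfolding sum_intervals coarse_sum_conv_intervals sum_distrib_left ..
  finally show ?thesis unfolding vw .
qed

lemma half_gen_degree_poly_eq_if_window_equiv:
  assumes "\<And>w :: rat. window_equiv w \<alpha> \<beta>"
  shows "half_gen_degree_poly (Cat ([1] \<odot> \<alpha> \<odot> [1])) = half_gen_degree_poly (Cat ([1] \<odot> \<beta> \<odot> [1]))"
proof (rule eval2_eqI)
  have c: "composition \<alpha>" "composition \<beta>" and eq: "sum_list \<alpha> = sum_list \<beta>" "length \<alpha> = length \<beta>"
    using assms by (auto simp: window_equiv_def)
  show "infinite {0::int<..}" "infinite {0::int<..}" by (rule infinite_int_greaterThan)+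
  fix y z :: int assume "z \<in> {0<..}" "y \<in> {0<..}"
  then have yz: "0 < y" "0 < z" by auto
  let ?t = "of_int y + of_int z :: rat"
  have "0 < ?t" using yz by simp
  then have "of_int y / ?t + of_int z / ?t = 1" by (simp add: add_divide_distrib[symmetric])
  then have "coarse_sum (of_int y / ?t) (of_int z / ?t) (\<lambda>d. ?t ^ d) \<alpha> =
      coarse_sum (of_int y / ?t) (of_int z / ?t) (\<lambda>d. ?t ^ d) \<beta>"
    by (intro coarse_sum_eq_if_window_equiv assms)
  then have "of_int (eval2 y z (half_gen_degree_poly (Cat ([1] \<odot> \<alpha> \<odot> [1])))) =
      (of_int (eval2 y z (half_gen_degree_poly (Cat ([1] \<odot> \<beta> \<odot> [1])))) :: rat)"
    unfolding half_gen_degree_poly_conv_coarse_sum[OF c(1) yz] half_gen_degree_poly_conv_coarse_sum[OF c(2) yz] eq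
    by simp
  then show "eval2 y z (half_gen_degree_poly (Cat ([1] \<odot> \<alpha> \<odot> [1]))) =
      eval2 y z (half_gen_degree_poly (Cat ([1] \<odot> \<beta> \<odot> [1])))"
    by (simp only: of_int_eq_iff)
qed

subsection \<open>Families of caterpillars\<close>

text \<open>The form with a list of factors serves the irreducible factorizations as well as the
  explicit products behind the last claim.\<close>

lemma switched_caterpillars:
  assumes "\<forall>a\<in>set as. composition a"
  defines "q \<equiv> length (filter (\<lambda>a. \<not> palindrome a) as)" and "\<alpha> \<equiv> circ_list as"
  shows "\<exists>B. finite B \<and> 2 ^ (q - 1) \<le> card B \<and> (\<forall>\<beta>\<in>B. composition \<beta> \<and> H_poly \<beta> = H_poly \<alpha>) \<and>
      pairwise (\<lambda>\<beta> \<gamma>. \<beta> \<noteq> \<gamma> \<and> \<beta> \<noteq> rev \<gamma>) B"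
    and "\<exists>K. finite K \<and> 2 ^ (q - 1) \<le> card K \<and> K \<subseteq> caterpillars \<and>
      Cat ([1] \<odot> \<alpha> \<odot> [1]) \<in> K \<and> pairwise (\<lambda>T T'. \<not> isomorphic T T') K \<and>
      (\<forall>T\<in>K. half_gen_degree_poly T = half_gen_degree_poly (Cat ([1] \<odot> \<alpha> \<odot> [1])) \<and>
             subtree_poly T = subtree_poly (Cat ([1] \<odot> \<alpha> \<odot> [1])))"
proof -
  have as: "composition a" if "a \<in> set as" for a using assms(1) that by blast
  obtain B where B: "finite B" "\<alpha> \<in> B" "2 ^ (q - 1) \<le> card B"
    "pairwise (\<lambda>\<beta> \<gamma>. \<beta> \<noteq> \<gamma> \<and> \<beta> \<noteq> rev \<gamma>) B"
    "\<And>\<beta>. \<beta> \<in> B \<Longrightarrow> \<exists>bs. list_all2 (\<lambda>b a. b = a \<or> b = rev a) bs as \<and> \<beta> = circ_list bs"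
    unfolding q_def \<alpha>_def by (rule switch_representatives[OF as]) blast+
  have equiv_rat: "window_equiv (w::rat) \<beta> \<alpha>" and equiv_mpoly: "window_equiv (w'::int poly poly fract mpoly) \<beta> \<alpha>"
    if "\<beta> \<in> B" for \<beta> w w'
    using B(5)[OF that] window_equiv_circ_list as unfolding \<alpha>_def by blast+
  have comp: "composition \<beta>" if "\<beta> \<in> B" for \<beta>
    using equiv_rat[OF that] by (simp add: window_equiv_def)
  let ?C = "\<lambda>\<beta>. Cat ([1] \<odot> \<beta> \<odot> [1])"
  have inj: "inj_on ?C B"
    by (rule inj_onI) (meson Cat_inject extend_inject extend_properties(1) comp)
  have pw: "pairwise (\<lambda>T T'. \<not> isomorphic T T') (?C ` B)"
  proof (rule pairwiseI)
    fix T T' assume T: "T \<in> ?C ` B" "T' \<in> ?C ` B" "T \<noteq> T'"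
    then obtain \<beta> \<gamma> where bc: "\<beta> \<in> B" "\<gamma> \<in> B" "T = ?C \<beta>" "T' = ?C \<gamma>" "\<beta> \<noteq> \<gamma>" by auto
    show "\<not> isomorphic T T'"
    proof
      assume "isomorphic T T'"
      \<comment> \<open>Extension adds 2 to a positive size, so the single-edge caterpillar does not
        occur.\<close>
      then have "[1] \<odot> \<gamma> \<odot> [1] = [1] \<odot> \<beta> \<odot> [1] \<or> [1] \<odot> \<gamma> \<odot> [1] = rev ([1] \<odot> \<beta> \<odot> [1])"
        using bc comp extend_properties sum_list_pos
        by (intro isomorphic_Cat_imp) (auto simp: Suc_le_eq eval_nat_numeral)
      then have "\<gamma> = \<beta> \<or> \<gamma> = rev \<beta>"
        using extend_inject[OF comp[OF bc(2)]] comp[OF bc(1)] composition_rev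
        unfolding extend_rev[OF comp[OF bc(1)], symmetric] by blast
      then show False using B(4) bc by (auto simp: pairwise_def)
    qed
  qed
  have cat: "?C ` B \<subseteq> caterpillars"
    using extend_properties comp unfolding caterpillars_def by blast
  have D: "half_gen_degree_poly (?C \<beta>) = half_gen_degree_poly (?C \<alpha>)" if "\<beta> \<in> B" for \<beta>
    by (intro half_gen_degree_poly_eq_if_window_equiv equiv_rat that)
  have S: "subtree_poly (?C \<beta>) = subtree_poly (?C \<alpha>)" if "\<beta> \<in> B" for \<beta>
    using half_gen_degree_poly_eq_iff_subtree_poly_eq D[OF that] extend_properties(1) comp[OF that] comp[OF B(2)]
    by blast
  have "\<forall>T\<in>?C ` B. half_gen_degree_poly T = half_gen_degree_poly (?C \<alpha>) \<and> subtree_poly T = subtree_poly (?C \<alpha>)"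
    using D S by blast
  moreover have "finite (?C ` B)" "2 ^ (q - 1) \<le> card (?C ` B)" "?C \<alpha> \<in> ?C ` B"
    using B(1-3) unfolding card_image[OF inj] by blast+
  ultimately show "\<exists>K. finite K \<and> 2 ^ (q - 1) \<le> card K \<and> K \<subseteq> caterpillars \<and>
      ?C \<alpha> \<in> K \<and> pairwise (\<lambda>T T'. \<not> isomorphic T T') K \<and>
      (\<forall>T\<in>K. half_gen_degree_poly T = half_gen_degree_poly (?C \<alpha>) \<and> subtree_poly T = subtree_poly (?C \<alpha>))"
    using pw cat by blast
  have "H_poly \<beta> = H_poly \<alpha>" if "\<beta> \<in> B" for \<beta>
    by (intro H_poly_eq_if_window_equiv equiv_mpoly that)
  then show "\<exists>B. finite B \<and> 2 ^ (q - 1) \<le> card B \<and> (\<forall>\<beta>\<in>B. composition \<beta> \<and> H_poly \<beta> = H_poly \<alpha>) \<and>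
      pairwise (\<lambda>\<beta> \<gamma>. \<beta> \<noteq> \<gamma> \<and> \<beta> \<noteq> rev \<gamma>) B"
    using B comp by blast
qed

lemma window_equiv_if_switching_related:
  assumes "switching_related \<alpha> \<beta>"
  shows "window_equiv w \<alpha> \<beta>"
proof -
  have "window_equiv w \<beta> \<alpha>" if "is_switch_of \<beta> \<alpha>" for \<alpha> \<beta>
    using that window_equiv_circ_list
    unfolding is_switch_of_def irreducible_factorization_def nontrivial_factorization_def factorization_def by blast
  then show ?thesis using assms window_equiv_sym unfolding switching_related_def by blast
qed

theorem theorem6p4:
  "(\<forall>\<alpha> \<beta>. composition \<alpha> \<and> composition \<beta> \<and> switching_related \<alpha> \<beta> \<longrightarrow>
      H_poly \<alpha> = H_poly \<beta> \<and>
      half_gen_degree_poly (Cat ([1] \<odot> \<alpha> \<odot> [1])) = half_gen_degree_poly (Cat ([1] \<odot> \<beta> \<odot> [1])))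
   \<and>
   (\<forall>\<alpha> as q. composition \<alpha> \<and> irreducible_factorization \<alpha> as \<and>
             q = length (filter (\<lambda>a. \<not> palindrome a) as) \<longrightarrow>
      (\<exists>B. finite B \<and> card B \<ge> 2 ^ (q - 1) \<and>
           (\<forall>\<beta>\<in>B. composition \<beta> \<and> H_poly \<beta> = H_poly \<alpha>) \<and>
           pairwise (\<lambda>\<beta> \<gamma>. \<beta> \<noteq> \<gamma> \<and> \<beta> \<noteq> rev \<gamma>) B) \<and>
      (\<exists>K. finite K \<and> card K \<ge> 2 ^ (q - 1) \<and> K \<subseteq> caterpillars \<and>
           Cat ([1] \<odot> \<alpha> \<odot> [1]) \<in> K \<and>
           pairwise (\<lambda>T T'. \<not> isomorphic T T') K \<and>
           (\<forall>T\<in>K. half_gen_degree_poly T = half_gen_degree_poly (Cat ([1] \<odot> \<alpha> \<odot> [1])) \<and>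
                  subtree_poly T = subtree_poly (Cat ([1] \<odot> \<alpha> \<odot> [1])))))
   \<and>
   (\<forall>T\<in>caterpillars. \<forall>T'\<in>caterpillars.
      half_gen_degree_poly T = half_gen_degree_poly T' \<longleftrightarrow> subtree_poly T = subtree_poly T')
   \<and>
   (\<forall>N::nat. \<exists>K. finite K \<and> card K \<ge> N \<and> K \<subseteq> caterpillars \<and>
      pairwise (\<lambda>T T'. \<not> isomorphic T T') K \<and>
      (\<forall>T\<in>K. \<forall>T'\<in>K. half_gen_degree_poly T = half_gen_degree_poly T' \<and>
                     subtree_poly T = subtree_poly T'))"
proof (intro conjI)
  show "\<forall>\<alpha> \<beta>. composition \<alpha> \<and> composition \<beta> \<and> switching_related \<alpha> \<beta> \<longrightarrow>
      H_poly \<alpha> = H_poly \<beta> \<and>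
      half_gen_degree_poly (Cat ([1] \<odot> \<alpha> \<odot> [1])) = half_gen_degree_poly (Cat ([1] \<odot> \<beta> \<odot> [1]))"
    using window_equiv_if_switching_related H_poly_eq_if_window_equiv
      half_gen_degree_poly_eq_if_window_equiv by metis
next
  show "\<forall>\<alpha> as q. composition \<alpha> \<and> irreducible_factorization \<alpha> as \<and>
             q = length (filter (\<lambda>a. \<not> palindrome a) as) \<longrightarrow>
      (\<exists>B. finite B \<and> card B \<ge> 2 ^ (q - 1) \<and>
           (\<forall>\<beta>\<in>B. composition \<beta> \<and> H_poly \<beta> = H_poly \<alpha>) \<and>
           pairwise (\<lambda>\<beta> \<gamma>. \<beta> \<noteq> \<gamma> \<and> \<beta> \<noteq> rev \<gamma>) B) \<and>
      (\<exists>K. finite K \<and> card K \<ge> 2 ^ (q - 1) \<and> K \<subseteq> caterpillars \<and>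
           Cat ([1] \<odot> \<alpha> \<odot> [1]) \<in> K \<and>
           pairwise (\<lambda>T T'. \<not> isomorphic T T') K \<and>
           (\<forall>T\<in>K. half_gen_degree_poly T = half_gen_degree_poly (Cat ([1] \<odot> \<alpha> \<odot> [1])) \<and>
                  subtree_poly T = subtree_poly (Cat ([1] \<odot> \<alpha> \<odot> [1]))))"
  proof (intro allI impI)
    fix \<alpha> as q
    assume *: "composition \<alpha> \<and> irreducible_factorization \<alpha> as \<and> q = length (filter (\<lambda>a. \<not> palindrome a) as)"
    then have as: "\<forall>a\<in>set as. composition a" "\<alpha> = circ_list as"
      unfolding irreducible_factorization_def nontrivial_factorization_def factorization_def by auto
    have q: "q = length (filter (\<lambda>a. \<not> palindrome a) as)" using * by simp
    show "(\<exists>B. finite B \<and> card B \<ge> 2 ^ (q - 1) \<and>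
           (\<forall>\<beta>\<in>B. composition \<beta> \<and> H_poly \<beta> = H_poly \<alpha>) \<and>
           pairwise (\<lambda>\<beta> \<gamma>. \<beta> \<noteq> \<gamma> \<and> \<beta> \<noteq> rev \<gamma>) B) \<and>
      (\<exists>K. finite K \<and> card K \<ge> 2 ^ (q - 1) \<and> K \<subseteq> caterpillars \<and>
           Cat ([1] \<odot> \<alpha> \<odot> [1]) \<in> K \<and>
           pairwise (\<lambda>T T'. \<not> isomorphic T T') K \<and>
           (\<forall>T\<in>K. half_gen_degree_poly T = half_gen_degree_poly (Cat ([1] \<odot> \<alpha> \<odot> [1])) \<and>
                  subtree_poly T = subtree_poly (Cat ([1] \<odot> \<alpha> \<odot> [1]))))"
      unfolding q as(2) by (intro conjI switched_caterpillars as(1))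
  qed
next
  show "\<forall>T\<in>caterpillars. \<forall>T'\<in>caterpillars.
      half_gen_degree_poly T = half_gen_degree_poly T' \<longleftrightarrow> subtree_poly T = subtree_poly T'"
    using half_gen_degree_poly_eq_iff_subtree_poly_eq unfolding caterpillars_def by blast
next
  show "\<forall>N::nat. \<exists>K. finite K \<and> card K \<ge> N \<and> K \<subseteq> caterpillars \<and>
      pairwise (\<lambda>T T'. \<not> isomorphic T T') K \<and>
      (\<forall>T\<in>K. \<forall>T'\<in>K. half_gen_degree_poly T = half_gen_degree_poly T' \<and>
                     subtree_poly T = subtree_poly T')"
  proof
    fix N :: nat
    \<comment> \<open>\<open>[1, 2]\<close> is a smallest composition that is no palindrome; after
      halving, \<open>Suc N\<close> copies still give \<open>2 ^ N\<close> caterpillars.\<close>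
    let ?as = "replicate (Suc N) [1, 2::nat]"
    have as: "\<forall>a\<in>set ?as. composition a" by (auto simp: composition_def)
    let ?T = "Cat ([1] \<odot> circ_list ?as \<odot> [1])"
    have q: "length (filter (\<lambda>a. \<not> palindrome a) ?as) = Suc N" by (simp add: palindrome_def)
    obtain K where K: "finite K" "2 ^ (Suc N - 1) \<le> card K" "K \<subseteq> caterpillars"
      "pairwise (\<lambda>T T'. \<not> isomorphic T T') K"
      and T: "\<forall>T\<in>K. half_gen_degree_poly T = half_gen_degree_poly ?T \<and> subtree_poly T = subtree_poly ?T"
      using switched_caterpillars(2)[OF as, unfolded q] by (elim exE conjE) (rule that)
    have "N < 2 ^ N" by (rule less_exp)
    also have "2 ^ N \<le> card K" using K(2) by simp
    finally have "N \<le> card K" by simp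
    moreover have "\<forall>T\<in>K. \<forall>T'\<in>K. half_gen_degree_poly T = half_gen_degree_poly T' \<and> subtree_poly T = subtree_poly T'"
    proof (intro ballI)
      fix T T' assume "T \<in> K" "T' \<in> K"
      then show "half_gen_degree_poly T = half_gen_degree_poly T' \<and> subtree_poly T = subtree_poly T'"
        using bspec[OF T, of T] bspec[OF T, of T'] by simp
    qed
    ultimately show "\<exists>K. finite K \<and> card K \<ge> N \<and> K \<subseteq> caterpillars \<and>
      pairwise (\<lambda>T T'. \<not> isomorphic T T') K \<and>
      (\<forall>T\<in>K. \<forall>T'\<in>K. half_gen_degree_poly T = half_gen_degree_poly T' \<and>
                     subtree_poly T = subtree_poly T')" using K(1,3,4) by blast
  qed
qed

end
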